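(* Let $\mathbf M_n=(X_{n,ij})_{i,j\in[n]}$ be a real symmetric random (Wigner) matrix whose upper triangular entries $\{X_{n,ij}:1\le i\le j\le n\}$ are i.i.d. with common distribution $\mathcal P$ having a density $f$, mean zero and variance $\sigma^2$, and such that there exists a constant $\beta\in(0,\infty)$ with $\mathbb E_{\mathcal P}|X|^k\le\sigma^kk^{\beta k}$ for all positive integers $k$. Then the problem sequence of minimizing $\boldsymbol v^\top\mathbf M_n\boldsymbol v$ over $\boldsymbol v\in\mathcal S_n$ is stable under small perturbations with perturbation blocks $\mathcal J_n=\{J_{n,(i,j)}:(i,j)\in[n]^2,\ i\le j\}$, where $J_{n,(i,j)}=\{(i,j)\}$ for all $1\le i\le j\le n$.
   Context: Parameter space: $\mathcal S_n=\{\boldsymbol v=(v_1,\dots,v_n)\in\mathbb R^n:\|\boldsymbol v\|_2=1,\ v_1\ge0\}$ with $d_n$ the Euclidean distance. The input index set is $I_n=\{(i,j):1\le i\le j\le n\}$ (upper triangular entries; changing the $(i,j)$ input changes both $X_{n,ij}$ and $X_{n,ji}$), and $\mathbf X^n=(X_{n,ij})_{i\le j}$. The minimizer is almost surely unique, denoted $\widehat{\boldsymbol v}(\mathbf X^n)$ (the unit eigenvector for the smallest eigenvalue). $[n]=\{1,\dots,n\}$; $\mathbb E_{\mathcal P}$ is expectation for $X\sim\mathcal P$. Stability. $\mathcal J_n=\{J_{n,l}:l\in\mathcal L_n\}$ is a finite family of subsets of $I_n$ with union $I_n$; $m_n=\operatorname{card}(\mathcal L_n)$. For each $l$, $\mathbf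 X^{n,l}$ is an independent copy of $\mathbf X^n$ (no further assumption on the joint law over $l$), and $\mathbf X^n_l$ is $\mathbf X^n$ with the coordinates in $J_{n,l}$ replaced by those of $\mathbf X^{n,l}$. For a metric $\mathsf d$, $P(T,\mathsf d,\varepsilon)$ is the largest cardinality of a subset of $T$ with pairwise distances $>\varepsilon$. With $\mathcal O_{n,A}=\{\widehat{\boldsymbol v}(\mathbf X^n_l):l\in A\}$, the sequence is stable under small perturbations with perturbation blocks $\mathcal J_n$ if for any $\varepsilon,\delta>0$ there is $M(\varepsilon,\delta)<\infty$ with $\limsup_{n\to\infty}\mathbb P[\min_{A\subseteq\mathcal L_n:|A|>(1-\varepsilon)m_n}P(\mathcal O_{n,A},d_n,\varepsilon)\ge M(\varepsilon,\delta)]\le\delta$. *)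

theory Defs
  imports "HOL-Probability.Probability"
begin

section \<open>Stability under small perturbations\<close>

text \<open>\<open>\<infinity>\<close> if there are separated subsets of unbounded size.\<close>

definition packing_number :: "'v set \<Rightarrow> ('v \<Rightarrow> 'v \<Rightarrow> real) \<Rightarrow> real \<Rightarrow> enat" where
  "packing_number T d \<epsilon> =
     (SUP S \<in> {S. finite S \<and> S \<subseteq> T \<and> (\<forall>x\<in>S. \<forall>y\<in>S. x \<noteq> y \<longrightarrow> d x y > \<epsilon>)}. enat (card S))"

definition random_vector :: "'i set \<Rightarrow> ('i \<Rightarrow> 'w \<Rightarrow> real) \<Rightarrow> 'w \<Rightarrow> 'i \<Rightarrow> real" where
  "random_vector I X \<omega> = (\<lambda>i\<in>I. X i \<omega>)"

definition independent_copy ::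
  "'w measure \<Rightarrow> 'i set \<Rightarrow> ('i \<Rightarrow> 'w \<Rightarrow> real) \<Rightarrow> ('i \<Rightarrow> 'w \<Rightarrow> real) \<Rightarrow> bool" where
  "independent_copy M I X Y \<longleftrightarrow>
     prob_space.indep_var M
       (Pi\<^sub>M I (\<lambda>_. borel)) (random_vector I X) (Pi\<^sub>M I (\<lambda>_. borel)) (random_vector I Y) \<and>
     distr M (Pi\<^sub>M I (\<lambda>_. borel)) (random_vector I Y) =
     distr M (Pi\<^sub>M I (\<lambda>_. borel)) (random_vector I X)"

definition perturbed_input ::
  "'i set \<Rightarrow> 'i set \<Rightarrow> ('i \<Rightarrow> 'w \<Rightarrow> real) \<Rightarrow> ('i \<Rightarrow> 'w \<Rightarrow> real) \<Rightarrow> 'w \<Rightarrow> 'i \<Rightarrow> real" where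
  "perturbed_input I J X Y = random_vector I (\<lambda>i. if i \<in> J then Y i else X i)"

text \<open>
  The \<open>n\<close>-th problem minimizes \<open>\<psi> n x\<close> over \<open>S n\<close>, with metric \<open>d n\<close> and input
  \<open>x\<close> indexed by \<open>I n\<close>. The blocks are \<open>J n l\<close> for \<open>l \<in> L n\<close>, and \<open>Y n l\<close> is
  the copy of the input \<open>X n\<close> used to resample block \<open>J n l\<close>.

  Since minimizers need only be almost surely unique, the value of \<^const>\<open>arg_min_on\<close>
  on the exceptional null set is an arbitrary choice that need not be measurable.
  The probability is therefore expressed by \<^const>\<open>outer_measure_of\<close>, which agrees with
  \<^const>\<open>emeasure\<close> on measurable events and is insensitive to null sets; plain
  \<^const>\<open>measure\<close> would assign \<open>0\<close> to a non-measurable event.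
\<close>

definition stable_under_small_perturbations ::
  "(nat \<Rightarrow> 'w measure) \<Rightarrow> (nat \<Rightarrow> 'v set) \<Rightarrow> (nat \<Rightarrow> 'v \<Rightarrow> 'v \<Rightarrow> real) \<Rightarrow>
   (nat \<Rightarrow> ('i \<Rightarrow> real) \<Rightarrow> 'v \<Rightarrow> real) \<Rightarrow>
   (nat \<Rightarrow> 'i set) \<Rightarrow> (nat \<Rightarrow> 'l set) \<Rightarrow> (nat \<Rightarrow> 'l \<Rightarrow> 'i set) \<Rightarrow>
   (nat \<Rightarrow> 'i \<Rightarrow> 'w \<Rightarrow> real) \<Rightarrow> (nat \<Rightarrow> 'l \<Rightarrow> 'i \<Rightarrow> 'w \<Rightarrow> real) \<Rightarrow> bool" where
  "stable_under_small_perturbations M S d \<psi> I L J X Y \<longleftrightarrow>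
     (\<forall>n. finite (L n) \<and> (\<Union>l\<in>L n. J n l) = I n) \<and>
     (\<forall>\<epsilon>>0. \<forall>\<delta>>0. \<exists>m::nat.
        limsup (\<lambda>n. outer_measure_of (M n)
          {\<omega> \<in> space (M n).
             (INF A \<in> {A. A \<subseteq> L n \<and> real (card A) > (1 - \<epsilon>) * real (card (L n))}.
                packing_number
                  ((\<lambda>l. arg_min_on (\<psi> n (perturbed_input (I n) (J n l) (X n) (Y n l) \<omega>)) (S n)) ` A)
                  (d n) \<epsilon>) \<ge> enat m})
        \<le> ennreal \<delta>)"


section \<open>The smallest eigenvector of a Wigner matrix\<close>

text \<open>
  Vectors of dimension \<open>n\<close> are functions on \<open>{1..n}\<close>, extensional so that vectors with
  the same coordinates are equal.
\<close>

definition half_sphere :: "nat \<Rightarrow> (nat \<Rightarrow> real) set" where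
  "half_sphere n = {v \<in> {1..n} \<rightarrow>\<^sub>E UNIV. L2_set v {1..n} = 1 \<and> v 1 \<ge> 0}"

definition euclidean_distance :: "nat \<Rightarrow> (nat \<Rightarrow> real) \<Rightarrow> (nat \<Rightarrow> real) \<Rightarrow> real" where
  "euclidean_distance n v w = L2_set (\<lambda>i. v i - w i) {1..n}"

definition upper_triangle :: "nat \<Rightarrow> (nat \<times> nat) set" where
  "upper_triangle n = {(i, j). 1 \<le> i \<and> i \<le> j \<and> j \<le> n}"

definition symmetric_entries :: "(nat \<times> nat \<Rightarrow> real) \<Rightarrow> nat \<Rightarrow> nat \<Rightarrow> real" where
  "symmetric_entries x i j = x (min i j, max i j)"

definition quadratic_form :: "nat \<Rightarrow> (nat \<times> nat \<Rightarrow> real) \<Rightarrow> (nat \<Rightarrow> real) \<Rightarrow> real" where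
  "quadratic_form n x v = (\<Sum>i\<in>{1..n}. \<Sum>j\<in>{1..n}. v i * symmetric_entries x i j * v j)"

end

theory Submission
  imports Defs
begin

text \<open>
  Let \<open>\<lambda>\<close> be the least eigenvalue and \<open>Q(v) = v\<^sup>T M v - \<lambda> |v|\<^sup>2\<close>, a positive semidefinite form.
  Resampling one entry \<open>(i, j)\<close> changes the energy of a unit vector \<open>v\<close> by \<open>O(|v\<^sub>i v\<^sub>j|)\<close>, which is
  \<open>O(1/n)\<close> for most \<open>(i, j)\<close>; for the new minimizer this holds because it has the same law as the
  old one. So most perturbed minimizers satisfy \<open>Q \<le> O(1/n)\<close>, and it suffices that, with high
  probability, there are no \<open>2K\<close> orthonormal vectors with \<open>Q \<le> O(1/n)\<close>: Gram--Schmidt then puts the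
  perturbed minimizers close to a space of dimension less than \<open>2K\<close>, whose unit ball has bounded
  packing numbers.

  Given \<open>2K\<close> such vectors, combining them in pairs gives \<open>K\<close> that vanish at the first coordinate,
  so the minor without the first row and column has \<open>K\<close> orthonormal near-minimizers \<open>w\<^sub>k\<close> chosen
  independently of the first row \<open>a\<close>. By Cauchy--Schwarz for \<open>Q\<close>,
  \<open>(a \<bullet> w\<^sub>k)\<^sup>2 = Q(e\<^sub>1, w\<^sub>k)\<^sup>2 \<le> Q(e\<^sub>1) Q(w\<^sub>k)\<close>, which is \<open>o(1)\<close> because \<open>\<lambda> = o(n)\<close> (from
  \<open>E tr M\<^sup>4 = O(n\<^sup>3)\<close>). But \<open>\<Sum>\<^sub>k (a \<bullet> w\<^sub>k)\<^sup>2\<close> has mean \<open>K \<sigma>\<^sup>2\<close> and variance \<open>O(K)\<close>, so by Chebyshev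
  this has probability \<open>O(1/K)\<close>.
\<close>


section \<open>Semi-inner products on coordinate vectors\<close>

text \<open>Two points shape the proof. That \<open>|v_i v_j|\<close> is O(1/n) for most pairs is
  itself derived from the scarcity of near-minimizers: off an unlikely event they all lie within 1 /
  sqrt n of one space of dimension less than 2K, and the diagonal of the projection onto it sums to
  less than 2K, so only a small fraction of the coordinates can be large. The second point is
  measurability. Minimizers and the vectors w_k come from arbitrary choices, yet the w_k must be
  independent of the first row, and localization must have the same probability for both inputs.
  Both are therefore read off the input rounded to a grid, which takes countably many values, and
  localization is formulated for all near-minimizers at a tolerance that absorbs the rounding error.
  The mesh is a high negative power of n, because a cover of radius 1 / sqrt n multiplies the
  tolerance by (2 sqrt n)^(4K). Sets not shown to be measurable are enclosed in events.\<close>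

locale semi_inner_product =
  fixes B :: "('a \<Rightarrow> real) \<Rightarrow> ('a \<Rightarrow> real) \<Rightarrow> real"
  assumes commute: "B u v = B v u"
    and linear: "B (\<lambda>i. a * u i + b * v i) w = a * B u w + b * B v w"
    and nonneg: "0 \<le> B v v"
begin

lemma linear_right: "B w (\<lambda>i. a * u i + b * v i) = a * B w u + b * B w v"
  using linear[of a u b v w] by (simp add: commute)

lemma sum_left:
  assumes "finite S"
  shows "B (\<lambda>i. \<Sum>j\<in>S. c j * e j i) w = (\<Sum>j\<in>S. c j * B (e j) w)"
  using assms
proof (induction S)
  case empty
  show ?case using linear[of 0 w 0 w w] by simp
next
  case (insert x S)
  have "B (\<lambda>i. \<Sum>j\<in>insert x S. c j * e j i) w
      = B (\<lambda>i. c x * e x i + 1 * (\<Sum>j\<in>S. c j * e j i)) w"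
    using insert by simp
  then show ?case
    using insert linear[of "c x" "e x" 1 "\<lambda>i. \<Sum>j\<in>S. c j * e j i" w] by simp
qed

lemma quadratic_expansion:
  "B (\<lambda>i. a * u i + b * v i) (\<lambda>i. a * u i + b * v i)
   = a\<^sup>2 * B u u + 2 * a * b * B u v + b\<^sup>2 * B v v"
  by (simp add: linear linear_right commute[of v u] power2_eq_square algebra_simps)

lemma Cauchy_Schwarz: "(B u v)\<^sup>2 \<le> B u u * B v v"
proof (cases "B v v = 0")
  case True
  have "B u v = 0"
  proof (rule ccontr)
    assume ne: "B u v \<noteq> 0"
    \<comment> \<open>The value of \<open>t\<close> at which the affine expression equals
      -1.\<close>
    define t where "t = - (B u u + 1) / (2 * B u v)"
    have "0 \<le> B u u + 2 * t * B u v"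
      using nonneg[of "\<lambda>i. 1 * u i + t * v i"] quadratic_expansion[of 1 u t v] True by simp
    moreover have "2 * t * B u v = - (B u u + 1)" using ne by (simp add: t_def)
    ultimately show False by linarith
  qed
  then show ?thesis using True by simp
next
  case False
  then have pos: "0 < B v v" using nonneg[of v] by simp
  have "0 \<le> B v v * (B u u * B v v - (B u v)\<^sup>2)"
    using nonneg[of "\<lambda>i. B v v * u i + (- B u v) * v i"]
      quadratic_expansion[of "B v v" u "- B u v" v]
    by (simp add: power2_eq_square algebra_simps)
  then show ?thesis using pos by (simp add: zero_le_mult_iff)
qed

lemma sqrt_triangle:
  "sqrt (B (\<lambda>i. a * u i + b * v i) (\<lambda>i. a * u i + b * v i))
   \<le> \<bar>a\<bar> * sqrt (B u u) + \<bar>b\<bar> * sqrt (B v v)"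
proof (rule real_le_lsqrt)
  have "\<bar>B u v\<bar> \<le> sqrt (B u u) * sqrt (B v v)"
    using real_sqrt_le_mono[OF Cauchy_Schwarz[of u v]] by (simp add: real_sqrt_mult)
  then have "\<bar>a\<bar> * \<bar>b\<bar> * \<bar>B u v\<bar> \<le> \<bar>a\<bar> * \<bar>b\<bar> * (sqrt (B u u) * sqrt (B v v))"
    by (intro mult_left_mono) auto
  moreover have "a * b * B u v \<le> \<bar>a\<bar> * \<bar>b\<bar> * \<bar>B u v\<bar>"
    by (metis abs_ge_self abs_mult)
  ultimately have "2 * (a * b * B u v) \<le> 2 * (\<bar>a\<bar> * \<bar>b\<bar> * (sqrt (B u u) * sqrt (B v v)))"
    by linarith
  then show "B (\<lambda>i. a * u i + b * v i) (\<lambda>i. a * u i + b * v i)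
    \<le> (\<bar>a\<bar> * sqrt (B u u) + \<bar>b\<bar> * sqrt (B v v))\<^sup>2"
    unfolding quadratic_expansion
    by (simp add: power2_sum power_mult_distrib nonneg algebra_simps)
qed (simp add: nonneg)

lemma sqrt_sum_le:
  assumes "finite S"
  shows "sqrt (B (\<lambda>i. \<Sum>j\<in>S. c j * e j i) (\<lambda>i. \<Sum>j\<in>S. c j * e j i))
    \<le> (\<Sum>j\<in>S. \<bar>c j\<bar> * sqrt (B (e j) (e j)))"
  using assms
proof (induction S)
  case empty
  show ?case using linear[of 0 "\<lambda>_. 0" 0 "\<lambda>_. 0" "\<lambda>_. 0"] by simp
next
  case (insert x S)
  have "sqrt (B (\<lambda>i. \<Sum>j\<in>insert x S. c j * e j i) (\<lambda>i. \<Sum>j\<in>insert x S. c j * e j i))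
      = sqrt (B (\<lambda>i. c x * e x i + 1 * (\<Sum>j\<in>S. c j * e j i))
                (\<lambda>i. c x * e x i + 1 * (\<Sum>j\<in>S. c j * e j i)))"
    using insert by simp
  also have "\<dots> \<le> \<bar>c x\<bar> * sqrt (B (e x) (e x)) + \<bar>1\<bar> *
      sqrt (B (\<lambda>i. \<Sum>j\<in>S. c j * e j i) (\<lambda>i. \<Sum>j\<in>S. c j * e j i))"
    by (rule sqrt_triangle)
  finally show ?case using insert by simp
qed

end

section \<open>Euclidean inner product, orthonormal families and Gram-Schmidt\<close>

definition ip :: "nat \<Rightarrow> (nat \<Rightarrow> real) \<Rightarrow> (nat \<Rightarrow> real) \<Rightarrow> real" where
  "ip n u v = (\<Sum>i=1..n. u i * v i)"

lemma semi_inner_product_ip: "semi_inner_product (ip n)"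
  by standard (auto simp: ip_def sum.distrib sum_distrib_left algebra_simps intro!: sum_nonneg)

interpretation ip: semi_inner_product "ip n" for n
  by (rule semi_inner_product_ip)

definition orthonormal :: "nat \<Rightarrow> nat \<Rightarrow> (nat \<Rightarrow> nat \<Rightarrow> real) \<Rightarrow> bool" where
  "orthonormal n k e \<longleftrightarrow> (\<forall>i<k. \<forall>j<k. ip n (e i) (e j) = of_bool (i = j))"

definition proj :: "nat \<Rightarrow> nat \<Rightarrow> (nat \<Rightarrow> nat \<Rightarrow> real) \<Rightarrow> (nat \<Rightarrow> real) \<Rightarrow> nat \<Rightarrow> real" where
  "proj n k e v = (\<lambda>i. \<Sum>j<k. ip n v (e j) * e j i)"

text \<open>The coefficients \<open>1\<close> and \<open>- 1\<close> stay explicit so that the term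
  has the shape \<open>a * u i + b * v i\<close> in which linearity, expansion and triangle
  inequality are stated for semi-inner products.\<close>

definition resid :: "nat \<Rightarrow> nat \<Rightarrow> (nat \<Rightarrow> nat \<Rightarrow> real) \<Rightarrow> (nat \<Rightarrow> real) \<Rightarrow> nat \<Rightarrow> real" where
  "resid n k e v = (\<lambda>i. 1 * v i + (- 1) * proj n k e v i)"

lemma ip_proj: "ip n (proj n k e v) w = (\<Sum>j<k. ip n v (e j) * ip n (e j) w)"
  unfolding proj_def by (simp add: ip.sum_left)

lemma ip_proj_basis:
  assumes "orthonormal n k e" "i < k"
  shows "ip n (proj n k e v) (e i) = ip n v (e i)"
proof -
  have "ip n (proj n k e v) (e i) = (\<Sum>j<k. if j = i then ip n v (e j) else 0)"
    unfolding ip_proj using assms by (intro sum.cong) (auto simp: orthonormal_def)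
  then show ?thesis using assms by simp
qed

lemma ip_proj_proj:
  assumes "orthonormal n k e"
  shows "ip n (proj n k e v) (proj n k e v) = (\<Sum>j<k. (ip n v (e j))\<^sup>2)"
proof -
  have "ip n (proj n k e v) (proj n k e v) = (\<Sum>j<k. ip n v (e j) * ip n (proj n k e v) (e j))"
    by (subst ip_proj) (simp add: ip.commute)
  also have "\<dots> = (\<Sum>j<k. (ip n v (e j))\<^sup>2)"
    using assms by (intro sum.cong) (auto simp: ip_proj_basis power2_eq_square)
  finally show ?thesis .
qed

lemma ip_resid_basis:
  assumes "orthonormal n k e" "i < k"
  shows "ip n (resid n k e v) (e i) = 0"
  unfolding resid_def ip.linear using assms by (simp add: ip_proj_basis)

lemma ip_resid_resid:
  assumes "orthonormal n k e"
  shows "ip n (resid n k e v) (resid n k e v) = ip n v v - (\<Sum>j<k. (ip n v (e j))\<^sup>2)"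
proof -
  have "ip n v (proj n k e v) = (\<Sum>j<k. (ip n v (e j))\<^sup>2)"
    unfolding ip.commute[of n v "proj n k e v"] ip_proj power2_eq_square
    by (intro sum.cong refl) (simp add: ip.commute)
  then show ?thesis
    unfolding resid_def ip.quadratic_expansion by (simp add: ip_proj_proj[OF assms])
qed

lemma Bessel:
  assumes "orthonormal n k e"
  shows "(\<Sum>j<k. (ip n v (e j))\<^sup>2) \<le> ip n v v"
  using ip_resid_resid[OF assms, of v] ip.nonneg[of n "resid n k e v"] by simp

lemma abs_ip_orthonormal_le_1:
  assumes "orthonormal n k e" "ip n v v = 1" "j < k"
  shows "\<bar>ip n v (e j)\<bar> \<le> 1"
proof -
  have "(ip n v (e j))\<^sup>2 \<le> ip n v v * ip n (e j) (e j)" by (rule ip.Cauchy_Schwarz)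
  then have "(ip n v (e j))\<^sup>2 \<le> 1" using assms by (simp add: orthonormal_def)
  then show ?thesis by (simp add: abs_square_le_1)
qed

text \<open>This closes the Gram-Schmidt recursion with \<open>b = 2 / \<rho>\<close>: if the
  earlier vectors have seminorms at most \<open>s * b ^ Suc j\<close>, the residual of a new vector
  has seminorm at most \<open>2 * s * b ^ k\<close>, and division by its length, which exceeds
  \<open>\<rho>\<close>, gives \<open>s * b ^ Suc k\<close>.\<close>

lemma one_plus_geometric_le:
  fixes b :: real
  assumes "2 \<le> b"
  shows "1 + (\<Sum>j<k. b ^ Suc j) \<le> 2 * b ^ k"
proof (induction k)
  case (Suc k)
  have "2 * b ^ k \<le> b * b ^ k" using assms by (intro mult_right_mono) auto
  then show ?case using Suc by simp
qed simp

text \<open>Normalized residuals keep a small seminorm: each step costs a factor at most \<open>2 / \<rho>\<close>.\<close>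

lemma orthonormal_or_cover:
  fixes Q :: "(nat \<Rightarrow> real) \<Rightarrow> (nat \<Rightarrow> real) \<Rightarrow> real"
  assumes Q: "semi_inner_product Q" and \<rho>: "0 < \<rho>" "\<rho> \<le> 1"
    and T: "\<And>v. v \<in> T \<Longrightarrow> ip n v v = 1 \<and> sqrt (Q v v) \<le> s"
  shows "(\<exists>e. orthonormal n k e \<and> (\<forall>j<k. sqrt (Q (e j) (e j)) \<le> s * (2 / \<rho>) ^ Suc j)) \<or>
    (\<exists>j<k. \<exists>e. orthonormal n j e \<and> (\<forall>v\<in>T. ip n (resid n j e v) (resid n j e v) \<le> \<rho>\<^sup>2))"
proof (induction k)
  case 0
  show ?case by (auto simp: orthonormal_def)
next
  case (Suc k)
  interpret Q: semi_inner_product Q by (rule Q)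
  show ?case
  proof (cases "\<exists>j<Suc k. \<exists>e. orthonormal n j e \<and> (\<forall>v\<in>T. ip n (resid n j e v) (resid n j e v) \<le> \<rho>\<^sup>2)")
    case False
    then obtain e where e: "orthonormal n k e"
      and small: "\<And>j. j < k \<Longrightarrow> sqrt (Q (e j) (e j)) \<le> s * (2 / \<rho>) ^ Suc j"
      using Suc less_SucI by blast
    \<comment> \<open>The second alternative fails for \<open>j = k\<close> too, so the current
      family does not cover \<open>T\<close>, and some vector of \<open>T\<close> supplies the next
      direction.\<close>
    then obtain v where v: "v \<in> T" and far: "\<rho>\<^sup>2 < ip n (resid n k e v) (resid n k e v)"
      using False by (meson lessI not_le)
    define w where "w = resid n k e v"
    define r where "r = sqrt (ip n w w)"
    have rr: "r * r = ip n w w" by (simp add: r_def ip.nonneg)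
    have r\<rho>: "\<rho> < r" using far \<rho> unfolding r_def w_def by (simp add: real_less_rsqrt)
    have unit: "ip n v v = 1" and Qv: "sqrt (Q v v) \<le> s" using T v by auto
    have s0: "0 \<le> s" using Qv real_sqrt_ge_zero[OF Q.nonneg[of v]] by linarith
    \<comment> \<open>The vanishing summand provides the two-term shape required by the rules for
      semi-inner products.\<close>
    define e' where "e' = e(k := (\<lambda>i. (1 / r) * w i + 0 * w i))"
    have "r \<noteq> 0" using r\<rho> \<rho> by linarith
    have "ip n (e' k) (e' k) = (1 / r)\<^sup>2 * ip n w w"
      using ip.quadratic_expansion[of n "1 / r" w 0 w] by (simp add: e'_def)
    also have "\<dots> = 1"
      unfolding rr[symmetric] using \<open>r \<noteq> 0\<close> by (simp add: power2_eq_square)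
    finally have "ip n (e' k) (e' k) = 1" .
    moreover have "ip n (e' k) (e j) = 0" if "j < k" for j
      using ip_resid_basis[OF e that, of v] ip.linear[of n "1 / r" w 0 w "e j"]
      by (simp add: e'_def w_def)
    moreover from this have "ip n (e j) (e' k) = 0" if "j < k" for j
      using that by (subst ip.commute) simp
    moreover have "e' j = e j" if "j < k" for j using that by (simp add: e'_def)
    ultimately have "orthonormal n (Suc k) e'"
      using e unfolding orthonormal_def by (simp add: less_Suc_eq all_conj_distrib imp_disjL) 
    moreover have "sqrt (Q (e' j) (e' j)) \<le> s * (2 / \<rho>) ^ Suc j" if j: "j < Suc k" for j
    proof (cases "j = k")
      case True
      have "sqrt (Q w w) \<le> \<bar>1\<bar> * sqrt (Q v v) + \<bar>- 1\<bar> * sqrt (Q (proj n k e v) (proj n k e v))"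
        unfolding w_def resid_def by (rule Q.sqrt_triangle)
      also have "\<dots> \<le> s + sqrt (Q (proj n k e v) (proj n k e v))" using Qv by simp
      also have "sqrt (Q (proj n k e v) (proj n k e v))
          \<le> (\<Sum>j<k. \<bar>ip n v (e j)\<bar> * sqrt (Q (e j) (e j)))"
        unfolding proj_def by (rule Q.sqrt_sum_le) simp
      also have "\<dots> \<le> (\<Sum>j<k. 1 * (s * (2 / \<rho>) ^ Suc j))"
        using small abs_ip_orthonormal_le_1[OF e unit] by (intro sum_mono mult_mono) (auto simp: Q.nonneg)
      finally have "sqrt (Q w w) \<le> s * (1 + (\<Sum>j<k. (2 / \<rho>) ^ Suc j))"
        by (simp add: sum_distrib_left algebra_simps)
      also have "\<dots> \<le> s * (2 * (2 / \<rho>) ^ k)"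
        using s0 \<rho> by (intro mult_left_mono one_plus_geometric_le) (auto simp: field_simps)
      finally have *: "sqrt (Q w w) \<le> s * (2 * (2 / \<rho>) ^ k)" .
      have "sqrt (Q (e' j) (e' j)) \<le> \<bar>1 / r\<bar> * sqrt (Q w w) + \<bar>0\<bar> * sqrt (Q w w)"
        unfolding e'_def True using Q.sqrt_triangle[of "1 / r" w 0 w] by simp
      also have "\<dots> \<le> (1 / \<rho>) * (s * (2 * (2 / \<rho>) ^ k))"
        using * r\<rho> \<rho> s0 by (simp only: abs_zero mult_zero_left add_0_right, intro mult_mono)
          (auto simp: field_simps Q.nonneg)
      also have "\<dots> = s * (2 / \<rho>) ^ Suc j" using True by (simp add: field_simps)
      finally show ?thesis .
    next
      case False
      then show ?thesis using small[of j] j by (simp add: e'_def)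
    qed
    ultimately show ?thesis by blast
  qed blast
qed


section \<open>Near-minimizers of the quadratic form\<close>

definition bilinear_form :: "nat \<Rightarrow> (nat \<times> nat \<Rightarrow> real) \<Rightarrow> (nat \<Rightarrow> real) \<Rightarrow> (nat \<Rightarrow> real) \<Rightarrow> real" where
  "bilinear_form n x u v = (\<Sum>i=1..n. \<Sum>j=1..n. u i * symmetric_entries x i j * v j)"

text \<open>Comparison is with all unit vectors, not just those in \<open>half_sphere n\<close>, and
  without reference to an eigenvalue: the set is closed under sign changes, makes no demand on
  coordinates outside \<open>{1..n}\<close>, and is stable under small changes of
  \<open>x\<close>.\<close>

definition near_min :: "nat \<Rightarrow> (nat \<times> nat \<Rightarrow> real) \<Rightarrow> real \<Rightarrow> (nat \<Rightarrow> real) set" where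
  "near_min n x t = {v. ip n v v = 1 \<and>
     (\<forall>w. ip n w w = 1 \<longrightarrow> quadratic_form n x v \<le> quadratic_form n x w + t)}"

text \<open>A substitute for having \<open>k\<close> eigenvalues close to the smallest one:
  eigenvectors for \<open>k\<close> eigenvalues within \<open>t\<close> of it form such a family,
  and conversely such a family puts the \<open>k\<close> smallest eigenvalues within
  \<open>k * t\<close> of it.\<close>

definition degenerate :: "nat \<Rightarrow> nat \<Rightarrow> (nat \<times> nat \<Rightarrow> real) \<Rightarrow> real \<Rightarrow> bool" where
  "degenerate n k x t \<longleftrightarrow> (\<exists>e. orthonormal n k e \<and> (\<forall>j<k. e j \<in> near_min n x t))"

lemma bilinear_form_self: "bilinear_form n x v v = quadratic_form n x v"
  by (simp add: bilinear_form_def quadratic_form_def)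

lemma symmetric_entries_commute: "symmetric_entries x i j = symmetric_entries x j i"
  by (simp add: symmetric_entries_def min.commute max.commute)

lemma bilinear_form_commute: "bilinear_form n x u v = bilinear_form n x v u"
proof -
  have "bilinear_form n x u v = (\<Sum>j=1..n. \<Sum>i=1..n. u i * symmetric_entries x i j * v j)"
    unfolding bilinear_form_def by (rule sum.swap)
  also have "\<dots> = bilinear_form n x v u"
    unfolding bilinear_form_def
    by (intro sum.cong refl, subst symmetric_entries_commute) simp
  finally show ?thesis .
qed

lemma bilinear_form_linear:
  "bilinear_form n x (\<lambda>i. a * u i + b * v i) w = a * bilinear_form n x u w + b * bilinear_form n x v w"
  by (simp add: bilinear_form_def sum.distrib sum_distrib_left algebra_simps)

lemma quadratic_form_cong:
  assumes "\<And>i. i \<in> {1..n} \<Longrightarrow> v i = w i"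
  shows "quadratic_form n x v = quadratic_form n x w"
  unfolding quadratic_form_def using assms by (intro sum.cong refl) auto

lemma ip_cong:
  assumes "\<And>i. i \<in> {1..n} \<Longrightarrow> v i = w i"
  shows "ip n v v = ip n w w"
  unfolding ip_def using assms by (intro sum.cong refl) auto

lemma quadratic_form_scale: "quadratic_form n x (\<lambda>i. c * v i) = c\<^sup>2 * quadratic_form n x v"
  by (simp add: quadratic_form_def sum_distrib_left power2_eq_square algebra_simps)

lemma ip_scale: "ip n (\<lambda>i. c * v i) (\<lambda>i. c * v i) = c\<^sup>2 * ip n v v"
  by (simp add: ip_def sum_distrib_left power2_eq_square algebra_simps)

lemma L2_set_eq_sqrt_ip: "L2_set v {1..n} = sqrt (ip n v v)"
  by (simp add: L2_set_def ip_def power2_eq_square)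

lemma half_sphere_iff:
  "v \<in> half_sphere n \<longleftrightarrow> v \<in> {1..n} \<rightarrow>\<^sub>E UNIV \<and> ip n v v = 1 \<and> v 1 \<ge> 0"
  unfolding half_sphere_def L2_set_eq_sqrt_ip by auto

lemma ip_eq_0D: "ip n v v = 0 \<Longrightarrow> i \<in> {1..n} \<Longrightarrow> v i = 0"
  unfolding ip_def by (subst (asm) sum_nonneg_eq_0_iff) auto

lemma square_le_ip: "i \<in> {1..n} \<Longrightarrow> (v i)\<^sup>2 \<le> ip n v v"
  unfolding ip_def power2_eq_square by (rule member_le_sum) auto

section \<open>Existence of minimizers on the half-sphere\<close>

lemma compactin_half_sphere:
  "compactin (product_topology (\<lambda>_. euclideanreal) {1..n}) (half_sphere n)"
proof -
  let ?T = "product_topology (\<lambda>_. euclideanreal) {1..n}"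
  have cont: "continuous_map ?T euclideanreal (\<lambda>v. v i)" if "i \<in> {1..n}" for i
    using that by (rule continuous_map_product_projection)
  have norm: "continuous_map ?T euclideanreal (\<lambda>v. ip n v v)"
    unfolding ip_def by (intro continuous_intros cont) auto
  have box: "compactin ?T (PiE {1..n} (\<lambda>_. {-1..1}))"
    by (simp add: compactin_PiE)
  have sphere: "closedin ?T {v \<in> topspace ?T. ip n v v \<in> {1}}"
    by (rule closedin_continuous_map_preimage[OF norm]) simp
  have "closedin ?T (half_sphere n)"
  proof (cases "n = 0")
    \<comment> \<open>In dimension 0 the half-sphere is empty, since the empty norm is 0, and
      \<open>1\<close> is not an index of the product.\<close>
    case True
    then show ?thesis by (simp add: half_sphere_def)
  next
    case False
    have "closedin ?T {v \<in> topspace ?T. v 1 \<in> {0..}}"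
      using False by (intro closedin_continuous_map_preimage[OF cont]) auto
    moreover have "half_sphere n =
        {v \<in> topspace ?T. ip n v v \<in> {1}} \<inter> {v \<in> topspace ?T. v 1 \<in> {0..}}"
      by (auto simp: half_sphere_iff PiE_iff extensional_def)
    ultimately show ?thesis using sphere by auto
  qed
  moreover have "half_sphere n \<subseteq> PiE {1..n} (\<lambda>_. {-1..1})"
  proof
    fix v assume v: "v \<in> half_sphere n"
    then have "ip n v v = 1" by (simp add: half_sphere_iff)
    then have "\<bar>v i\<bar> \<le> 1" if "i \<in> {1..n}" for i
      using square_le_ip[OF that, of v] by (simp add: abs_square_le_1)
    then show "v \<in> PiE {1..n} (\<lambda>_. {-1..1})"
      using v by (force simp: half_sphere_def PiE_iff abs_le_iff)
  qed
  ultimately show ?thesis using box closed_compactin by blast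
qed

lemma half_sphere_minimizer:
  assumes "n \<ge> 1"
  obtains v where "v \<in> half_sphere n" "\<And>w. w \<in> half_sphere n \<Longrightarrow> quadratic_form n x v \<le> quadratic_form n x w"
proof -
  let ?T = "product_topology (\<lambda>_. euclideanreal) {1..n}"
  have "continuous_map ?T euclideanreal (quadratic_form n x)"
    unfolding quadratic_form_def
    by (intro continuous_intros continuous_map_product_projection) auto
  then have "compact (quadratic_form n x ` half_sphere n)"
    using image_compactin[OF compactin_half_sphere, of n] by (metis compactin_euclidean_iff)
  moreover have "(\<lambda>i\<in>{1..n}. if i = 1 then 1 else 0) \<in> half_sphere n"
  proof -
    have "ip n (\<lambda>i\<in>{1..n}. if i = 1 then 1 else 0) (\<lambda>i\<in>{1..n}. if i = 1 then 1 else 0)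
        = (\<Sum>i=1..n. if i = 1 then 1 else 0)"
      unfolding ip_def by (intro sum.cong) auto
    then show ?thesis using assms by (simp add: half_sphere_iff)
  qed
  ultimately show ?thesis
    using compact_attains_inf[of "quadratic_form n x ` half_sphere n"] that by blast
qed

text \<open>A change of sign and restriction to \<open>{1..n}\<close> leave the energy unchanged, so
  minimizing over the half-sphere amounts to minimizing over the sphere.\<close>

lemma half_sphere_representative:
  assumes "ip n w w = 1"
  obtains u where "u \<in> half_sphere n" "\<And>x. quadratic_form n x u = quadratic_form n x w"
proof -
  define c :: real where "c = (if w 1 \<ge> 0 then 1 else - 1)"
  define u where "u = (\<lambda>i\<in>{1..n}. c * w i)"
  have n: "n \<ge> 1" using assms by (cases n) (auto simp: ip_def)
  have c: "c\<^sup>2 = 1" by (simp add: c_def)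
  have "ip n u u = ip n (\<lambda>i. c * w i) (\<lambda>i. c * w i)" by (rule ip_cong) (simp add: u_def)
  then have "ip n u u = 1" using assms c by (simp add: ip_scale)
  moreover have "u 1 \<ge> 0" using n by (simp add: u_def c_def)
  ultimately have "u \<in> half_sphere n"
    by (simp add: half_sphere_iff u_def)
  moreover have "quadratic_form n x u = quadratic_form n x w" for x
  proof -
    have "quadratic_form n x u = quadratic_form n x (\<lambda>i. c * w i)"
      by (rule quadratic_form_cong) (simp add: u_def)
    then show ?thesis using c by (simp add: quadratic_form_scale)
  qed
  ultimately show ?thesis using that by blast
qed

text \<open>Existence of a minimizer gives the choice in \<open>arg_min_on\<close> its meaning. From
  here on the argument relies on the chosen vector attaining the minimum, whichever minimizer is
  chosen.\<close>

lemma arg_min_on_near_min: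
  assumes "n \<ge> 1"
  shows "arg_min_on (quadratic_form n x) (half_sphere n) \<in> near_min n x 0"
proof -
  obtain v where "v \<in> half_sphere n"
    "\<And>w. w \<in> half_sphere n \<Longrightarrow> quadratic_form n x v \<le> quadratic_form n x w"
    using half_sphere_minimizer[OF assms] by blast
  then have "is_arg_min (quadratic_form n x) (\<lambda>v. v \<in> half_sphere n) v"
    by (auto simp: is_arg_min_def not_less)
  then have "is_arg_min (quadratic_form n x) (\<lambda>v. v \<in> half_sphere n)
      (arg_min_on (quadratic_form n x) (half_sphere n))"
    unfolding arg_min_on_def arg_min_def
    by (rule someI[where P = "is_arg_min (quadratic_form n x) (\<lambda>v. v \<in> half_sphere n)"])
  then have a: "arg_min_on (quadratic_form n x) (half_sphere n) \<in> half_sphere n"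
    and m: "\<And>w. w \<in> half_sphere n \<Longrightarrow>
      quadratic_form n x (arg_min_on (quadratic_form n x) (half_sphere n)) \<le> quadratic_form n x w"
    by (auto simp: is_arg_min_def not_less)
  have "quadratic_form n x (arg_min_on (quadratic_form n x) (half_sphere n)) \<le> quadratic_form n x w"
    if w: "ip n w w = 1" for w
    using half_sphere_representative[OF w] m by metis
  then show ?thesis using a unfolding near_min_def half_sphere_iff by simp
qed

text \<open>By homogeneity the minimum over unit vectors bounds the Rayleigh quotient of every
  vector of nonzero norm, so subtracting it leaves a positive semidefinite form.\<close>

lemma semi_inner_product_shift:
  assumes v: "v \<in> near_min n x 0"
  shows "semi_inner_product (\<lambda>u w. bilinear_form n x u w - quadratic_form n x v * ip n u w)"
proof
  let ?\<mu> = "quadratic_form n x v"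
  fix u w :: "nat \<Rightarrow> real" and a b :: real
  show "bilinear_form n x u w - ?\<mu> * ip n u w = bilinear_form n x w u - ?\<mu> * ip n w u"
    by (simp add: bilinear_form_commute[of n x u] ip.commute[of n u])
  show "bilinear_form n x (\<lambda>i. a * u i + b * v i) w - ?\<mu> * ip n (\<lambda>i. a * u i + b * v i) w
      = a * (bilinear_form n x u w - ?\<mu> * ip n u w) + b * (bilinear_form n x v w - ?\<mu> * ip n v w)"
    for v by (simp add: bilinear_form_linear ip.linear algebra_simps)
  show "0 \<le> bilinear_form n x u u - ?\<mu> * ip n u u"
  proof (cases "ip n u u = 0")
    case True
    \<comment> \<open>Norm zero means that the coordinates in \<open>{1..n}\<close> vanish;
      \<open>u\<close> itself may be nonzero elsewhere.\<close>
    have "quadratic_form n x u = quadratic_form n x (\<lambda>i. 0 * u i)"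
      by (rule quadratic_form_cong) (use ip_eq_0D[OF True] in simp)
    then show ?thesis
      using True quadratic_form_scale[of n x 0 u] by (simp add: bilinear_form_self)
  next
    case False
    then have pos: "0 < ip n u u" using ip.nonneg[of n u] by simp
    define c where "c = 1 / sqrt (ip n u u)"
    have c2: "c\<^sup>2 = 1 / ip n u u" using pos by (simp add: c_def power_divide)
    then have "ip n (\<lambda>i. c * u i) (\<lambda>i. c * u i) = 1" using pos by (simp add: ip_scale)
    then have "?\<mu> \<le> quadratic_form n x (\<lambda>i. c * u i)" using v by (simp add: near_min_def)
    then show ?thesis using pos by (simp add: quadratic_form_scale c2 bilinear_form_self field_simps)
  qed
qed

lemma near_min_iff:
  assumes v: "v \<in> near_min n x 0" and w: "ip n w w = 1"
  shows "w \<in> near_min n x t \<longleftrightarrow> bilinear_form n x w w - quadratic_form n x v * ip n w w \<le> t"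
proof
  assume "w \<in> near_min n x t"
  then show "bilinear_form n x w w - quadratic_form n x v * ip n w w \<le> t"
    using v w by (auto simp: near_min_def bilinear_form_self)
next
  assume a: "bilinear_form n x w w - quadratic_form n x v * ip n w w \<le> t"
  have "quadratic_form n x w \<le> quadratic_form n x u + t" if "ip n u u = 1" for u
    using a w v that by (fastforce simp: near_min_def bilinear_form_self)
  then show "w \<in> near_min n x t" using w by (simp add: near_min_def)
qed

lemma near_min_mono: "s \<le> t \<Longrightarrow> near_min n x s \<subseteq> near_min n x t"
  by (force simp: near_min_def)

lemma degenerate_mono: "degenerate n k x s \<Longrightarrow> s \<le> t \<Longrightarrow> degenerate n k x t"
  unfolding degenerate_def using near_min_mono by blast

text \<open>Gram-Schmidt in the seminorm of \<open>Q\<close> with \<open>s = sqrt t\<close>. If it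
  ran for \<open>k\<close> steps, all vectors would have seminorm at most
  \<open>sqrt t * (2 / \<rho>) ^ k\<close>; squaring produces the exponent \<open>2 * k\<close> of
  the hypothesis and contradicts nondegeneracy. So it stops earlier, and the vectors found until
  then give the cover.\<close>

lemma near_min_cover:
  assumes n: "n \<ge> 1" and nondeg: "\<not> degenerate n k x t'" and \<rho>: "0 < \<rho>" "\<rho> \<le> 1"
    and t: "0 \<le> t" "t * (2 / \<rho>) ^ (2 * k) \<le> t'"
  obtains j e where "j < k" "orthonormal n j e"
    "\<And>v. v \<in> near_min n x t \<Longrightarrow> ip n (resid n j e v) (resid n j e v) \<le> \<rho>\<^sup>2"
proof -
  define v0 where "v0 = arg_min_on (quadratic_form n x) (half_sphere n)"
  have v0: "v0 \<in> near_min n x 0" unfolding v0_def by (rule arg_min_on_near_min[OF n])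
  define Q where "Q = (\<lambda>u w. bilinear_form n x u w - quadratic_form n x v0 * ip n u w)"
  have Q: "semi_inner_product Q" unfolding Q_def by (rule semi_inner_product_shift[OF v0])
  have T: "ip n v v = 1 \<and> sqrt (Q v v) \<le> sqrt t" if "v \<in> near_min n x t" for v
  proof -
    have u: "ip n v v = 1" using that by (simp add: near_min_def)
    then show ?thesis using near_min_iff[OF v0 u, of t] that by (simp add: Q_def)
  qed
  have "\<not> (\<exists>e. orthonormal n k e \<and> (\<forall>j<k. sqrt (Q (e j) (e j)) \<le> sqrt t * (2 / \<rho>) ^ Suc j))"
  proof
    assume "\<exists>e. orthonormal n k e \<and> (\<forall>j<k. sqrt (Q (e j) (e j)) \<le> sqrt t * (2 / \<rho>) ^ Suc j)"
    then obtain e where e: "orthonormal n k e"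
      and small: "\<And>j. j < k \<Longrightarrow> sqrt (Q (e j) (e j)) \<le> sqrt t * (2 / \<rho>) ^ Suc j" by blast
    have "e j \<in> near_min n x t'" if j: "j < k" for j
    proof -
      have "sqrt (Q (e j) (e j)) \<le> sqrt t * (2 / \<rho>) ^ Suc j" using small j .
      also have "\<dots> \<le> sqrt t * (2 / \<rho>) ^ k"
        using t \<rho> j by (intro mult_left_mono power_increasing) (auto simp: field_simps)
      finally have "(sqrt (Q (e j) (e j)))\<^sup>2 \<le> (sqrt t * (2 / \<rho>) ^ k)\<^sup>2"
        by (intro power_mono) (auto simp: semi_inner_product.nonneg[OF Q])
      also have "\<dots> = t * (2 / \<rho>) ^ (2 * k)"
        using t by (simp add: power_mult_distrib power_mult[symmetric] mult.commute)
      finally have "Q (e j) (e j) \<le> t'"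
        using t(2) semi_inner_product.nonneg[OF Q] by simp
      moreover have "ip n (e j) (e j) = 1" using e j by (simp add: orthonormal_def)
      ultimately show ?thesis using near_min_iff[OF v0] by (simp add: Q_def)
    qed
    then show False using nondeg e unfolding degenerate_def by blast
  qed
  moreover have "(\<exists>e. orthonormal n k e \<and> (\<forall>j<k. sqrt (Q (e j) (e j)) \<le> sqrt t * (2 / \<rho>) ^ Suc j)) \<or>
    (\<exists>j<k. \<exists>e. orthonormal n j e \<and>
      (\<forall>v\<in>near_min n x t. ip n (resid n j e v) (resid n j e v) \<le> \<rho>\<^sup>2))"
    by (rule orthonormal_or_cover[OF Q \<rho> T])
  ultimately obtain j e where "j < k" "orthonormal n j e"
    "\<forall>v\<in>near_min n x t. ip n (resid n j e v) (resid n j e v) \<le> \<rho>\<^sup>2"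
    by auto
  then show ?thesis using that by metis
qed

section \<open>Effect of changing entries on the energy\<close>

lemma square_sum_abs_le:
  assumes "ip n v v = 1"
  shows "(\<Sum>i=1..n. \<bar>v i\<bar>)\<^sup>2 \<le> real n"
proof -
  have "(\<Sum>i=1..n. \<bar>v i\<bar> * 1)\<^sup>2 \<le> (\<Sum>i=1..n. \<bar>v i\<bar>\<^sup>2) * (\<Sum>i=1..n. 1\<^sup>2)"
    by (rule Cauchy_Schwarz_ineq_sum)
  then show ?thesis using assms by (simp add: ip_def power2_eq_square)
qed

text \<open>The error is at most \<open>r\<close> times the square of the l1 norm, which
  Cauchy-Schwarz bounds by \<open>n\<close>. Closeness is demanded on the support of
  \<open>v\<close> alone, so that the estimate also applies to vectors that see just a
  minor.\<close>

lemma quadratic_form_close: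
  assumes v: "ip n v v = 1" and "0 \<le> r"
    and close: "\<And>i j. i \<in> {1..n} \<Longrightarrow> j \<in> {1..n} \<Longrightarrow> v i \<noteq> 0 \<Longrightarrow> v j \<noteq> 0 \<Longrightarrow>
      \<bar>symmetric_entries x i j - symmetric_entries y i j\<bar> \<le> r"
  shows "\<bar>quadratic_form n x v - quadratic_form n y v\<bar> \<le> real n * r"
proof -
  let ?s = "\<lambda>i j. symmetric_entries x i j - symmetric_entries y i j"
  have "quadratic_form n x v - quadratic_form n y v = (\<Sum>i=1..n. \<Sum>j=1..n. v i * ?s i j * v j)"
    by (simp add: quadratic_form_def sum_subtractf algebra_simps)
  also have "\<bar>\<dots>\<bar> \<le> (\<Sum>i=1..n. \<Sum>j=1..n. \<bar>v i * ?s i j * v j\<bar>)"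
    by (intro order_trans[OF sum_abs] sum_mono sum_abs)
  also have "\<dots> \<le> (\<Sum>i=1..n. \<Sum>j=1..n. r * (\<bar>v i\<bar> * \<bar>v j\<bar>))"
  proof (intro sum_mono)
    fix i j assume "i \<in> {1..n}" "j \<in> {1..n}"
    then have "v i \<noteq> 0 \<Longrightarrow> v j \<noteq> 0 \<Longrightarrow> \<bar>?s i j\<bar> * (\<bar>v i\<bar> * \<bar>v j\<bar>) \<le> r * (\<bar>v i\<bar> * \<bar>v j\<bar>)"
      by (intro mult_right_mono close) auto
    then show "\<bar>v i * ?s i j * v j\<bar> \<le> r * (\<bar>v i\<bar> * \<bar>v j\<bar>)"
      by (cases "v i = 0 \<or> v j = 0") (auto simp: abs_mult mult_ac)
  qed
  also have "\<dots> = r * (\<Sum>i=1..n. \<bar>v i\<bar>)\<^sup>2"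
    unfolding power2_eq_square sum_product by (simp add: sum_distrib_left)
  also have "\<dots> \<le> r * real n"
    using square_sum_abs_le[OF v] \<open>0 \<le> r\<close> by (rule mult_left_mono)
  finally show ?thesis by (simp add: mult.commute)
qed

text \<open>The error \<open>n * r\<close> enters twice, at \<open>v\<close> and at the
  competitor.\<close>

lemma near_min_close:
  assumes "0 \<le> r" and close: "\<And>l. l \<in> upper_triangle n \<Longrightarrow> \<bar>x l - y l\<bar> \<le> r"
    and v: "v \<in> near_min n x t"
  shows "v \<in> near_min n y (t + 2 * real n * r)"
proof -
  have c: "\<bar>quadratic_form n x u - quadratic_form n y u\<bar> \<le> real n * r" if "ip n u u = 1" for u
    using that assms(1) by (rule quadratic_form_close)
      (auto simp: symmetric_entries_def upper_triangle_def intro!: close)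
  have v1: "ip n v v = 1" using v by (simp add: near_min_def)
  have "quadratic_form n y v \<le> quadratic_form n y w + (t + 2 * real n * r)" if w: "ip n w w = 1" for w
  proof -
    have "quadratic_form n x v \<le> quadratic_form n x w + t" using v w by (simp add: near_min_def)
    then show ?thesis using c[OF v1] c[OF w] by (simp add: abs_le_iff)
  qed
  then show ?thesis using v1 by (simp add: near_min_def)
qed

lemma quadratic_form_single_entry:
  assumes l: "(i, j) \<in> upper_triangle n"
    and eq: "\<And>l. l \<in> upper_triangle n \<Longrightarrow> l \<noteq> (i, j) \<Longrightarrow> x l = y l"
  shows "\<bar>quadratic_form n x v - quadratic_form n y v\<bar> \<le> 2 * \<bar>x (i, j) - y (i, j)\<bar> * \<bar>v i * v j\<bar>"
proof -
  let ?s = "\<lambda>a b. symmetric_entries x a b - symmetric_entries y a b"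
  let ?D = "\<bar>x (i, j) - y (i, j)\<bar> * \<bar>v i * v j\<bar>"
  have ij: "i \<in> {1..n}" "j \<in> {1..n}" using l by (auto simp: upper_triangle_def)
  have "quadratic_form n x v - quadratic_form n y v = (\<Sum>a=1..n. \<Sum>b=1..n. v a * ?s a b * v b)"
    by (simp add: quadratic_form_def sum_subtractf algebra_simps)
  also have "\<bar>\<dots>\<bar> \<le> (\<Sum>a=1..n. \<Sum>b=1..n. \<bar>v a * ?s a b * v b\<bar>)"
    by (intro order_trans[OF sum_abs] sum_mono sum_abs)
  \<comment> \<open>The entry sits at the positions \<open>(i, j)\<close> and \<open>(j, i)\<close>,
    one indicator for each. On the diagonal these coincide and the entry is counted twice, which is
    harmless.\<close>
  also have "\<dots> \<le> (\<Sum>a=1..n. \<Sum>b=1..n. (if b = j then if a = i then ?D else 0 else 0)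
      + (if b = i then if a = j then ?D else 0 else 0))"
  proof (intro sum_mono)
    fix a b assume "a \<in> {1..n}" "b \<in> {1..n}"
    then have "(min a b, max a b) \<in> upper_triangle n" by (auto simp: upper_triangle_def)
    then have "(min a b, max a b) = (i, j) \<or> ?s a b = 0"
      using eq by (auto simp: symmetric_entries_def)
    then have "a = i \<and> b = j \<or> a = j \<and> b = i \<or> ?s a b = 0"
      by (auto simp: min_def max_def split: if_splits)
    moreover have "?s i j = x (i, j) - y (i, j)" "?s j i = x (i, j) - y (i, j)"
      using l by (auto simp: symmetric_entries_def upper_triangle_def min_def max_def)
    ultimately show "\<bar>v a * ?s a b * v b\<bar> \<le> (if b = j then if a = i then ?D else 0 else 0)
      + (if b = i then if a = j then ?D else 0 else 0)"
      by (auto simp: abs_mult mult_ac simp del: abs_mult_self_eq)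
  qed
  also have "\<dots> = 2 * \<bar>x (i, j) - y (i, j)\<bar> * \<bar>v i * v j\<bar>"
    using ij by (simp add: sum.distrib sum.delta)
  finally show ?thesis .
qed

section \<open>Packing numbers of vectors close to a low-dimensional space\<close>

definition packing_bound :: "real \<Rightarrow> nat \<Rightarrow> nat" where
  "packing_bound \<epsilon> k = nat (2 * \<lceil>2 * (real k + 1) / \<epsilon>\<rceil> + 1) ^ k"

text \<open>Pigeonhole on the coefficients along \<open>e\<close>, rounded to multiples of
  \<open>h\<close>. For two vectors in the same cell the residuals contribute at most
  \<open>2 * \<epsilon> / 4\<close> to the distance and the projections at most
  \<open>k * h\<close>, which is less than \<open>\<epsilon> / 2\<close>. The coefficients lie
  between -1 and 1, so each has at most \<open>2 * m + 1\<close> rounded values; this is the origin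
  of \<open>packing_bound\<close>.\<close>

lemma packing_number_near_subspace:
  assumes e: "orthonormal n j e" and jk: "j \<le> k" and \<epsilon>: "0 < \<epsilon>" and \<rho>: "0 \<le> \<rho>" "\<rho> \<le> \<epsilon> / 4"
    and T: "\<And>v. v \<in> T \<Longrightarrow> ip n v v = 1 \<and> ip n (resid n j e v) (resid n j e v) \<le> \<rho>\<^sup>2"
  shows "packing_number T (euclidean_distance n) \<epsilon> \<le> enat (packing_bound \<epsilon> k)"
  unfolding packing_number_def
proof (rule SUP_least, clarify, simp)
  fix S assume S: "finite S" "S \<subseteq> T" and sep: "\<forall>x\<in>S. \<forall>y\<in>S. x \<noteq> y \<longrightarrow> \<epsilon> < euclidean_distance n x y"
  \<comment> \<open>With \<open>k + 1\<close> in place of \<open>k\<close>, the product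
    \<open>k * h\<close> is strictly below \<open>\<epsilon> / 2\<close>, and \<open>k = 0\<close>
    is no exception.\<close>
  define h where "h = \<epsilon> / (2 * (real k + 1))"
  define m where "m = \<lceil>2 * (real k + 1) / \<epsilon>\<rceil>"
  define g where "g = (\<lambda>v. \<lambda>i\<in>{..<j}. \<lfloor>ip n v (e i) / h\<rfloor>)"
  have h: "0 < h" using \<epsilon> by (simp add: h_def add_nonneg_pos)
  have mh: "1 / h \<le> of_int m" by (simp add: m_def h_def)
  have m0: "0 \<le> m" using \<epsilon> unfolding m_def by (simp add: add_nonneg_pos less_le_trans[of "-1" 0])
  have "inj_on g S"
  proof (rule inj_onI, rule ccontr)
    fix v w assume vw: "v \<in> S" "w \<in> S" and eq: "g v = g w" and ne: "v \<noteq> w"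
    define rv where "rv = resid n j e v"
    define rw where "rw = resid n j e w"
    define p where "p = (\<lambda>a. \<Sum>i<j. (ip n v (e i) - ip n w (e i)) * e i a)"
    define d where "d = (\<lambda>a. 1 * rv a + (- 1) * rw a)"
    have diff: "(\<lambda>a. v a - w a) = (\<lambda>a. 1 * d a + 1 * p a)"
      by (auto simp: d_def p_def rv_def rw_def resid_def proj_def sum_subtractf algebra_simps)
    have res: "sqrt (ip n (resid n j e u) (resid n j e u)) \<le> \<epsilon> / 4" if "u \<in> S" for u
    proof -
      have "sqrt (ip n (resid n j e u) (resid n j e u)) \<le> sqrt (\<rho>\<^sup>2)"
        using T that S by (intro real_sqrt_le_mono) blast
      then show ?thesis using \<rho> by simp
    qed
    have "\<bar>ip n v (e i) - ip n w (e i)\<bar> \<le> h" if "i < j" for i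
    proof -
      have "\<lfloor>ip n v (e i) / h\<rfloor> = \<lfloor>ip n w (e i) / h\<rfloor>"
        using fun_cong[OF eq, of i] that by (simp add: g_def)
      then have "\<bar>ip n v (e i) / h - ip n w (e i) / h\<bar> < 1" by linarith
      then have "\<bar>(ip n v (e i) - ip n w (e i)) / h\<bar> < 1" by (simp add: diff_divide_distrib)
      then show ?thesis using h by (simp add: abs_divide)
    qed
    moreover have "sqrt (ip n (e i) (e i)) = 1" if "i < j" for i using e that by (simp add: orthonormal_def)
    ultimately have "(\<Sum>i<j. \<bar>ip n v (e i) - ip n w (e i)\<bar> * sqrt (ip n (e i) (e i))) \<le> (\<Sum>i<j. h)"
      by (intro sum_mono) auto
    then have "sqrt (ip n p p) \<le> real j * h"
      using ip.sqrt_sum_le[of "{..<j}" n "\<lambda>i. ip n v (e i) - ip n w (e i)" e] by (simp add: p_def)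
    also have "\<dots> \<le> real k * h" using jk h by (intro mult_right_mono) auto
    also have "\<dots> < \<epsilon> / 2" using \<epsilon> by (simp add: h_def field_simps)
    finally have p: "sqrt (ip n p p) < \<epsilon> / 2" .
    have "euclidean_distance n v w = sqrt (ip n (\<lambda>a. v a - w a) (\<lambda>a. v a - w a))"
      unfolding euclidean_distance_def by (rule L2_set_eq_sqrt_ip)
    also have "\<dots> \<le> \<bar>1\<bar> * sqrt (ip n d d) + \<bar>1\<bar> * sqrt (ip n p p)"
      unfolding diff by (rule ip.sqrt_triangle)
    also have "sqrt (ip n d d) \<le> \<bar>1\<bar> * sqrt (ip n rv rv) + \<bar>- 1\<bar> * sqrt (ip n rw rw)"
      unfolding d_def by (rule ip.sqrt_triangle)
    finally have "euclidean_distance n v w < \<epsilon>"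
      using p res[OF vw(1)] res[OF vw(2)] by (simp add: rv_def rw_def)
    then show False using sep vw ne by force
  qed
  moreover have "g ` S \<subseteq> PiE {..<j} (\<lambda>_. {-m..m})"
  proof (clarify)
    fix v assume v: "v \<in> S"
    have "\<lfloor>ip n v (e i) / h\<rfloor> \<in> {-m..m}" if i: "i < j" for i
    proof -
      have "\<bar>ip n v (e i)\<bar> \<le> 1" using abs_ip_orthonormal_le_1[OF e _ i] T v S by blast
      then have "\<bar>ip n v (e i) / h\<bar> \<le> 1 / h" using h by (simp add: abs_divide divide_right_mono)
      then have "\<bar>ip n v (e i) / h\<bar> \<le> of_int m" using mh by linarith
      then have "- of_int m \<le> ip n v (e i) / h" "ip n v (e i) / h \<le> of_int m" by linarith+
      then have "- m \<le> \<lfloor>ip n v (e i) / h\<rfloor>" "\<lfloor>ip n v (e i) / h\<rfloor> \<le> m"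
        by (simp_all add: le_floor_iff floor_le_iff)
      then show ?thesis by simp
    qed
    then show "g v \<in> PiE {..<j} (\<lambda>_. {-m..m})"
      unfolding g_def by (intro restrict_PiE_iff[THEN iffD2] ballI) simp
  qed
  ultimately have "card S \<le> card (PiE {..<j} (\<lambda>_. {-m..m}))"
    by (intro card_inj_on_le[of g]) (auto intro!: finite_PiE)
  also have "\<dots> = nat (2 * m + 1) ^ j" by (simp add: card_PiE algebra_simps)
  also have "\<dots> \<le> nat (2 * m + 1) ^ k" using jk m0 by (intro power_increasing) auto
  finally show "card S \<le> packing_bound \<epsilon> k" by (simp add: packing_bound_def m_def)
qed


section \<open>Pairs of coordinates at which near-minimizers can be large\<close>

lemma finite_upper_triangle [simp]: "finite (upper_triangle n)"
  by (rule finite_subset[of _ "{1..n} \<times> {1..n}"]) (auto simp: upper_triangle_def)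

lemma card_upper_triangle_ge: "real (n\<^sup>2) \<le> 2 * real (card (upper_triangle n))"
proof -
  have "{1..n} \<times> {1..n} \<subseteq> upper_triangle n \<union> prod.swap ` upper_triangle n"
  proof (clarify, rule ccontr)
    fix a b assume *: "a \<in> {1..n}" "b \<in> {1..n}" "(a, b) \<notin> prod.swap ` upper_triangle n" "(a, b) \<notin> upper_triangle n"
    then have "(b, a) \<in> upper_triangle n" by (auto simp: upper_triangle_def)
    then have "prod.swap (b, a) \<in> prod.swap ` upper_triangle n" by (rule imageI)
    then show False using * by simp
  qed
  then have "card ({1..n} \<times> {1..n}) \<le> card (upper_triangle n \<union> prod.swap ` upper_triangle n)"
    by (rule card_mono[rotated]) simp
  also have "\<dots> \<le> card (upper_triangle n) + card (prod.swap ` upper_triangle n)"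
    by (rule card_Un_le)
  also have "\<dots> \<le> card (upper_triangle n) + card (upper_triangle n)"
    by (intro add_left_mono card_image_le) simp
  finally show ?thesis by (simp add: power2_eq_square flip: of_nat_mult)
qed

text \<open>All near-minimizers are covered, not one chosen minimizer. The predicate then depends on
  the input alone, so it can be compared between inputs of equal law, and it controls the minimizer
  of any input close enough to \<open>x\<close>.\<close>

definition localized :: "nat \<Rightarrow> (nat \<times> nat \<Rightarrow> real) \<Rightarrow> real \<Rightarrow> real \<Rightarrow> nat \<times> nat \<Rightarrow> bool" where
  "localized n x t c l \<longleftrightarrow> (\<exists>v\<in>near_min n x t. \<bar>v (fst l) * v (snd l)\<bar> > c / n)"

text \<open>\<open>p i\<close> is the diagonal of the projection onto the span of \<open>e\<close>,
  with trace \<open>j\<close>. The cover gives \<open>(v i)\<^sup>2 \<le> 2 * p i + 2 / n\<close>,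
  so a product above \<open>c / n\<close> needs an index with \<open>p\<close> above
  \<open>(c - 2) / (2 * n)\<close>, and the trace allows at most \<open>2 * n * j / (c - 2)\<close>
  of these. Each lies in at most \<open>2 * n\<close> pairs, and \<open>n\<^sup>2\<close> is at most
  twice the number of blocks.\<close>

lemma card_localized_le:
  assumes n: "n \<ge> 1" and e: "orthonormal n j e" and c: "2 < c"
    and cover: "\<And>v. v \<in> near_min n x t \<Longrightarrow> ip n (resid n j e v) (resid n j e v) \<le> 1 / n"
  shows "card {l \<in> upper_triangle n. localized n x t c l} \<le> 8 * real j / (c - 2) * card (upper_triangle n)"
proof -
  define p where "p i = (\<Sum>k<j. (e k i)\<^sup>2)" for i
  \<comment> \<open>The threshold solves \<open>2 * p + 2 / n = c / n\<close>.\<close>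
  define H where "H = {i \<in> {1..n}. p i > (c - 2) / (2 * n)}"
  have sq: "(v i)\<^sup>2 \<le> 2 * p i + 2 / n" if v: "v \<in> near_min n x t" and i: "i \<in> {1..n}" for v i
  proof -
    have "(resid n j e v i)\<^sup>2 \<le> 1 / n"
      using square_le_ip[OF i, of "resid n j e v"] cover[OF v] by linarith
    moreover have "(proj n j e v i)\<^sup>2 \<le> p i"
    proof -
      have "(proj n j e v i)\<^sup>2 \<le> (\<Sum>k<j. (ip n v (e k))\<^sup>2) * (\<Sum>k<j. (e k i)\<^sup>2)"
        unfolding proj_def by (rule Cauchy_Schwarz_ineq_sum)
      also have "\<dots> \<le> 1 * (\<Sum>k<j. (e k i)\<^sup>2)"
        using Bessel[OF e, of v] v by (intro mult_right_mono) (auto simp: near_min_def intro: sum_nonneg)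
      finally show ?thesis by (simp add: p_def)
    qed
    moreover have "v i = resid n j e v i + proj n j e v i" by (simp add: resid_def)
    moreover have "(a + b)\<^sup>2 \<le> 2 * a\<^sup>2 + 2 * b\<^sup>2" for a b :: real
      using sum_squares_bound[of a b] by (simp add: power2_sum)
    ultimately show ?thesis
      by (smt (verit) add_divide_distrib)
  qed
  have sub: "{l \<in> upper_triangle n. localized n x t c l} \<subseteq> H \<times> {1..n} \<union> {1..n} \<times> H"
  proof
    fix l assume "l \<in> {l \<in> upper_triangle n. localized n x t c l}"
    then obtain a b v where l: "l = (a, b)" and ab: "a \<in> {1..n}" "b \<in> {1..n}"
      and v: "v \<in> near_min n x t" and big: "\<bar>v a * v b\<bar> > c / n"
      by (cases l) (auto simp: upper_triangle_def localized_def)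
    have "a \<in> H \<or> b \<in> H"
    proof (rule ccontr)
      assume "\<not> (a \<in> H \<or> b \<in> H)"
      moreover have eq: "c / n = 2 * ((c - 2) / (2 * n)) + 2 / n" using n by (simp add: field_simps)
      ultimately have "2 * p a + 2 / n \<le> c / n" "2 * p b + 2 / n \<le> c / n"
        using ab unfolding eq by (simp_all add: H_def not_less del: times_divide_eq_right)
      then have "(v a)\<^sup>2 \<le> c / n" "(v b)\<^sup>2 \<le> c / n"
        using sq[OF v ab(1)] sq[OF v ab(2)] by linarith+
      moreover have "2 * \<bar>v a * v b\<bar> \<le> (v a)\<^sup>2 + (v b)\<^sup>2"
        using sum_squares_bound[of "\<bar>v a\<bar>" "\<bar>v b\<bar>"] by (simp add: abs_mult mult.assoc)
      ultimately show False using big by linarith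
    qed
    then show "l \<in> H \<times> {1..n} \<union> {1..n} \<times> H" using l ab by auto
  qed
  have "card {l \<in> upper_triangle n. localized n x t c l} \<le> card (H \<times> {1..n} \<union> {1..n} \<times> H)"
    by (rule card_mono[OF _ sub]) (auto simp: H_def)
  also have "\<dots> \<le> card (H \<times> {1..n}) + card ({1..n} \<times> H)" by (rule card_Un_le)
  also have "\<dots> = 2 * n * card H" by (simp add: card_cartesian_product)
  finally have card: "real (card {l \<in> upper_triangle n. localized n x t c l}) \<le> 2 * n * real (card H)"
    by (metis of_nat_le_iff of_nat_mult of_nat_numeral)
  have "real (card H) * ((c - 2) / (2 * n)) = (\<Sum>i\<in>H. (c - 2) / (2 * n))" by simp
  also have "\<dots> \<le> (\<Sum>i\<in>H. p i)" by (intro sum_mono) (auto simp: H_def)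
  also have "\<dots> \<le> (\<Sum>i=1..n. p i)"
    by (intro sum_mono2) (auto simp: H_def p_def intro: sum_nonneg)
  also have "\<dots> = (\<Sum>k<j. ip n (e k) (e k))"
    unfolding p_def ip_def by (subst sum.swap) (simp add: power2_eq_square)
  also have "\<dots> = real j" using e by (simp add: orthonormal_def)
  finally have "real (card H) \<le> 2 * real n * real j / (c - 2)"
    using c n by (simp add: field_simps)
  then have "2 * n * real (card H) \<le> 2 * n * (2 * real n * real j / (c - 2))"
    by (intro mult_left_mono) auto
  also have "\<dots> = 4 * real j / (c - 2) * real (n\<^sup>2)" by (simp add: power2_eq_square)
  also have "\<dots> \<le> 4 * real j / (c - 2) * (2 * real (card (upper_triangle n)))"
    using c by (intro mult_left_mono card_upper_triangle_ge) auto
  finally show ?thesis using card by simp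
qed

section \<open>Near-minimizers vanishing at the first coordinate\<close>

lemma exists_unit_orthogonal:
  fixes a b :: real
  obtains p q where "p\<^sup>2 + q\<^sup>2 = 1" "p * a + q * b = 0"
proof (cases "a = 0 \<and> b = 0")
  case True
  then show ?thesis using that[of 1 0] by simp
next
  case False
  define r where "r = sqrt (a\<^sup>2 + b\<^sup>2)"
  have "a\<^sup>2 + b\<^sup>2 \<noteq> 0" using False by (simp add: sum_power2_eq_zero_iff)
  then have "r\<^sup>2 = a\<^sup>2 + b\<^sup>2" "r \<noteq> 0" by (auto simp: r_def)
  then have "(b / r)\<^sup>2 + (- a / r)\<^sup>2 = 1"
    by (metis add.commute add_divide_distrib divide_self_if power2_minus power_divide power_not_zero)
  moreover have "b / r * a + (- a / r) * b = 0" by simp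
  ultimately
  show ?thesis using that by blast
qed

text \<open>Rotating each of \<open>K\<close> disjoint pairs of basis vectors kills the first coordinate.\<close>

lemma degenerate_vanishing_first:
  assumes n: "n \<ge> 1" and deg: "degenerate n (2 * K) x t"
  obtains f where "orthonormal n K f" "\<And>k. k < K \<Longrightarrow> f k 1 = 0" "\<And>k. k < K \<Longrightarrow> f k \<in> near_min n x (4 * t)"
proof -
  obtain e where e: "orthonormal n (2 * K) e" and near: "\<And>j. j < 2 * K \<Longrightarrow> e j \<in> near_min n x t"
    using deg unfolding degenerate_def by blast
  have "\<forall>k. \<exists>p q :: real. p\<^sup>2 + q\<^sup>2 = 1 \<and> p * e (2 * k) 1 + q * e (Suc (2 * k)) 1 = 0"
    using exists_unit_orthogonal by metis
  then obtain p q :: "nat \<Rightarrow> real" where pq: "\<And>k. (p k)\<^sup>2 + (q k)\<^sup>2 = 1"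
    "\<And>k. p k * e (2 * k) 1 + q k * e (Suc (2 * k)) 1 = 0" by metis
  define f where "f k = (\<lambda>i. p k * e (2 * k) i + q k * e (Suc (2 * k)) i)" for k
  have orth: "orthonormal n K f"
    unfolding orthonormal_def
  proof (intro allI impI)
    fix i j assume ij: "i < K" "j < K"
    have "ip n (f i) (f j) = p i * p j * ip n (e (2 * i)) (e (2 * j))
        + p i * q j * ip n (e (2 * i)) (e (Suc (2 * j)))
        + q i * p j * ip n (e (Suc (2 * i))) (e (2 * j))
        + q i * q j * ip n (e (Suc (2 * i))) (e (Suc (2 * j)))"
      by (simp add: f_def ip.linear ip.linear_right algebra_simps)
    moreover have "ip n (e a) (e b) = of_bool (a = b)" if "a < 2 * K" "b < 2 * K" for a b
      using e that by (simp add: orthonormal_def)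
    moreover have "2 * i \<noteq> Suc (2 * j)" "Suc (2 * i) \<noteq> 2 * j" by presburger+
    ultimately show "ip n (f i) (f j) = of_bool (i = j)"
      using ij pq(1)[of i] by (auto simp: power2_eq_square)
  qed
  define v0 where "v0 = arg_min_on (quadratic_form n x) (half_sphere n)"
  have v0: "v0 \<in> near_min n x 0" unfolding v0_def by (rule arg_min_on_near_min[OF n])
  define Q where "Q = (\<lambda>u w. bilinear_form n x u w - quadratic_form n x v0 * ip n u w)"
  interpret Q: semi_inner_product Q unfolding Q_def by (rule semi_inner_product_shift[OF v0])
  have "f k \<in> near_min n x (4 * t)" if k: "k < K" for k
  proof -
    have small: "sqrt (Q (e j) (e j)) \<le> sqrt t" if "j < 2 * K" for j
    proof -
      have "ip n (e j) (e j) = 1" using e that by (simp add: orthonormal_def)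
      then show ?thesis using near_min_iff[OF v0] near[OF that] by (simp add: Q_def)
    qed
    have t0: "0 \<le> t" using small[of "2 * k"] Q.nonneg[of "e (2 * k)"] k
      by (smt (verit) mult_less_cancel1 real_sqrt_le_iff real_sqrt_ge_zero zero_less_numeral)
    have "(p k)\<^sup>2 \<le> 1" "(q k)\<^sup>2 \<le> 1" using pq(1)[of k] zero_le_power2[of "p k"] zero_le_power2[of "q k"] by linarith+
    then have le1: "\<bar>p k\<bar> \<le> 1" "\<bar>q k\<bar> \<le> 1" by (simp_all add: abs_square_le_1)
    have "sqrt (Q (f k) (f k)) \<le> \<bar>p k\<bar> * sqrt (Q (e (2 * k)) (e (2 * k)))
        + \<bar>q k\<bar> * sqrt (Q (e (Suc (2 * k))) (e (Suc (2 * k))))"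
      unfolding f_def by (rule Q.sqrt_triangle)
    \<comment> \<open>A seminorm of at most \<open>2 * sqrt t\<close> is the source of the factor 4
      in the conclusion.\<close>
    also have "\<dots> \<le> 1 * sqrt t + 1 * sqrt t"
      using le1 small k by (intro add_mono mult_mono) (auto simp: Q.nonneg)
    finally have "sqrt (Q (f k) (f k)) \<le> 2 * sqrt t" by simp
    then have "(sqrt (Q (f k) (f k)))\<^sup>2 \<le> (2 * sqrt t)\<^sup>2" by (intro power_mono) (auto simp: Q.nonneg)
    then have "Q (f k) (f k) \<le> 4 * t" using t0 by (simp add: Q.nonneg power_mult_distrib)
    moreover have "ip n (f k) (f k) = 1" using orth k by (simp add: orthonormal_def)
    ultimately show ?thesis using near_min_iff[OF v0] by (simp add: Q_def)
  qed
  moreover have "f k 1 = 0" for k using pq(2)[of k] by (simp add: f_def)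
  ultimately show ?thesis using that orth by blast
qed

text \<open>Vectors vanishing at \<open>1\<close> only see the minor obtained by deleting the first row and column.\<close>

definition minor :: "nat \<Rightarrow> (nat \<times> nat) set" where
  "minor n = {(i, j). 2 \<le> i \<and> i \<le> j \<and> j \<le> n}"

text \<open>The competitors \<open>u\<close> vanish at \<open>1\<close> as well, so the predicate
  involves \<open>y\<close> only through its entries in \<open>minor n\<close>. A family
  \<open>w\<close> chosen from these entries is therefore independent of the first row.\<close>

definition minor_near :: "nat \<Rightarrow> nat \<Rightarrow> (nat \<times> nat \<Rightarrow> real) \<Rightarrow> real \<Rightarrow> (nat \<Rightarrow> nat \<Rightarrow> real) \<Rightarrow> bool" where
  "minor_near n K y t w \<longleftrightarrow> orthonormal n K w \<and> (\<forall>k<K. w k 1 = 0) \<and>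
     (\<forall>k<K. \<forall>u. ip n u u = 1 \<and> u 1 = 0 \<longrightarrow> quadratic_form n y (w k) \<le> quadratic_form n y u + t)"

lemma quadratic_form_close_minor:
  assumes "ip n v v = 1" "v 1 = 0" "0 \<le> r"
    and close: "\<And>l. l \<in> minor n \<Longrightarrow> \<bar>x l - y l\<bar> \<le> r"
  shows "\<bar>quadratic_form n x v - quadratic_form n y v\<bar> \<le> real n * r"
proof (rule quadratic_form_close[OF assms(1,3)])
  fix i j assume ij: "i \<in> {1..n}" "j \<in> {1..n}" "v i \<noteq> 0" "v j \<noteq> 0"
  then have "i \<noteq> 1" "j \<noteq> 1" using assms(2) by auto
  then have "(min i j, max i j) \<in> minor n" using ij by (auto simp: minor_def)
  then show "\<bar>symmetric_entries x i j - symmetric_entries y i j\<bar> \<le> r"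
    using close by (auto simp: symmetric_entries_def)
qed

text \<open>A near-minimizer for the whole matrix that vanishes at \<open>1\<close> is one for the
  minor, where there are fewer competitors. The term \<open>4 * t\<close> comes from rotating pairs;
  replacing \<open>x\<close> by \<open>y\<close> costs \<open>n * r\<close> at each end of the
  comparison.\<close>

lemma minor_near_of_degenerate:
  assumes n: "n \<ge> 1" and deg: "degenerate n (2 * K) x t" and r: "0 \<le> r"
    and close: "\<And>l. l \<in> minor n \<Longrightarrow> \<bar>x l - y l\<bar> \<le> r"
  shows "\<exists>w. minor_near n K y (4 * t + 2 * (real n * r)) w"
proof -
  obtain f where f: "orthonormal n K f" "\<And>k. k < K \<Longrightarrow> f k 1 = 0" "\<And>k. k < K \<Longrightarrow> f k \<in> near_min n x (4 * t)"
    using degenerate_vanishing_first[OF n deg] by blast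
  have "quadratic_form n y (f k) \<le> quadratic_form n y u + (4 * t + 2 * (real n * r))"
    if k: "k < K" and u: "ip n u u = 1" "u 1 = 0" for k u
  proof -
    have "ip n (f k) (f k) = 1" using f(3)[OF k] by (simp add: near_min_def)
    then have "\<bar>quadratic_form n x (f k) - quadratic_form n y (f k)\<bar> \<le> real n * r"
      using quadratic_form_close_minor f(2)[OF k] r close by blast
    moreover have "\<bar>quadratic_form n x u - quadratic_form n y u\<bar> \<le> real n * r"
      using quadratic_form_close_minor u r close by blast
    moreover have "quadratic_form n x (f k) \<le> quadratic_form n x u + 4 * t"
      using f(3)[OF k] u by (simp add: near_min_def)
    ultimately show ?thesis by linarith
  qed
  then show ?thesis unfolding minor_near_def using f by blast
qed

text \<open>The \<open>w k\<close> are chosen from \<open>y\<close> alone and need not be related to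
  the vectors \<open>f k\<close>. The latter compete with them in the minor, which shows that the
  minimum there is close to the full one. The errors add up to
  \<open>8 * t + 4 * n * r \<le> 12 * t\<close> for \<open>Q (w k) (w k)\<close>, while
  \<open>Q d d \<le> 2 * c\<close>; Cauchy-Schwarz multiplies the two.\<close>

lemma first_row_small:
  assumes n: "n \<ge> 1" and deg: "degenerate n (2 * K) x t" and r: "0 \<le> r" "real n * r \<le> t"
    and close: "\<And>l. l \<in> minor n \<Longrightarrow> \<bar>x l - y l\<bar> \<le> r"
    and w: "minor_near n K y (4 * t + 2 * (real n * r)) w"
    and norm: "\<And>v. ip n v v = 1 \<Longrightarrow> \<bar>quadratic_form n x v\<bar> \<le> c"
    and k: "k < K"
  shows "(\<Sum>j=1..n. x (1, j) * w k j)\<^sup>2 \<le> 24 * c * t"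
proof -
  obtain f where "orthonormal n K f"
    and f: "\<And>k. k < K \<Longrightarrow> f k 1 = 0" "\<And>k. k < K \<Longrightarrow> f k \<in> near_min n x (4 * t)"
    using degenerate_vanishing_first[OF n deg] by blast
  define v0 where "v0 = arg_min_on (quadratic_form n x) (half_sphere n)"
  have v0: "v0 \<in> near_min n x 0" unfolding v0_def by (rule arg_min_on_near_min[OF n])
  define Q where "Q = (\<lambda>u w. bilinear_form n x u w - quadratic_form n x v0 * ip n u w)"
  interpret Q: semi_inner_product Q unfolding Q_def by (rule semi_inner_product_shift[OF v0])
  define d :: "nat \<Rightarrow> real" where "d = (\<lambda>i. if i = 1 then 1 else 0)"
  have wk: "ip n (w k) (w k) = 1" "w k 1 = 0"
    using w k by (auto simp: minor_near_def orthonormal_def)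
  have fk: "ip n (f k) (f k) = 1" using f(2)[OF k] by (simp add: near_min_def)
  have "\<bar>quadratic_form n x (f k) - quadratic_form n y (f k)\<bar> \<le> real n * r"
    using quadratic_form_close_minor f(1)[OF k] fk r close by blast
  moreover have "\<bar>quadratic_form n x (w k) - quadratic_form n y (w k)\<bar> \<le> real n * r"
    using quadratic_form_close_minor wk r close by blast
  moreover have "quadratic_form n y (w k) \<le> quadratic_form n y (f k) + (4 * t + 2 * (real n * r))"
    using w k fk f(1) by (simp add: minor_near_def)
  moreover have "quadratic_form n x (f k) \<le> quadratic_form n x v0 + 4 * t"
    using f(2)[OF k] v0 by (simp add: near_min_def)
  ultimately have "Q (w k) (w k) \<le> 12 * t"
    using r by (simp add: Q_def bilinear_form_self wk)
  moreover have "Q d d \<le> 2 * c"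
  proof -
    have "ip n d d = (\<Sum>i=1..n. if i = 1 then 1 else 0)" unfolding ip_def d_def by (intro sum.cong) auto
    then have d1: "ip n d d = 1" using n by simp
    have "\<bar>quadratic_form n x v0\<bar> \<le> c" using v0 norm by (simp add: near_min_def)
    then show ?thesis using norm[OF d1] d1 by (simp add: Q_def bilinear_form_self)
  qed
  moreover have "0 \<le> Q d d" "0 \<le> Q (w k) (w k)" by (rule Q.nonneg)+
  ultimately have "Q d d * Q (w k) (w k) \<le> (2 * c) * (12 * t)" by (intro mult_mono) auto
  \<comment> \<open>As \<open>w k 1 = 0\<close>, the multiple of the inner product drops out and the
    first row remains.\<close>
  moreover have "Q d (w k) = (\<Sum>j=1..n. x (1, j) * w k j)"
  proof -
    have "ip n d (w k) = (\<Sum>i=1..n. 0)" unfolding ip_def d_def using wk by (intro sum.cong) auto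
    moreover have "bilinear_form n x d (w k)
        = (\<Sum>i=1..n. if i = 1 then \<Sum>j=1..n. x (1, j) * w k j else 0)"
      unfolding bilinear_form_def d_def
      by (intro sum.cong refl) (auto simp: symmetric_entries_def min_def max_def intro!: sum.cong)
    ultimately show ?thesis using n by (simp add: Q_def)
  qed
  ultimately show ?thesis using Q.Cauchy_Schwarz[of d "w k"] by simp
qed

section \<open>The fourth trace as a bound for the energy\<close>

definition fourth_trace :: "nat \<Rightarrow> (nat \<times> nat \<Rightarrow> real) \<Rightarrow> real" where
  "fourth_trace n x = (\<Sum>i=1..n. \<Sum>k=1..n. (\<Sum>j=1..n. symmetric_entries x i j * symmetric_entries x j k)\<^sup>2)"

lemma double_sum_Cauchy_Schwarz:
  fixes a b :: "'a \<Rightarrow> 'b \<Rightarrow> real"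
  shows "(\<Sum>i\<in>A. \<Sum>j\<in>B. a i j * b i j)\<^sup>2 \<le> (\<Sum>i\<in>A. \<Sum>j\<in>B. (a i j)\<^sup>2) * (\<Sum>i\<in>A. \<Sum>j\<in>B. (b i j)\<^sup>2)"
  unfolding sum.cartesian_product
  using Cauchy_Schwarz_ineq_sum[of "\<lambda>(i, j). a i j" "\<lambda>(i, j). b i j" "A \<times> B"]
  by (simp add: case_prod_unfold)

text \<open>\<open>fourth_trace\<close> is tr M^4, written as the squared Frobenius norm of M^2.
  Cauchy-Schwarz gives \<open>(v^T M v)^2 \<le> |M v|^2 = v^T M^2 v\<close>, and a second time
  against the entries of \<open>v v^T\<close> gives the trace. The trace of M^2, of order n^2, would
  only bound energies by order n, which is too weak; the fourth trace yields order n^(3/4).\<close>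

lemma quadratic_form_power4_le:
  assumes v: "ip n v v = 1"
  shows "(quadratic_form n x v) ^ 4 \<le> fourth_trace n x"
proof -
  let ?s = "symmetric_entries x"
  define m where "m j = (\<Sum>i=1..n. v i * ?s i j)" for j
  have "quadratic_form n x v = (\<Sum>j=1..n. m j * v j)"
    unfolding quadratic_form_def m_def by (subst sum.swap) (simp add: sum_distrib_right)
  then have "(quadratic_form n x v)\<^sup>2 \<le> (\<Sum>j=1..n. (m j)\<^sup>2) * (\<Sum>j=1..n. (v j)\<^sup>2)"
    using Cauchy_Schwarz_ineq_sum by metis
  then have "(quadratic_form n x v)\<^sup>2 \<le> (\<Sum>j=1..n. (m j)\<^sup>2)"
    using v by (simp add: ip_def power2_eq_square)
  then have "((quadratic_form n x v)\<^sup>2)\<^sup>2 \<le> (\<Sum>j=1..n. (m j)\<^sup>2)\<^sup>2" by (intro power_mono) auto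
  also have "(\<Sum>j=1..n. (m j)\<^sup>2) = (\<Sum>j=1..n. \<Sum>i=1..n. \<Sum>k=1..n. (v i * v k) * (?s i j * ?s j k))"
    unfolding m_def power2_eq_square sum_product
    by (intro sum.cong refl, subst (2) symmetric_entries_commute) simp
  also have "\<dots> = (\<Sum>i=1..n. \<Sum>j=1..n. \<Sum>k=1..n. (v i * v k) * (?s i j * ?s j k))"
    by (rule sum.swap)
  also have "\<dots> = (\<Sum>i=1..n. \<Sum>k=1..n. (v i * v k) * (\<Sum>j=1..n. ?s i j * ?s j k))"
    unfolding sum_distrib_left by (intro sum.cong refl sum.swap)
  also have "\<dots>\<^sup>2 \<le> (\<Sum>i=1..n. \<Sum>k=1..n. (v i * v k)\<^sup>2) * fourth_trace n x"
    unfolding fourth_trace_def by (rule double_sum_Cauchy_Schwarz)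
  also have "(\<Sum>i=1..n. \<Sum>k=1..n. (v i * v k)\<^sup>2) = ip n v v * ip n v v"
    unfolding ip_def sum_product by (simp add: power2_eq_square mult_ac)
  finally show ?thesis using v by (simp add: power_mult[symmetric])
qed


section \<open>Quadratic forms in independent variables\<close>

locale iid_moments = prob_space M for M :: "'w measure" +
  fixes X :: "'i \<Rightarrow> 'w \<Rightarrow> real" and I :: "'i set" and \<sigma> \<mu> :: real
  assumes finite_I: "finite I"
    and indep: "indep_vars (\<lambda>_. borel) X I"
    and integrable_fourth: "\<And>l. l \<in> I \<Longrightarrow> integrable M (\<lambda>\<omega>. X l \<omega> ^ 4)"
    and mean_zero: "\<And>l. l \<in> I \<Longrightarrow> expectation (X l) = 0"
    and second_moment: "\<And>l. l \<in> I \<Longrightarrow> expectation (\<lambda>\<omega>. (X l \<omega>)\<^sup>2) = \<sigma>\<^sup>2"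
    and fourth_moment: "\<And>l. l \<in> I \<Longrightarrow> expectation (\<lambda>\<omega>. X l \<omega> ^ 4) \<le> \<mu>"
begin

lemma random_variable_entry: "l \<in> I \<Longrightarrow> X l \<in> borel_measurable M"
  using indep by (simp add: indep_vars_def)

lemma four_product_le: "\<bar>a * b * c * d\<bar> \<le> a ^ 4 + b ^ 4 + c ^ 4 + d ^ 4" for a b c d :: real
proof -
  have e: "a ^ 4 = a\<^sup>2 * a\<^sup>2" for a :: real by (simp add: power2_eq_square power4_eq_xxxx)
  have 1: "2 * \<bar>p * q\<bar> \<le> p\<^sup>2 + q\<^sup>2" for p q :: real
    using sum_squares_bound[of "\<bar>p\<bar>" "\<bar>q\<bar>"] by (simp add: abs_mult mult.assoc)
  have "2 * \<bar>(a * b) * (c * d)\<bar> \<le> (a * b)\<^sup>2 + (c * d)\<^sup>2" by (rule 1)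
  moreover have "2 * (a * b)\<^sup>2 \<le> a ^ 4 + b ^ 4"
    using sum_squares_bound[of "a\<^sup>2" "b\<^sup>2"] unfolding e by (simp add: power2_eq_square mult_ac)
  moreover have "2 * (c * d)\<^sup>2 \<le> c ^ 4 + d ^ 4"
    using sum_squares_bound[of "c\<^sup>2" "d\<^sup>2"] unfolding e by (simp add: power2_eq_square mult_ac)
  moreover have "0 \<le> (a * b)\<^sup>2" "0 \<le> (c * d)\<^sup>2" by auto
  ultimately show ?thesis by (simp add: mult.assoc)
qed

lemma integrable_four_product:
  assumes "a \<in> I" "b \<in> I" "c \<in> I" "d \<in> I"
  shows "integrable M (\<lambda>\<omega>. X a \<omega> * X b \<omega> * X c \<omega> * X d \<omega>)"
proof (rule Bochner_Integration.integrable_bound)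
  show "integrable M (\<lambda>\<omega>. X a \<omega> ^ 4 + X b \<omega> ^ 4 + X c \<omega> ^ 4 + X d \<omega> ^ 4)"
    using assms integrable_fourth by auto
  show "(\<lambda>\<omega>. X a \<omega> * X b \<omega> * X c \<omega> * X d \<omega>) \<in> borel_measurable M"
    using assms random_variable_entry by auto
  show "AE \<omega> in M. norm (X a \<omega> * X b \<omega> * X c \<omega> * X d \<omega>)
      \<le> norm (X a \<omega> ^ 4 + X b \<omega> ^ 4 + X c \<omega> ^ 4 + X d \<omega> ^ 4)"
    using four_product_le by (intro AE_I2) (smt (verit) real_norm_def)
qed

lemma integrable_power:
  assumes "l \<in> I" "p \<le> 4"
  shows "integrable M (\<lambda>\<omega>. X l \<omega> ^ p)"
proof (rule Bochner_Integration.integrable_bound)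
  show "integrable M (\<lambda>\<omega>. 1 + X l \<omega> ^ 4)" using assms integrable_fourth by auto
  show "(\<lambda>\<omega>. X l \<omega> ^ p) \<in> borel_measurable M"
    using assms random_variable_entry by auto
  have "\<bar>x ^ p\<bar> \<le> 1 + x ^ 4" for x :: real
  proof (cases "\<bar>x\<bar> \<le> 1")
    case True
    then have "\<bar>x\<bar> ^ p \<le> 1" by (intro power_le_one) auto
    then show ?thesis by (simp add: power_abs add_increasing2)
  next
    case False
    then have "\<bar>x\<bar> ^ p \<le> \<bar>x\<bar> ^ 4" using assms(2) by (intro power_increasing) auto
    also have "\<bar>x\<bar> ^ 4 = x ^ 4" by simp
    finally show ?thesis by (simp add: power_abs)
  qed
  then show "AE \<omega> in M. norm (X l \<omega> ^ p) \<le> norm (1 + X l \<omega> ^ 4)"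
    by (intro AE_I2) (smt (verit) real_norm_def)
qed

text \<open>Products of entries with possibly coinciding indices are written as monomials over all
  of \<open>I\<close>, with an exponent function counting occurrences; independence then applies
  without a case distinction on the coincidences.\<close>

lemma expectation_monomial:
  assumes "\<And>l. l \<in> I \<Longrightarrow> p l \<le> 4"
  shows "expectation (\<lambda>\<omega>. \<Prod>l\<in>I. X l \<omega> ^ p l) = (\<Prod>l\<in>I. expectation (\<lambda>\<omega>. X l \<omega> ^ p l))"
proof (rule indep_vars_lebesgue_integral[OF finite_I])
  show "indep_vars (\<lambda>_. borel) (\<lambda>l \<omega>. X l \<omega> ^ p l) I"
    by (rule indep_vars_compose2[OF indep]) auto
qed (use assms integrable_power in auto)

lemma prod_power_of_bool:
  fixes f :: "'i \<Rightarrow> real"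
  assumes "a \<in> I"
  shows "(\<Prod>l\<in>I. f l ^ of_bool (l = a)) = f a"
proof -
  have "(\<Prod>l\<in>I. f l ^ of_bool (l = a)) = (\<Prod>l\<in>I. if l = a then f l else 1)"
    by (intro prod.cong) auto
  then show ?thesis using assms finite_I by simp
qed

text \<open>The index \<open>a\<close> has exponent 1, so its factor is the mean 0; the other three
  indices may coincide in any way.\<close>

lemma expectation_isolated_factor:
  assumes "a \<in> I" "b \<in> I" "c \<in> I" "d \<in> I" "a \<noteq> b" "a \<noteq> c" "a \<noteq> d"
  shows "expectation (\<lambda>\<omega>. X a \<omega> * X b \<omega> * X c \<omega> * X d \<omega>) = 0"
proof -
  define p :: "'i \<Rightarrow> nat" where
    "p l = of_bool (l = a) + of_bool (l = b) + of_bool (l = c) + of_bool (l = d)" for l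
  have "(\<Prod>l\<in>I. X l \<omega> ^ p l) = X a \<omega> * X b \<omega> * X c \<omega> * X d \<omega>" for \<omega>
    unfolding p_def power_add prod.distrib using assms by (simp add: prod_power_of_bool)
  moreover have "expectation (\<lambda>\<omega>. \<Prod>l\<in>I. X l \<omega> ^ p l) = (\<Prod>l\<in>I. expectation (\<lambda>\<omega>. X l \<omega> ^ p l))"
    by (rule expectation_monomial) (simp add: p_def)
  moreover have "(\<Prod>l\<in>I. expectation (\<lambda>\<omega>. X l \<omega> ^ p l)) = 0"
    using assms mean_zero[of a] finite_I by (intro prod_zero bexI[of _ a]) (auto simp: p_def)
  ultimately show ?thesis by simp
qed

lemma expectation_squares:
  assumes "a \<in> I" "c \<in> I" "a \<noteq> c"
  shows "expectation (\<lambda>\<omega>. (X a \<omega>)\<^sup>2 * (X c \<omega>)\<^sup>2) = \<sigma>\<^sup>2 * \<sigma>\<^sup>2"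
proof -
  define p :: "'i \<Rightarrow> nat" where
    "p l = of_bool (l = a) * 2 + of_bool (l = c) * 2" for l
  have "(\<Prod>l\<in>I. X l \<omega> ^ p l) = (X a \<omega>)\<^sup>2 * (X c \<omega>)\<^sup>2" for \<omega>
    unfolding p_def power_add power_mult prod.distrib
    using assms by (simp add: prod_power_of_bool prod_power_distrib[symmetric])
  moreover have "expectation (\<lambda>\<omega>. \<Prod>l\<in>I. X l \<omega> ^ p l) = (\<Prod>l\<in>I. expectation (\<lambda>\<omega>. X l \<omega> ^ p l))"
    by (rule expectation_monomial) (simp add: p_def)
  moreover have "(\<Prod>l\<in>I. expectation (\<lambda>\<omega>. X l \<omega> ^ p l))
      = (\<Prod>l\<in>I. (if l = a then \<sigma>\<^sup>2 else 1) * (if l = c then \<sigma>\<^sup>2 else 1))"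
    using assms second_moment by (intro prod.cong) (auto simp: p_def prob_space power2_eq_square)
  ultimately show ?thesis using assms finite_I by (simp add: prod.distrib)
qed

definition centered :: "'i \<Rightarrow> 'i \<Rightarrow> 'w \<Rightarrow> real" where
  "centered a b \<omega> = X a \<omega> * X b \<omega> - (if a = b then \<sigma>\<^sup>2 else 0)"

lemma expectation_two_product:
  assumes "a \<in> I" "b \<in> I"
  shows "integrable M (\<lambda>\<omega>. X a \<omega> * X b \<omega>)"
    "expectation (\<lambda>\<omega>. X a \<omega> * X b \<omega>) = (if a = b then \<sigma>\<^sup>2 else 0)"
proof -
  define p :: "'i \<Rightarrow> nat" where "p l = of_bool (l = a) + of_bool (l = b)" for l
  have eq: "(\<Prod>l\<in>I. X l \<omega> ^ p l) = X a \<omega> * X b \<omega>" for \<omega>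
    unfolding p_def power_add prod.distrib using assms by (simp add: prod_power_of_bool)
  have "integrable M (\<lambda>\<omega>. X l \<omega> ^ p l)" if "l \<in> I" for l
    by (rule integrable_power[OF that]) (simp add: p_def)
  then have "integrable M (\<lambda>\<omega>. \<Prod>l\<in>I. X l \<omega> ^ p l)"
    by (intro indep_vars_integrable[OF finite_I indep_vars_compose2[OF indep]]) auto
  then show "integrable M (\<lambda>\<omega>. X a \<omega> * X b \<omega>)" by (simp add: eq)
  show "expectation (\<lambda>\<omega>. X a \<omega> * X b \<omega>) = (if a = b then \<sigma>\<^sup>2 else 0)"
  proof (cases "a = b")
    case True
    then show ?thesis using second_moment[OF assms(1)] by (simp add: power2_eq_square)
  next
    case False
    have "expectation (\<lambda>\<omega>. \<Prod>l\<in>I. X l \<omega> ^ p l) = (\<Prod>l\<in>I. expectation (\<lambda>\<omega>. X l \<omega> ^ p l))"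
      by (rule expectation_monomial) (simp add: p_def)
    also have "\<dots> = 0"
      using assms False mean_zero[of a] finite_I by (intro prod_zero bexI[of _ a]) (auto simp: p_def)
    finally show ?thesis using False by (simp add: eq)
  qed
qed

lemma centered_product_expansion:
  "centered a b \<omega> * centered c d \<omega> = X a \<omega> * X b \<omega> * X c \<omega> * X d \<omega>
    - (if a = b then \<sigma>\<^sup>2 else 0) * (X c \<omega> * X d \<omega>) - (if c = d then \<sigma>\<^sup>2 else 0) * (X a \<omega> * X b \<omega>)
    + (if a = b then \<sigma>\<^sup>2 else 0) * (if c = d then \<sigma>\<^sup>2 else 0)"
  by (simp add: centered_def algebra_simps)

lemma integrable_centered_product:
  assumes "a \<in> I" "b \<in> I" "c \<in> I" "d \<in> I"
  shows "integrable M (\<lambda>\<omega>. centered a b \<omega> * centered c d \<omega>)"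
  unfolding centered_product_expansion
  by (intro Bochner_Integration.integrable_add Bochner_Integration.integrable_diff
      integrable_mult_right integrable_four_product expectation_two_product assms integrable_const)

lemma expectation_centered_product:
  assumes "a \<in> I" "b \<in> I" "c \<in> I" "d \<in> I"
  shows "expectation (\<lambda>\<omega>. centered a b \<omega> * centered c d \<omega>)
    = expectation (\<lambda>\<omega>. X a \<omega> * X b \<omega> * X c \<omega> * X d \<omega>)
      - (if a = b then \<sigma>\<^sup>2 else 0) * (if c = d then \<sigma>\<^sup>2 else 0)"
  unfolding centered_product_expansion
  using integrable_four_product[OF assms] expectation_two_product[OF assms(1,2)]
    expectation_two_product[OF assms(3,4)]
  by (simp add: prob_space)

text \<open>Unless four indices pair up, one of them occurs exactly once and the expectation
  vanishes. Two pairings are excluded by hypothesis; in the remaining one, \<open>a = b\<close> and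
  \<open>c = d\<close> with \<open>a \<noteq> c\<close>, the expectation factors into the means that
  are subtracted.\<close>

lemma centered_orthogonal:
  assumes I: "a \<in> I" "b \<in> I" "c \<in> I" "d \<in> I" and ne: "(c, d) \<noteq> (a, b)" "(c, d) \<noteq> (b, a)"
  shows "expectation (\<lambda>\<omega>. centered a b \<omega> * centered c d \<omega>) = 0"
proof (cases "a = b \<and> c = d")
  case True
  then have "expectation (\<lambda>\<omega>. X a \<omega> * X b \<omega> * X c \<omega> * X d \<omega>) = \<sigma>\<^sup>2 * \<sigma>\<^sup>2"
    using expectation_squares[of a c] I ne by (simp add: power2_eq_square mult.assoc)
  then show ?thesis using True by (simp add: expectation_centered_product I)
next
  case False
  consider "a \<noteq> b" "a \<noteq> c" "a \<noteq> d" | "b \<noteq> a" "b \<noteq> c" "b \<noteq> d" |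
    "c \<noteq> a" "c \<noteq> b" "c \<noteq> d" | "d \<noteq> a" "d \<noteq> b" "d \<noteq> c"
    using False ne by fastforce
  then have "expectation (\<lambda>\<omega>. X a \<omega> * X b \<omega> * X c \<omega> * X d \<omega>) = 0"
  proof cases
    case 1
    then show ?thesis using expectation_isolated_factor I by blast
  next
    case 2
    then show ?thesis using expectation_isolated_factor[of b a c d] I by (simp add: mult_ac)
  next
    case 3
    then show ?thesis using expectation_isolated_factor[of c a b d] I by (simp add: mult_ac)
  next
    case 4
    then show ?thesis using expectation_isolated_factor[of d a b c] I by (simp add: mult_ac)
  qed
  then show ?thesis using False by (auto simp: expectation_centered_product I)
qed

lemma centered_square_le:
  assumes "a \<in> I" "b \<in> I"
  shows "expectation (\<lambda>\<omega>. centered a b \<omega> * centered a b \<omega>) \<le> \<mu>"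
proof -
  have "expectation (\<lambda>\<omega>. centered a b \<omega> * centered a b \<omega>)
      \<le> expectation (\<lambda>\<omega>. X a \<omega> * X b \<omega> * X a \<omega> * X b \<omega>)"
    by (simp add: expectation_centered_product assms)
  also have "\<dots> \<le> expectation (\<lambda>\<omega>. (X a \<omega> ^ 4 + X b \<omega> ^ 4) / 2)"
  proof (rule integral_mono)
    show "integrable M (\<lambda>\<omega>. X a \<omega> * X b \<omega> * X a \<omega> * X b \<omega>)"
      by (rule integrable_four_product) fact+
    show "integrable M (\<lambda>\<omega>. (X a \<omega> ^ 4 + X b \<omega> ^ 4) / 2)"
      using integrable_fourth assms by auto
    show "X a \<omega> * X b \<omega> * X a \<omega> * X b \<omega> \<le> (X a \<omega> ^ 4 + X b \<omega> ^ 4) / 2" for \<omega>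
      using sum_squares_bound[of "(X a \<omega>)\<^sup>2" "(X b \<omega>)\<^sup>2"]
      by (simp add: power2_eq_square power4_eq_xxxx mult_ac)
  qed
  also have "\<dots> \<le> \<mu>"
    using integrable_fourth fourth_moment[OF assms(1)] fourth_moment[OF assms(2)] assms by simp
  finally show ?thesis .
qed

text \<open>Distinct unordered pairs give orthogonal variables, and each unordered pair has at most two
  orderings; hence the factor \<open>2\<close>.\<close>

lemma second_moment_quadratic_form:
  fixes c :: "'i \<times> 'i \<Rightarrow> real"
  assumes S: "finite S" "S \<subseteq> I \<times> I"
  defines "Z \<equiv> \<lambda>\<omega>. \<Sum>s\<in>S. c s * centered (fst s) (snd s) \<omega>"
  shows "integrable M (\<lambda>\<omega>. (Z \<omega>)\<^sup>2)" "expectation (\<lambda>\<omega>. (Z \<omega>)\<^sup>2) \<le> 2 * \<mu> * (\<Sum>s\<in>S. (c s)\<^sup>2)"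
proof -
  let ?\<xi> = "\<lambda>s. centered (fst s) (snd s)"
  have I: "fst s \<in> I" "snd s \<in> I" if "s \<in> S" for s using that S by auto
  have exp: "(\<lambda>\<omega>. (Z \<omega>)\<^sup>2) = (\<lambda>\<omega>. \<Sum>s\<in>S. \<Sum>t\<in>S. (c s * c t) * (?\<xi> s \<omega> * ?\<xi> t \<omega>))"
    by (simp add: Z_def power2_eq_square sum_product mult_ac)
  have int: "integrable M (\<lambda>\<omega>. (c s * c t) * (?\<xi> s \<omega> * ?\<xi> t \<omega>))" if "s \<in> S" "t \<in> S" for s t
    using that I by (intro integrable_mult_right integrable_centered_product) auto
  show "integrable M (\<lambda>\<omega>. (Z \<omega>)\<^sup>2)"
    unfolding exp by (intro Bochner_Integration.integrable_sum int)
  have "expectation (\<lambda>\<omega>. (Z \<omega>)\<^sup>2)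
      = (\<Sum>s\<in>S. \<Sum>t\<in>S. (c s * c t) * expectation (\<lambda>\<omega>. ?\<xi> s \<omega> * ?\<xi> t \<omega>))"
    unfolding exp using int
    by (simp add: Bochner_Integration.integral_sum Bochner_Integration.integrable_sum del: mult.assoc)
  \<comment> \<open>Swapped pairs give the same variable; \<open>c s * c t\<close> is split by the
    arithmetic-geometric mean, one half charged to \<open>s\<close> and one to \<open>t\<close>. If
    \<open>s\<close> has equal components the terms overlap, which only enlarges the bound.\<close>
  also have "\<dots> \<le> (\<Sum>s\<in>S. \<Sum>t\<in>S. (if t = s then \<mu> * (c s)\<^sup>2 else 0)
      + (if t = prod.swap s then \<mu> / 2 * (c s)\<^sup>2 else 0)
      + (if s = prod.swap t then \<mu> / 2 * (c t)\<^sup>2 else 0))"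
  proof (intro sum_mono)
    fix s t assume st: "s \<in> S" "t \<in> S"
    let ?E = "expectation (\<lambda>\<omega>. ?\<xi> s \<omega> * ?\<xi> t \<omega>)"
    have \<mu>: "0 \<le> expectation (\<lambda>\<omega>. ?\<xi> s \<omega> * ?\<xi> s \<omega>)" by (rule Bochner_Integration.integral_nonneg) simp
    have E: "expectation (\<lambda>\<omega>. ?\<xi> s \<omega> * ?\<xi> s \<omega>) \<le> \<mu>" by (rule centered_square_le) (use st I in auto)
    have \<mu>0: "0 \<le> \<mu>" using \<mu> E by linarith
    consider "t = s" | "t = prod.swap s" "t \<noteq> s" | "t \<noteq> s" "t \<noteq> prod.swap s" by blast
    then show "(c s * c t) * ?E \<le> (if t = s then \<mu> * (c s)\<^sup>2 else 0)
      + (if t = prod.swap s then \<mu> / 2 * (c s)\<^sup>2 else 0)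
      + (if s = prod.swap t then \<mu> / 2 * (c t)\<^sup>2 else 0)"
    proof cases
      case 1
      have "(c s)\<^sup>2 * ?E \<le> (c s)\<^sup>2 * \<mu>" using E 1 by (intro mult_left_mono) auto
      then show ?thesis using 1 \<mu>0 by (simp add: power2_eq_square mult_ac add_increasing2)
    next
      case 2
      have "?\<xi> t = ?\<xi> s" using 2 by (auto simp: centered_def fun_eq_iff)
      then have "0 \<le> ?E" "?E \<le> \<mu>" using E \<mu> by auto
      moreover have "c s * c t \<le> ((c s)\<^sup>2 + (c t)\<^sup>2) / 2" using sum_squares_bound[of "c s" "c t"] by simp
      ultimately have "(c s * c t) * ?E \<le> ((c s)\<^sup>2 + (c t)\<^sup>2) / 2 * ?E" by (intro mult_right_mono) auto
      also have "\<dots> \<le> ((c s)\<^sup>2 + (c t)\<^sup>2) / 2 * \<mu>" using \<open>?E \<le> \<mu>\<close> by (intro mult_left_mono) auto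
      finally show ?thesis using 2 by (auto simp: field_simps)
    next
      case 3
      then have "?E = 0"
        using st I by (intro centered_orthogonal) (auto simp: prod_eq_iff)
      then show ?thesis using 3 by auto
    qed
  qed
  also have "\<dots> = (\<Sum>s\<in>S. \<Sum>t\<in>S. if t = s then \<mu> * (c s)\<^sup>2 else 0)
      + (\<Sum>s\<in>S. \<Sum>t\<in>S. if t = prod.swap s then \<mu> / 2 * (c s)\<^sup>2 else 0)
      + (\<Sum>s\<in>S. \<Sum>t\<in>S. if s = prod.swap t then \<mu> / 2 * (c t)\<^sup>2 else 0)"
    by (simp add: sum.distrib)
  also have "(\<Sum>s\<in>S. \<Sum>t\<in>S. if s = prod.swap t then \<mu> / 2 * (c t)\<^sup>2 else 0)
      = (\<Sum>s\<in>S. \<Sum>t\<in>S. if t = prod.swap s then \<mu> / 2 * (c s)\<^sup>2 else 0)"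
    by (rule sum.swap)
  also have "(\<Sum>s\<in>S. \<Sum>t\<in>S. if t = prod.swap s then \<mu> / 2 * (c s)\<^sup>2 else 0)
      \<le> (\<Sum>s\<in>S. \<mu> / 2 * (c s)\<^sup>2)"
  proof (rule sum_mono)
    fix s assume s: "s \<in> S"
    have "0 \<le> \<mu>" using fourth_moment[OF I(1)[OF s]]
      by (rule order_trans[rotated]) (rule Bochner_Integration.integral_nonneg, simp)
    then show "(\<Sum>t\<in>S. if t = prod.swap s then \<mu> / 2 * (c s)\<^sup>2 else 0) \<le> \<mu> / 2 * (c s)\<^sup>2"
      using S(1) by (simp add: sum.delta)
  qed
  also have "(\<Sum>s\<in>S. \<Sum>t\<in>S. if t = s then \<mu> * (c s)\<^sup>2 else 0) = (\<Sum>s\<in>S. \<mu> * (c s)\<^sup>2)"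
    using S(1) by (intro sum.cong refl) (simp add: sum.delta)
  finally show "expectation (\<lambda>\<omega>. (Z \<omega>)\<^sup>2) \<le> 2 * \<mu> * (\<Sum>s\<in>S. (c s)\<^sup>2)"
    by (simp add: sum_distrib_left[symmetric] sum_divide_distrib[symmetric])
qed

end

section \<open>Wigner matrices: moments of the fourth trace and of the first row\<close>

locale wigner = iid_moments M X "upper_triangle n" \<sigma> \<mu>
  for M :: "'w measure" and X :: "nat \<times> nat \<Rightarrow> 'w \<Rightarrow> real" and n :: nat and \<sigma> \<mu> :: real
begin

lemma entry_mem: "i \<in> {1..n} \<Longrightarrow> j \<in> {1..n} \<Longrightarrow> (min i j, max i j) \<in> upper_triangle n"
  by (auto simp: upper_triangle_def)

text \<open>For \<open>i = k\<close> the inner sum consists of squares, nothing cancels, and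
  Cauchy-Schwarz gives order \<open>n\<^sup>2\<close>. For \<open>i \<noteq> k\<close> it consists
  of products of two distinct entries, uncorrelated for different \<open>j\<close>, which gives
  order \<open>n\<close>. Summed over \<open>i\<close> and \<open>k\<close>, both kinds contribute
  order n^3, with total constant 3.\<close>

lemma fourth_trace_term:
  assumes i: "i \<in> {1..n}" and k: "k \<in> {1..n}"
  defines "T \<equiv> \<lambda>\<omega>. (\<Sum>j=1..n. symmetric_entries (\<lambda>l. X l \<omega>) i j * symmetric_entries (\<lambda>l. X l \<omega>) j k)\<^sup>2"
  shows "integrable M T" "expectation T \<le> 2 * \<mu> * n + (if i = k then n\<^sup>2 * \<mu> else 0)"
proof -
  have \<mu>: "0 \<le> \<mu>" using fourth_moment[OF entry_mem[OF i i]]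
      by (rule order_trans[rotated]) (rule Bochner_Integration.integral_nonneg, simp)
  have "integrable M T \<and> expectation T \<le> 2 * \<mu> * n + (if i = k then n\<^sup>2 * \<mu> else 0)"
  proof (cases "i = k")
    case True
    let ?s = "\<lambda>j \<omega>. X (min i j, max i j) \<omega>"
    have T: "T = (\<lambda>\<omega>. (\<Sum>j=1..n. (?s j \<omega>)\<^sup>2)\<^sup>2)"
      unfolding T_def True by (simp add: symmetric_entries_def power2_eq_square min.commute max.commute)
    have bound: "T \<omega> \<le> n * (\<Sum>j=1..n. ?s j \<omega> ^ 4)" for \<omega>
      using Cauchy_Schwarz_ineq_sum[of "\<lambda>_. 1" "\<lambda>j. (?s j \<omega>)\<^sup>2" "{1..n}"]
      by (simp add: T power_mult[symmetric])
    have int: "integrable M (\<lambda>\<omega>. n * (\<Sum>j=1..n. ?s j \<omega> ^ 4))"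
      using integrable_fourth entry_mem[OF i] by (intro integrable_mult_right Bochner_Integration.integrable_sum) auto
    have meas: "T \<in> borel_measurable M"
      unfolding T using random_variable_entry entry_mem[OF i]
      by (intro borel_measurable_power borel_measurable_sum) auto
    have intT: "integrable M T"
      using bound by (intro Bochner_Integration.integrable_bound[OF int meas] AE_I2)
        (smt (verit) T real_norm_def zero_le_power2)
    have "expectation T \<le> expectation (\<lambda>\<omega>. n * (\<Sum>j=1..n. ?s j \<omega> ^ 4))"
      by (intro integral_mono intT int bound)
    also have "\<dots> = n * (\<Sum>j=1..n. expectation (\<lambda>\<omega>. ?s j \<omega> ^ 4))"
      using integrable_fourth entry_mem[OF i] by (simp add: Bochner_Integration.integral_sum)
    also have "\<dots> \<le> n * (\<Sum>j=1..n. \<mu>)"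
      using fourth_moment entry_mem[OF i] by (intro mult_left_mono sum_mono) auto
    finally have "expectation T \<le> n\<^sup>2 * \<mu>" by (simp add: power2_eq_square)
    then show ?thesis using \<mu> True intT by (simp add: add_increasing)
  next
    case False
    let ?e = "\<lambda>i j :: nat. (min i j, max i j)"
    \<comment> \<open>Sends \<open>j\<close> to the two entries in the \<open>j\<close>-th summand.
      They differ because \<open>i \<noteq> k\<close>, so centering subtracts 0.\<close>
    define g where "g = (\<lambda>j. (?e i j, ?e j k))"
    have inj: "inj_on g {1..n}"
      by (intro inj_onI) (auto simp: g_def min_def max_def split: if_splits)
    have ne: "?e i j \<noteq> ?e j k" for j using False by (auto simp: min_def max_def)
    have sub: "g ` {1..n} \<subseteq> upper_triangle n \<times> upper_triangle n"
      using entry_mem i k by (auto simp: g_def)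
    have T: "T \<omega> = (\<Sum>s\<in>g ` {1..n}. 1 * centered (fst s) (snd s) \<omega>)\<^sup>2" for \<omega>
      unfolding sum.reindex[OF inj] T_def
      by (simp only: g_def centered_def symmetric_entries_def comp_def fst_conv snd_conv ne if_False) simp
    have "T = (\<lambda>\<omega>. (\<Sum>s\<in>g ` {1..n}. 1 * centered (fst s) (snd s) \<omega>)\<^sup>2)" using T by blast
    then show ?thesis
      using second_moment_quadratic_form[OF _ sub, of "\<lambda>_. 1"] card_image[OF inj] False
      by simp
  qed
  then show "integrable M T" "expectation T \<le> 2 * \<mu> * n + (if i = k then n\<^sup>2 * \<mu> else 0)" by auto
qed

lemma expectation_fourth_trace:
  "integrable M (\<lambda>\<omega>. fourth_trace n (\<lambda>l. X l \<omega>))"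
  "expectation (\<lambda>\<omega>. fourth_trace n (\<lambda>l. X l \<omega>)) \<le> 3 * \<mu> * n ^ 3"
proof -
  show "integrable M (\<lambda>\<omega>. fourth_trace n (\<lambda>l. X l \<omega>))"
    unfolding fourth_trace_def by (intro Bochner_Integration.integrable_sum fourth_trace_term)
  have "expectation (\<lambda>\<omega>. fourth_trace n (\<lambda>l. X l \<omega>))
      = (\<Sum>i=1..n. \<Sum>k=1..n. expectation (\<lambda>\<omega>. (\<Sum>j=1..n. symmetric_entries (\<lambda>l. X l \<omega>) i j * symmetric_entries (\<lambda>l. X l \<omega>) j k)\<^sup>2))"
    unfolding fourth_trace_def
    by (subst Bochner_Integration.integral_sum,
        intro Bochner_Integration.integrable_sum fourth_trace_term, assumption+,
        intro sum.cong refl Bochner_Integration.integral_sum fourth_trace_term)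
  also have "\<dots> \<le> (\<Sum>i=1..n. \<Sum>k=1..n. 2 * \<mu> * n + (if i = k then n\<^sup>2 * \<mu> else 0))"
    by (intro sum_mono fourth_trace_term)
  also have "\<dots> = 3 * \<mu> * n ^ 3"
    by (simp add: sum.distrib power2_eq_square power3_eq_cube)
  finally show "expectation (\<lambda>\<omega>. fourth_trace n (\<lambda>l. X l \<omega>)) \<le> 3 * \<mu> * n ^ 3" .
qed

lemma prob_fourth_trace:
  assumes "0 < c"
  shows "{\<omega> \<in> space M. fourth_trace n (\<lambda>l. X l \<omega>) \<ge> c} \<in> events"
    "prob {\<omega> \<in> space M. fourth_trace n (\<lambda>l. X l \<omega>) \<ge> c} \<le> 3 * \<mu> * n ^ 3 / c"
proof -
  have [measurable]: "(\<lambda>\<omega>. fourth_trace n (\<lambda>l. X l \<omega>)) \<in> borel_measurable M"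
    using expectation_fourth_trace(1) by (rule borel_measurable_integrable)
  show "{\<omega> \<in> space M. fourth_trace n (\<lambda>l. X l \<omega>) \<ge> c} \<in> events" by measurable
  have "prob {\<omega> \<in> space M. fourth_trace n (\<lambda>l. X l \<omega>) \<ge> c}
      \<le> expectation (\<lambda>\<omega>. fourth_trace n (\<lambda>l. X l \<omega>)) / c"
    using assms expectation_fourth_trace(1)
    by (intro integral_Markov_inequality_measure[where A = "space M"])
      (auto simp: fourth_trace_def intro!: sum_nonneg)
  also have "\<dots> \<le> 3 * \<mu> * n ^ 3 / c"
    using expectation_fourth_trace(2) assms by (intro divide_right_mono) auto
  finally show "prob {\<omega> \<in> space M. fourth_trace n (\<lambda>l. X l \<omega>) \<ge> c} \<le> 3 * \<mu> * n ^ 3 / c" .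
qed

text \<open>With \<open>p\<close> the matrix of the projection onto the span of the
  \<open>w k\<close>, the sum is the quadratic form of \<open>p\<close> in the first row. Its mean
  is \<open>\<sigma>\<^sup>2\<close> times the trace \<open>K\<close>; the squared entries of
  \<open>p\<close> also sum to \<open>K\<close>, so its variance is at most
  \<open>2 * \<mu> * K\<close>. Chebyshev at half the mean gives the bound.\<close>

lemma row_projection_small:
  assumes w: "orthonormal n K w" and K: "0 < K" and \<sigma>: "0 < \<sigma>"
  shows "prob {\<omega> \<in> space M. (\<Sum>k<K. (\<Sum>j=1..n. X (1, j) \<omega> * w k j)\<^sup>2) \<le> K * \<sigma>\<^sup>2 / 2} \<le> 8 * \<mu> / (K * \<sigma> ^ 4)"
proof -
  define p where "p i j = (\<Sum>k<K. w k i * w k j)" for i j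
  define g :: "nat \<times> nat \<Rightarrow> _" where "g = (\<lambda>(i, j). ((1 :: nat, i), (1 :: nat, j)))"
  define S where "S = g ` ({1..n} \<times> {1..n})"
  define c where "c s = p (snd (fst s)) (snd (snd s))" for s :: "(nat \<times> nat) \<times> (nat \<times> nat)"
  define Z where "Z \<omega> = (\<Sum>s\<in>S. c s * centered (fst s) (snd s) \<omega>)" for \<omega>
  have inj: "inj_on g ({1..n} \<times> {1..n})" by (auto simp: g_def inj_on_def)
  have S: "finite S" "S \<subseteq> upper_triangle n \<times> upper_triangle n"
    by (auto simp: S_def g_def upper_triangle_def)
  have diag: "(\<Sum>i=1..n. p i i) = K"
  proof -
    have "(\<Sum>i=1..n. p i i) = (\<Sum>k<K. ip n (w k) (w k))"
      unfolding p_def ip_def by (rule sum.swap)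
    then show ?thesis using w by (simp add: orthonormal_def)
  qed
  have "(\<Sum>s\<in>S. (c s)\<^sup>2) = (\<Sum>i=1..n. \<Sum>j=1..n. (p i j)\<^sup>2)"
    unfolding S_def sum.reindex[OF inj]
    by (simp add: c_def g_def sum.cartesian_product case_prod_unfold)
  also have "\<dots> = (\<Sum>i=1..n. \<Sum>j=1..n. \<Sum>k<K. \<Sum>l<K. (w k i * w l i) * (w k j * w l j))"
    by (simp add: p_def power2_eq_square sum_product mult_ac)
  also have "\<dots> = (\<Sum>i=1..n. \<Sum>k<K. \<Sum>j=1..n. \<Sum>l<K. (w k i * w l i) * (w k j * w l j))"
    by (intro sum.cong refl sum.swap)
  also have "\<dots> = (\<Sum>k<K. \<Sum>i=1..n. \<Sum>l<K. \<Sum>j=1..n. (w k i * w l i) * (w k j * w l j))"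
    by (subst sum.swap) (intro sum.cong refl sum.swap)
  also have "\<dots> = (\<Sum>k<K. \<Sum>l<K. \<Sum>i=1..n. \<Sum>j=1..n. (w k i * w l i) * (w k j * w l j))"
    by (intro sum.cong refl sum.swap)
  also have "\<dots> = (\<Sum>k<K. \<Sum>l<K. ip n (w k) (w l) * ip n (w k) (w l))"
    by (simp add: ip_def sum_product)
  also have "\<dots> = (\<Sum>k<K. \<Sum>l<K. if l = k then 1 else 0)"
    using w by (intro sum.cong refl) (auto simp: orthonormal_def)
  also have "\<dots> = K" by simp
  finally have c2: "(\<Sum>s\<in>S. (c s)\<^sup>2) = K" .
  have Z: "Z \<omega> = (\<Sum>k<K. (\<Sum>j=1..n. X (1, j) \<omega> * w k j)\<^sup>2) - K * \<sigma>\<^sup>2" for \<omega>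
  proof -
    have "Z \<omega> = (\<Sum>i=1..n. \<Sum>j=1..n. p i j * (X (1, i) \<omega> * X (1, j) \<omega> - (if j = i then \<sigma>\<^sup>2 else 0)))"
      unfolding Z_def S_def sum.reindex[OF inj] sum.cartesian_product
      by (intro sum.cong refl) (auto simp: c_def g_def centered_def)
    also have "\<dots> = (\<Sum>i=1..n. \<Sum>j=1..n. p i j * (X (1, i) \<omega> * X (1, j) \<omega>))
        - (\<Sum>i=1..n. \<Sum>j=1..n. if j = i then p i i * \<sigma>\<^sup>2 else 0)"
      unfolding sum_subtractf[symmetric] by (intro sum.cong refl) (simp add: algebra_simps)
    also have "(\<Sum>i=1..n. \<Sum>j=1..n. if j = i then p i i * \<sigma>\<^sup>2 else 0) = (\<Sum>i=1..n. p i i) * \<sigma>\<^sup>2"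
      by (simp add: sum_distrib_right)
    also have "(\<Sum>i=1..n. \<Sum>j=1..n. p i j * (X (1, i) \<omega> * X (1, j) \<omega>))
        = (\<Sum>i=1..n. \<Sum>k<K. \<Sum>j=1..n. (X (1, i) \<omega> * w k i) * (X (1, j) \<omega> * w k j))"
      unfolding p_def sum_distrib_right
      by (rule sum.cong[OF refl], subst sum.swap, intro sum.cong refl) (simp add: mult_ac)
    also have "\<dots> = (\<Sum>k<K. (\<Sum>j=1..n. X (1, j) \<omega> * w k j)\<^sup>2)"
      by (subst sum.swap) (simp add: power2_eq_square sum_product)
    finally show ?thesis unfolding diag .
  qed
  have int: "integrable M (\<lambda>\<omega>. (Z \<omega>)\<^sup>2)" and E: "expectation (\<lambda>\<omega>. (Z \<omega>)\<^sup>2) \<le> 2 * \<mu> * K"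
    using second_moment_quadratic_form[OF S, of c] c2 by (simp_all add: Z_def)
  have pos: "0 < (K * \<sigma>\<^sup>2 / 2)\<^sup>2" using K \<sigma> by simp
  have meas: "{\<omega> \<in> space M. (Z \<omega>)\<^sup>2 \<ge> (K * \<sigma>\<^sup>2 / 2)\<^sup>2} \<in> events"
    using borel_measurable_integrable[OF int] by measurable
  have "prob {\<omega> \<in> space M. (\<Sum>k<K. (\<Sum>j=1..n. X (1, j) \<omega> * w k j)\<^sup>2) \<le> K * \<sigma>\<^sup>2 / 2}
      \<le> prob {\<omega> \<in> space M. (Z \<omega>)\<^sup>2 \<ge> (K * \<sigma>\<^sup>2 / 2)\<^sup>2}"
  proof (rule finite_measure_mono[OF _ meas], clarify)
    fix \<omega> assume "(\<Sum>k<K. (\<Sum>j=1..n. X (1, j) \<omega> * w k j)\<^sup>2) \<le> K * \<sigma>\<^sup>2 / 2"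
    then have "K * \<sigma>\<^sup>2 / 2 \<le> - Z \<omega>" unfolding Z by simp
    then have "(K * \<sigma>\<^sup>2 / 2)\<^sup>2 \<le> (- Z \<omega>)\<^sup>2" by (intro power_mono) auto
    then show "(K * \<sigma>\<^sup>2 / 2)\<^sup>2 \<le> (Z \<omega>)\<^sup>2" by simp
  qed
  also have "\<dots> \<le> expectation (\<lambda>\<omega>. (Z \<omega>)\<^sup>2) / (K * \<sigma>\<^sup>2 / 2)\<^sup>2"
    using int pos by (intro integral_Markov_inequality_measure[where A = "space M"]) auto
  also have "\<dots> \<le> 2 * \<mu> * K / (K * \<sigma>\<^sup>2 / 2)\<^sup>2" using E by (intro divide_right_mono) auto
  also have "\<dots> = 8 * \<mu> / (K * \<sigma> ^ 4)"
    using K \<sigma> by (simp add: power2_eq_square power4_eq_xxxx field_simps)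
  finally show ?thesis .
qed

end


section \<open>Rounding to a grid\<close>

text \<open>Rounded inputs take countably many values, so arbitrary choices depending on them are measurable.\<close>

definition grid :: "real \<Rightarrow> 'i set \<Rightarrow> ('i \<Rightarrow> real) \<Rightarrow> 'i \<Rightarrow> int" where
  "grid h J x = (\<lambda>l\<in>J. \<lfloor>x l / h\<rfloor>)"

definition ungrid :: "real \<Rightarrow> ('i \<Rightarrow> int) \<Rightarrow> 'i \<Rightarrow> real" where
  "ungrid h b l = h * of_int (b l)"

lemma ungrid_grid_close:
  assumes "0 < h" "l \<in> J"
  shows "\<bar>x l - ungrid h (grid h J x) l\<bar> \<le> h"
proof -
  have "\<bar>x l / h - of_int \<lfloor>x l / h\<rfloor>\<bar> \<le> 1" by linarith
  then have "h * \<bar>x l / h - of_int \<lfloor>x l / h\<rfloor>\<bar> \<le> h * 1" using assms by (intro mult_left_mono) auto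
  moreover have "h * \<bar>x l / h - of_int \<lfloor>x l / h\<rfloor>\<bar> = \<bar>h * (x l / h - of_int \<lfloor>x l / h\<rfloor>)\<bar>"
    using assms by (simp add: abs_mult)
  ultimately show ?thesis using assms by (simp add: grid_def ungrid_def right_diff_distrib)
qed

lemma grid_in_PiE: "grid h J x \<in> (\<Pi>\<^sub>E l\<in>J. UNIV)"
  by (simp add: grid_def)

lemma countable_PiE_int: "finite J \<Longrightarrow> countable (\<Pi>\<^sub>E l\<in>J. (UNIV :: int set))"
  by (rule countable_PiE) auto

lemma sets_grid:
  assumes J: "finite J" and X: "\<And>l. l \<in> J \<Longrightarrow> X l \<in> borel_measurable N"
  shows "{\<omega> \<in> space N. grid h J (\<lambda>l. X l \<omega>) \<in> D} \<in> sets N"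
proof -
  have eq: "{\<omega> \<in> space N. grid h J (\<lambda>l. X l \<omega>) \<in> D}
      = (\<Union>b \<in> D \<inter> (\<Pi>\<^sub>E l\<in>J. UNIV). {\<omega> \<in> space N. \<forall>l\<in>J. \<lfloor>X l \<omega> / h\<rfloor> = b l})"
  proof (intro set_eqI iffI)
    fix \<omega> assume "\<omega> \<in> {\<omega> \<in> space N. grid h J (\<lambda>l. X l \<omega>) \<in> D}"
    then show "\<omega> \<in> (\<Union>b \<in> D \<inter> (\<Pi>\<^sub>E l\<in>J. UNIV). {\<omega> \<in> space N. \<forall>l\<in>J. \<lfloor>X l \<omega> / h\<rfloor> = b l})"
      by (intro UN_I[of "grid h J (\<lambda>l. X l \<omega>)"]) (auto simp: grid_in_PiE grid_def)
  next
    fix \<omega> assume "\<omega> \<in> (\<Union>b \<in> D \<inter> (\<Pi>\<^sub>E l\<in>J. UNIV). {\<omega> \<in> space N. \<forall>l\<in>J. \<lfloor>X l \<omega> / h\<rfloor> = b l})"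
    then obtain b where b: "b \<in> D" "b \<in> (\<Pi>\<^sub>E l\<in>J. UNIV)" "\<omega> \<in> space N" "\<forall>l\<in>J. \<lfloor>X l \<omega> / h\<rfloor> = b l"
      by blast
    then have "grid h J (\<lambda>l. X l \<omega>) = b" by (auto simp: grid_def PiE_def extensional_def fun_eq_iff)
    then show "\<omega> \<in> {\<omega> \<in> space N. grid h J (\<lambda>l. X l \<omega>) \<in> D}" using b by simp
  qed
  have "{\<omega> \<in> space N. \<forall>l\<in>J. \<lfloor>X l \<omega> / h\<rfloor> = b l} \<in> sets N" for b
  proof (rule sets.sets_Collect_finite_All[OF _ J])
    fix l assume "l \<in> J"
    note X[OF this, measurable]
    show "{\<omega> \<in> space N. \<lfloor>X l \<omega> / h\<rfloor> = b l} \<in> sets N" by measurable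
  qed
  then show ?thesis
    unfolding eq using countable_PiE_int[OF J]
    by (intro sets.countable_UN'') (auto intro: countable_subset)
qed

text \<open>Conditioning on the countably many values of \<open>g (B \<omega>)\<close>: on each
  piece the set \<open>G b\<close> is fixed, and independence bounds the probability by
  \<open>\<eta>\<close> times that of the piece. Any choice of \<open>G b\<close> for each
  \<open>b\<close> is admissible; this is how vectors selected from the minor are treated as
  constants against the first row.\<close>

lemma (in prob_space) prob_countable_selection_le:
  assumes indep: "indep_var S A T B" and C: "countable C"
    and g: "\<And>b. b \<in> C \<Longrightarrow> {y \<in> space T. g y = b} \<in> sets T" "\<And>\<omega>. \<omega> \<in> space M \<Longrightarrow> g (B \<omega>) \<in> C"
    and G: "\<And>b. b \<in> C \<Longrightarrow> G b \<in> sets S" "\<And>b. b \<in> C \<Longrightarrow> prob (A -` G b \<inter> space M) \<le> \<eta>"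
  shows "{\<omega> \<in> space M. A \<omega> \<in> G (g (B \<omega>))} \<in> events"
    "prob {\<omega> \<in> space M. A \<omega> \<in> G (g (B \<omega>))} \<le> \<eta>"
proof -
  have A[measurable]: "A \<in> measurable M S" and B[measurable]: "B \<in> measurable M T"
    using indep indep_var_rv1 indep_var_rv2 by blast+
  define F where "F b = B -` {y \<in> space T. g y = b} \<inter> space M" for b
  define H where "H b = (A -` G b \<inter> space M) \<inter> F b" for b
  have F: "F b \<in> events" if "b \<in> C" for b
    unfolding F_def using g(1)[OF that] by (rule measurable_sets[OF B])
  have H: "H b \<in> events" if "b \<in> C" for b
    unfolding H_def using F[OF that] measurable_sets[OF A G(1)[OF that]] by blast
  have disjF: "disjoint_family_on F C" by (auto simp: disjoint_family_on_def F_def)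
  then have disjH: "disjoint_family_on H C" by (auto simp: disjoint_family_on_def H_def)
  have eq: "{\<omega> \<in> space M. A \<omega> \<in> G (g (B \<omega>))} = (\<Union>b\<in>C. H b)"
    using g(2) measurable_space[OF B] by (auto simp: H_def F_def)
  show "{\<omega> \<in> space M. A \<omega> \<in> G (g (B \<omega>))} \<in> events"
    unfolding eq by (rule sets.countable_UN''[OF C H])
  obtain \<omega>0 where "\<omega>0 \<in> space M" using not_empty by blast
  then have "g (B \<omega>0) \<in> C" by (rule g(2))
  then have \<eta>: "0 \<le> \<eta>" using G(2) measure_nonneg order_trans by blast
  have "emeasure M (\<Union>b\<in>C. H b) = (\<integral>\<^sup>+b. emeasure M (H b) \<partial>count_space C)"
    by (rule emeasure_UN_countable[OF H C disjH])
  also have "\<dots> \<le> (\<integral>\<^sup>+b. ennreal \<eta> * emeasure M (F b) \<partial>count_space C)"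
  proof (rule nn_integral_mono)
    fix b assume "b \<in> space (count_space C)"
    then have b: "b \<in> C" by simp
    have "(\<lambda>\<omega>. (A \<omega>, B \<omega>)) -` (G b \<times> {y \<in> space T. g y = b}) \<inter> space M = H b"
      by (auto simp: H_def F_def)
    then have "prob (H b) = prob (A -` G b \<inter> space M) * prob (F b)"
      using indep_varD[OF indep G(1)[OF b] g(1)[OF b]] by (simp add: F_def)
    also have "\<dots> \<le> \<eta> * prob (F b)" using G(2)[OF b] by (intro mult_right_mono) auto
    finally show "emeasure M (H b) \<le> ennreal \<eta> * emeasure M (F b)"
      using \<eta> by (simp add: emeasure_eq_measure ennreal_mult[symmetric])
  qed
  also have "\<dots> = ennreal \<eta> * (\<integral>\<^sup>+b. emeasure M (F b) \<partial>count_space C)"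
    by (rule nn_integral_cmult) simp
  also have "(\<integral>\<^sup>+b. emeasure M (F b) \<partial>count_space C) = emeasure M (\<Union>b\<in>C. F b)"
    by (rule emeasure_UN_countable[OF F C disjF, symmetric])
  also have "ennreal \<eta> * emeasure M (\<Union>b\<in>C. F b) \<le> ennreal \<eta> * 1"
    by (intro mult_left_mono measure_le_1 emeasure_le_1) auto
  finally show "prob {\<omega> \<in> space M. A \<omega> \<in> G (g (B \<omega>))} \<le> \<eta>"
    unfolding eq using \<eta> by (simp add: emeasure_eq_measure)
qed

text \<open>Markov's inequality for the number of bad blocks. It involves the single probabilities
  alone, which suits copies whose joint law over \<open>l\<close> is arbitrary.\<close>

lemma (in prob_space) prob_count_ge:
  fixes \<epsilon> \<theta> :: real
  assumes L: "finite L" "L \<noteq> {}" and B: "\<And>l. l \<in> L \<Longrightarrow> B l \<in> events"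
    and le: "(\<Sum>l\<in>L. prob (B l)) \<le> \<theta> * card L" and \<epsilon>: "0 < \<epsilon>"
  shows "{\<omega> \<in> space M. \<epsilon> * card L \<le> card {l \<in> L. \<omega> \<in> B l}} \<in> events"
    "prob {\<omega> \<in> space M. \<epsilon> * card L \<le> card {l \<in> L. \<omega> \<in> B l}} \<le> \<theta> / \<epsilon>"
proof -
  define u :: "'a \<Rightarrow> real" where "u \<omega> = (\<Sum>l\<in>L. indicat_real (B l) \<omega>)" for \<omega>
  have u: "real (card {l \<in> L. \<omega> \<in> B l}) = u \<omega>" for \<omega>
    unfolding u_def indicator_def using L by (simp add: sum.If_cases Int_def)
  have u0: "0 \<le> u \<omega>" for \<omega> by (simp add: u[symmetric])
  have int: "integrable M u"
    unfolding u_def using B by (intro Bochner_Integration.integrable_sum integrable_real_indicator) (auto simp: emeasure_eq_measure)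
  have "expectation u = (\<Sum>l\<in>L. prob (B l))"
    unfolding u_def using B by (subst Bochner_Integration.integral_sum) (auto simp: emeasure_eq_measure)
  moreover have pos: "0 < card L" using L by (simp add: card_gt_0_iff)
  ultimately have "expectation u / (\<epsilon> * card L) \<le> \<theta> * card L / (\<epsilon> * card L)"
    using le \<epsilon> by (intro divide_right_mono) auto
  moreover have "prob {\<omega> \<in> space M. \<epsilon> * card L \<le> u \<omega>} \<le> expectation u / (\<epsilon> * card L)"
    using int \<epsilon> pos by (intro integral_Markov_inequality_measure[where A = "space M"])
      (auto simp: u0)
  ultimately show "prob {\<omega> \<in> space M. \<epsilon> * card L \<le> card {l \<in> L. \<omega> \<in> B l}} \<le> \<theta> / \<epsilon>"
    unfolding u using pos \<epsilon> by simp
  show "{\<omega> \<in> space M. \<epsilon> * card L \<le> card {l \<in> L. \<omega> \<in> B l}} \<in> events"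
    unfolding u using borel_measurable_integrable[OF int] by measurable
qed

section \<open>Probability that many near-minimizers are orthonormal\<close>

context wigner
begin

lemma finite_minor: "finite (minor n)"
  by (rule finite_subset[OF _ finite_upper_triangle[of n]]) (auto simp: minor_def upper_triangle_def)

text \<open>For a degenerate input, either the fourth trace is at least \<open>c ^ 4\<close>, or
  energies are at most \<open>c\<close> and the first row is almost orthogonal to vectors selected
  from the rounded minor; \<open>E\<close> is the union of these two events and encloses the
  degenerate inputs. The hypothesis \<open>48 * c * t \<le> \<sigma>\<^sup>2\<close> keeps
  \<open>K\<close> terms of size \<open>24 * c * t\<close> below half of the mean
  \<open>K * \<sigma>\<^sup>2\<close>.\<close>

lemma degenerate_prob:
  fixes c h t :: real
  assumes n: "n \<ge> 1" and K: "0 < K" and \<sigma>: "0 < \<sigma>" and c: "0 < c" and h: "0 < h" "n * h \<le> t"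
    and ct: "48 * c * t \<le> \<sigma>\<^sup>2"
  obtains E where "E \<in> events" "prob E \<le> 8 * \<mu> / (K * \<sigma> ^ 4) + 3 * \<mu> * n ^ 3 / c ^ 4"
    "\<And>\<omega>. \<omega> \<in> space M \<Longrightarrow> degenerate n (2 * K) (\<lambda>l. X l \<omega>) t \<Longrightarrow> \<omega> \<in> E"
proof -
  define R where "R = {1 :: nat} \<times> {1..n}"
  define A where "A \<omega> = (\<lambda>l\<in>R. X l \<omega>)" for \<omega>
  define B where "B \<omega> = (\<lambda>l\<in>minor n. X l \<omega>)" for \<omega>
  define t' where "t' = 4 * t + 2 * (real n * h)"
  define ok where "ok b = (\<exists>w. minor_near n K (ungrid h b) t' w)" for b
  \<comment> \<open>An arbitrary choice, but a function of the rounded minor \<open>b\<close>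
    only.\<close>
  define w where "w b = (SOME w. minor_near n K (ungrid h b) t' w)" for b
  have w: "minor_near n K (ungrid h b) t' (w b)" if "ok b" for b
    using that unfolding ok_def w_def by (rule someI_ex)
  let ?S = "\<Pi>\<^sub>M l\<in>R. (borel :: real measure)" and ?T = "\<Pi>\<^sub>M l\<in>minor n. (borel :: real measure)"
  \<comment> \<open>Empty when \<open>b\<close> admits no family of near-minimizers, since
    \<open>w b\<close> is then meaningless.\<close>
  define G where "G b = {a \<in> space ?S. ok b \<and> (\<Sum>k<K. (\<Sum>j=1..n. a (1, j) * w b k j)\<^sup>2) \<le> K * \<sigma>\<^sup>2 / 2}" for b
  have sub: "R \<subseteq> upper_triangle n" "minor n \<subseteq> upper_triangle n" "R \<inter> minor n = {}"
    by (auto simp: R_def minor_def upper_triangle_def)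
  have ind: "indep_var ?S A ?T B"
    unfolding A_def B_def using sub by (intro indep_var_restrict[OF indep]) auto
  have g1: "{y \<in> space ?T. grid h (minor n) y = b} \<in> sets ?T" for b
    using sets_grid[OF finite_minor, of "\<lambda>l y. y l" ?T h "{b}"] by simp
  have G1: "G b \<in> sets ?S" for b
  proof -
    have "(\<lambda>a. a (1, j)) \<in> borel_measurable ?S" if "j \<in> {1..n}" for j
      using that by (intro measurable_component_singleton) (auto simp: R_def)
    then have "(\<lambda>a. \<Sum>k<K. (\<Sum>j=1..n. a (1, j) * w b k j)\<^sup>2) \<in> borel_measurable ?S"
      by (intro borel_measurable_sum borel_measurable_power borel_measurable_times borel_measurable_const)
    then show ?thesis unfolding G_def by measurable
  qed
  have "A \<in> measurable M ?S" using ind by (rule indep_var_rv1)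
  then have AS: "A \<omega> \<in> space ?S" if "\<omega> \<in> space M" for \<omega> using that by (rule measurable_space)
  have AG: "A \<omega> \<in> G b \<longleftrightarrow> ok b \<and> (\<Sum>k<K. (\<Sum>j=1..n. X (1, j) \<omega> * w b k j)\<^sup>2) \<le> K * \<sigma>\<^sup>2 / 2"
    if "\<omega> \<in> space M" for \<omega> b
    using AS[OF that] by (simp add: G_def A_def R_def)
  have G2: "prob (A -` G b \<inter> space M) \<le> 8 * \<mu> / (K * \<sigma> ^ 4)" for b
  proof (cases "ok b")
    case True
    have "A -` G b \<inter> space M = {\<omega> \<in> space M. (\<Sum>k<K. (\<Sum>j=1..n. X (1, j) \<omega> * w b k j)\<^sup>2) \<le> K * \<sigma>\<^sup>2 / 2}"
      using AG True by blast
    then show ?thesis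
      using row_projection_small[OF _ K \<sigma>, of "w b"] w[OF True] by (simp add: minor_near_def)
  next
    case False
    have "0 \<le> expectation (\<lambda>\<omega>. X (1, 1) \<omega> ^ 4)" by (rule Bochner_Integration.integral_nonneg) simp
    also have "\<dots> \<le> \<mu>" by (rule fourth_moment) (use n in \<open>simp add: upper_triangle_def\<close>)
    finally have "0 \<le> \<mu>" .
    then show ?thesis using False \<sigma> by (simp add: G_def)
  qed
  define E1 where "E1 = {\<omega> \<in> space M. A \<omega> \<in> G (grid h (minor n) (B \<omega>))}"
  define E2 where "E2 = {\<omega> \<in> space M. fourth_trace n (\<lambda>l. X l \<omega>) \<ge> c ^ 4}"
  have E1: "E1 \<in> events" "prob E1 \<le> 8 * \<mu> / (K * \<sigma> ^ 4)"
    unfolding E1_def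
    using prob_countable_selection_le[OF ind countable_PiE_int[OF finite_minor] g1 grid_in_PiE G1 G2] by auto
  have E2: "E2 \<in> events" "prob E2 \<le> 3 * \<mu> * n ^ 3 / c ^ 4"
    unfolding E2_def using prob_fourth_trace[of "c ^ 4"] c by auto
  have "\<omega> \<in> E1 \<union> E2" if \<omega>: "\<omega> \<in> space M" and deg: "degenerate n (2 * K) (\<lambda>l. X l \<omega>) t" for \<omega>
  proof (rule ccontr)
    assume "\<omega> \<notin> E1 \<union> E2"
    then have nE1: "\<omega> \<notin> E1" and tr: "fourth_trace n (\<lambda>l. X l \<omega>) < c ^ 4" using \<omega> by (auto simp: E2_def)
    define b where "b = grid h (minor n) (B \<omega>)"
    have close: "\<bar>X l \<omega> - ungrid h b l\<bar> \<le> h" if "l \<in> minor n" for l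
      using ungrid_grid_close[OF h(1) that, of "B \<omega>"] that by (simp add: b_def B_def)
    have ok: "ok b"
      unfolding ok_def t'_def by (rule minor_near_of_degenerate[OF n deg _ close]) (use h in auto)
    have norm: "\<bar>quadratic_form n (\<lambda>l. X l \<omega>) v\<bar> \<le> c" if "ip n v v = 1" for v
    proof -
      have "\<bar>quadratic_form n (\<lambda>l. X l \<omega>) v\<bar> ^ 4 < c ^ 4"
        using quadratic_form_power4_le[OF that, of "\<lambda>l. X l \<omega>"] tr by simp
      then show ?thesis using c power_less_imp_less_base[of _ 4 c] by (meson less_imp_le)
    qed
    have "(\<Sum>k<K. (\<Sum>j=1..n. X (1, j) \<omega> * w b k j)\<^sup>2) \<le> (\<Sum>k<K. 24 * c * t)"
      using first_row_small[OF n deg _ h(2) close w[OF ok, unfolded t'_def] norm] h(1)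
      by (intro sum_mono) auto
    also have "\<dots> \<le> K * \<sigma>\<^sup>2 / 2" using mult_left_mono[OF ct, of "real K"] by simp
    finally show False using nE1 ok AG[OF \<omega>, of b] \<omega> by (simp add: E1_def b_def)
  qed
  moreover have "prob (E1 \<union> E2) \<le> 8 * \<mu> / (K * \<sigma> ^ 4) + 3 * \<mu> * n ^ 3 / c ^ 4"
    using measure_Un_le[OF E1(1) E2(1)] E1 E2 by linarith
  ultimately show ?thesis using that E1 E2 by blast
qed

end


section \<open>Resampling one entry\<close>

lemma random_vector_measurable:
  "(\<And>i. i \<in> I \<Longrightarrow> X i \<in> borel_measurable N) \<Longrightarrow> random_vector I X \<in> measurable N (\<Pi>\<^sub>M i\<in>I. borel)"
  unfolding random_vector_def by (rule measurable_restrict)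

lemma measurable_of_random_vector:
  assumes "random_vector I Y \<in> measurable N (\<Pi>\<^sub>M i\<in>I. borel)" "i \<in> I"
  shows "Y i \<in> borel_measurable N"
proof -
  have "(\<lambda>x. x i) \<circ> random_vector I Y \<in> borel_measurable N"
    by (rule measurable_comp[OF assms(1) measurable_component_singleton[OF assms(2)]])
  moreover have "(\<lambda>x. x i) \<circ> random_vector I Y = Y i" using assms(2) by (auto simp: random_vector_def)
  ultimately show ?thesis by simp
qed

context prob_space
begin

lemma independent_copyD:
  assumes "independent_copy M I X Y"
  shows "indep_var (\<Pi>\<^sub>M i\<in>I. borel) (random_vector I X) (\<Pi>\<^sub>M i\<in>I. borel) (random_vector I Y)"
    "distr M (\<Pi>\<^sub>M i\<in>I. borel) (random_vector I Y) = distr M (\<Pi>\<^sub>M i\<in>I. borel) (random_vector I X)"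
  using assms by (simp_all add: independent_copy_def)

lemma independent_copy_measurable:
  assumes "independent_copy M I X Y" "i \<in> I"
  shows "Y i \<in> borel_measurable M"
  by (rule measurable_of_random_vector[OF indep_var_rv2[OF independent_copyD(1)[OF assms(1)]] assms(2)])

lemma independent_copy_marginal:
  assumes copy: "independent_copy M I X Y" and i: "i \<in> I"
  shows "distr M borel (Y i) = distr M borel (X i)"
proof -
  let ?N = "\<Pi>\<^sub>M i\<in>I. (borel :: real measure)"
  have rv: "random_vector I X \<in> measurable M ?N" "random_vector I Y \<in> measurable M ?N"
    and eq: "distr M ?N (random_vector I Y) = distr M ?N (random_vector I X)"
    using indep_var_rv1[OF independent_copyD(1)[OF copy]] indep_var_rv2[OF independent_copyD(1)[OF copy]]
      independent_copyD(2)[OF copy] by simp_all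
  have c: "(\<lambda>x. x i) \<in> measurable ?N borel" by (rule measurable_component_singleton[OF i])
  have "(\<lambda>x. x i) \<circ> random_vector I Z = Z i" for Z :: "'b \<Rightarrow> 'a \<Rightarrow> real"
    using i by (auto simp: random_vector_def)
  then show ?thesis using distr_distr[OF c rv(1)] distr_distr[OF c rv(2)] eq by simp
qed

text \<open>The perturbed input lies in a box exactly when the original lies in the box with side
  \<open>l\<close> freed and the copy in the box with all other sides freed. Independence of the
  copy factors the probability, and box probabilities determine the law as a product.\<close>

lemma distr_perturbed_input:
  assumes I: "finite I" and indep: "indep_vars (\<lambda>_. borel) X I"
    and copy: "independent_copy M I X Y" and l: "l \<in> I"
  shows "distr M (\<Pi>\<^sub>M i\<in>I. borel) (perturbed_input I {l} X Y) = distr M (\<Pi>\<^sub>M i\<in>I. borel) (random_vector I X)"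
proof -
  let ?N = "\<Pi>\<^sub>M i\<in>I. (borel :: real measure)"
  let ?Q = "\<lambda>i. distr M borel (X i)"
  have X: "X i \<in> borel_measurable M" if "i \<in> I" for i using indep that by (simp add: indep_vars_def)
  have Y: "Y i \<in> borel_measurable M" if "i \<in> I" for i using independent_copy_measurable[OF copy that] .
  have rvP: "perturbed_input I {l} X Y \<in> measurable M ?N"
    unfolding perturbed_input_def by (rule random_vector_measurable) (use X Y in auto)
  have rvX: "random_vector I X \<in> measurable M ?N" and rvY: "random_vector I Y \<in> measurable M ?N"
    using X Y by (auto intro: random_vector_measurable)
  have iv: "indep_var ?N (random_vector I X) ?N (random_vector I Y)"
    and eq: "distr M ?N (random_vector I Y) = distr M ?N (random_vector I X)"
    using independent_copyD[OF copy] by simp_all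
  have boxes: "PiE I A \<in> sets ?N" if "\<And>i. i \<in> I \<Longrightarrow> A i \<in> sets borel" for A :: "'b \<Rightarrow> real set"
    using I that by (rule sets_PiM_I_finite)
  have box: "prob (random_vector I X -` PiE I A \<inter> space M) = (\<Prod>i\<in>I. prob (X i -` A i \<inter> space M))"
    if A: "\<And>i. i \<in> I \<Longrightarrow> A i \<in> sets borel" for A :: "'b \<Rightarrow> real set"
  proof -
    have "random_vector I X -` PiE I A \<inter> space M = (\<Inter>i\<in>I. X i -` A i \<inter> space M)"
      using l by (auto simp: random_vector_def PiE_iff)
    then show ?thesis
      using indep_varsD_finite[OF indep _ I, of A] l A by auto
  qed
  have P_box: "prob (perturbed_input I {l} X Y -` PiE I A \<inter> space M) = (\<Prod>i\<in>I. prob (X i -` A i \<inter> space M))"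
    if A: "\<And>i. i \<in> I \<Longrightarrow> A i \<in> sets borel" for A :: "'b \<Rightarrow> real set"
  proof -
    define A1 where "A1 = A(l := UNIV)"
    define A2 :: "'b \<Rightarrow> real set" where "A2 = (\<lambda>i. if i = l then A i else UNIV)"
    have A1: "\<And>i. i \<in> I \<Longrightarrow> A1 i \<in> sets borel" and A2: "\<And>i. i \<in> I \<Longrightarrow> A2 i \<in> sets borel"
      using A by (auto simp: A1_def A2_def)
    have "perturbed_input I {l} X Y -` PiE I A \<inter> space M
        = (\<lambda>x. (random_vector I X x, random_vector I Y x)) -` (PiE I A1 \<times> PiE I A2) \<inter> space M"
      using l by (auto simp: perturbed_input_def random_vector_def A1_def A2_def PiE_iff split: if_splits)
    then have "prob (perturbed_input I {l} X Y -` PiE I A \<inter> space M)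
        = prob (random_vector I X -` PiE I A1 \<inter> space M) * prob (random_vector I Y -` PiE I A2 \<inter> space M)"
      using indep_varD[OF iv boxes[OF A1] boxes[OF A2]] by simp
    also have "prob (random_vector I Y -` PiE I A2 \<inter> space M) = prob (random_vector I X -` PiE I A2 \<inter> space M)"
      using measure_distr[OF rvY boxes[OF A2]] measure_distr[OF rvX boxes[OF A2]] eq by simp
    also have "prob (random_vector I X -` PiE I A1 \<inter> space M) * prob (random_vector I X -` PiE I A2 \<inter> space M)
        = (\<Prod>i\<in>I. prob (X i -` A1 i \<inter> space M) * prob (X i -` A2 i \<inter> space M))"
      by (simp add: box A1 A2 prod.distrib)
    also have "\<dots> = (\<Prod>i\<in>I. prob (X i -` A i \<inter> space M))"
      by (intro prod.cong refl) (simp add: A1_def A2_def prob_space)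
    finally show ?thesis .
  qed
  have prob_Q: "prob_space (?Q i)" if "i \<in> I" for i using X[OF that] by (rule prob_space_distr)
  \<comment> \<open>Outside \<open>I\<close> a point mass serves as filler, because the product
    locale wants a probability measure at every index of the type.\<close>
  define Q where "Q i = (if i \<in> I then ?Q i else return borel 0)" for i
  have Q: "prob_space (Q i)" for i using prob_Q by (simp add: Q_def prob_space_return)
  interpret Q: product_prob_space Q by (rule product_prob_spaceI) (rule Q)
  have sets_Q: "sets (\<Pi>\<^sub>M i\<in>I. Q i) = sets ?N" by (rule sets_PiM_cong) (auto simp: Q_def)
  have prod: "distr M ?N Z = (\<Pi>\<^sub>M i\<in>I. Q i)"
    if Z: "Z \<in> measurable M ?N" and bx: "\<And>A. (\<And>i. i \<in> I \<Longrightarrow> A i \<in> sets borel) \<Longrightarrow>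
        prob (Z -` PiE I A \<inter> space M) = (\<Prod>i\<in>I. prob (X i -` A i \<inter> space M))" for Z
  proof (rule Q.PiM_eqI[OF I])
    show "sets (distr M ?N Z) = sets (\<Pi>\<^sub>M i\<in>I. Q i)" using sets_Q by simp
    fix A assume "\<And>i. i \<in> I \<Longrightarrow> A i \<in> sets (Q i)"
    then have A: "\<And>i. i \<in> I \<Longrightarrow> A i \<in> sets borel" by (auto simp: Q_def)
    have "emeasure (distr M ?N Z) (PiE I A) = ennreal (\<Prod>i\<in>I. prob (X i -` A i \<inter> space M))"
      using emeasure_distr[OF Z boxes[OF A]] bx[OF A] by (simp add: emeasure_eq_measure)
    also have "\<dots> = (\<Prod>i\<in>I. emeasure (Q i) (A i))"
      using X A by (simp add: prod_ennreal[symmetric] Q_def emeasure_distr emeasure_eq_measure)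
    finally show "emeasure (distr M ?N Z) (PiE I A) = (\<Prod>i\<in>I. emeasure (Q i) (A i))" .
  qed
  show ?thesis using prod[OF rvP P_box] prod[OF rvX box] by simp
qed

text \<open>On the rounded level equality in law extends to an arbitrary set \<open>D\<close> of
  grid values, such as one defined by the existence of certain near-minimizers.\<close>

lemma prob_grid_perturbed_input:
  assumes I: "finite I" and indep: "indep_vars (\<lambda>_. borel) X I"
    and copy: "independent_copy M I X Y" and l: "l \<in> I"
  shows "prob {\<omega> \<in> space M. grid h I (perturbed_input I {l} X Y \<omega>) \<in> D}
    = prob {\<omega> \<in> space M. grid h I (\<lambda>i. X i \<omega>) \<in> D}"
proof -
  let ?N = "\<Pi>\<^sub>M i\<in>I. (borel :: real measure)"
  let ?G = "{x \<in> space ?N. grid h I x \<in> D}"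
  have X: "X i \<in> borel_measurable M" if "i \<in> I" for i using indep that by (simp add: indep_vars_def)
  have Y: "Y i \<in> borel_measurable M" if "i \<in> I" for i using independent_copy_measurable[OF copy that] .
  have rvP: "perturbed_input I {l} X Y \<in> measurable M ?N"
    unfolding perturbed_input_def by (rule random_vector_measurable) (use X Y in auto)
  have rvX: "random_vector I X \<in> measurable M ?N" using X by (rule random_vector_measurable)
  have G: "?G \<in> sets ?N"
    using sets_grid[OF I, of "\<lambda>i x. x i" ?N h D] by simp
  have "grid h I (random_vector I X \<omega>) = grid h I (\<lambda>i. X i \<omega>)" for \<omega>
    by (simp add: grid_def random_vector_def fun_eq_iff)
  then have "random_vector I X -` ?G \<inter> space M = {\<omega> \<in> space M. grid h I (\<lambda>i. X i \<omega>) \<in> D}"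
    using measurable_space[OF rvX] by auto
  moreover have "perturbed_input I {l} X Y -` ?G \<inter> space M = {\<omega> \<in> space M. grid h I (perturbed_input I {l} X Y \<omega>) \<in> D}"
    using measurable_space[OF rvP] by auto
  ultimately show ?thesis
    using measure_distr[OF rvX G] measure_distr[OF rvP G] distr_perturbed_input[OF assms] by simp
qed

end

section \<open>Rarity of large entries and of localized pairs\<close>

context wigner
begin

lemma prob_large_entry:
  assumes l: "l \<in> upper_triangle n" and Z: "Z \<in> borel_measurable M"
    and eq: "distr M borel Z = distr M borel (X l)" and C: "0 < C"
  shows "prob {\<omega> \<in> space M. C \<le> \<bar>Z \<omega>\<bar>} \<le> \<sigma>\<^sup>2 / C\<^sup>2"
proof -
  have X: "X l \<in> borel_measurable M" by (rule random_variable_entry[OF l])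
  have S: "{x :: real. C \<le> \<bar>x\<bar>} \<in> sets borel" by measurable
  have "prob {\<omega> \<in> space M. C \<le> \<bar>Z \<omega>\<bar>} = measure (distr M borel Z) {x. C \<le> \<bar>x\<bar>}"
    using measure_distr[OF Z S] by (simp add: vimage_def Int_def conj_commute)
  also have "\<dots> = prob {\<omega> \<in> space M. C \<le> \<bar>X l \<omega>\<bar>}"
    unfolding eq using measure_distr[OF X S] by (simp add: vimage_def Int_def conj_commute)
  also have "{\<omega> \<in> space M. C \<le> \<bar>X l \<omega>\<bar>} = {\<omega> \<in> space M. C\<^sup>2 \<le> (X l \<omega>)\<^sup>2}"
    using C by (auto simp: abs_le_square_iff[symmetric])
  also have "prob \<dots> \<le> expectation (\<lambda>\<omega>. (X l \<omega>)\<^sup>2) / C\<^sup>2"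
    using integrable_power[OF l, of 2] C by (intro integral_Markov_inequality_measure[where A = "space M"]) auto
  finally show ?thesis using second_moment[OF l] by simp
qed

text \<open>Off \<open>E\<close> the rounded input is not degenerate at \<open>t'\<close>: undoing
  the rounding costs \<open>2 * n * h \<le> t'\<close> and would make the input degenerate at
  \<open>2 * t'\<close>. Its near-minimizers are then covered with radius \<open>1 / sqrt n\<close>,
  the scale of a typical coordinate, and fewer than \<open>2 * K\<close> directions give the
  fraction \<open>16 * K / (c - 2)\<close>. On \<open>E\<close> all blocks are counted.\<close>

lemma sum_prob_localized:
  fixes h c t' :: real
  assumes n: "n \<ge> 1" and h: "0 < h" "2 * real n * h * (2 * sqrt n) ^ (2 * (2 * K)) \<le> t'" "2 * real n * h \<le> t'"
    and c: "2 < c" and E: "E \<in> events"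
    and deg: "\<And>\<omega>. \<omega> \<in> space M \<Longrightarrow> degenerate n (2 * K) (\<lambda>l. X l \<omega>) (2 * t') \<Longrightarrow> \<omega> \<in> E"
  shows "(\<Sum>l\<in>upper_triangle n. prob {\<omega> \<in> space M.
      localized n (ungrid h (grid h (upper_triangle n) (\<lambda>l. X l \<omega>))) (2 * real n * h) c l})
    \<le> (prob E + 16 * real K / (c - 2)) * card (upper_triangle n)"
proof -
  let ?I = "upper_triangle n"
  let ?x = "\<lambda>\<omega>. ungrid h (grid h ?I (\<lambda>l. X l \<omega>))"
  let ?B = "\<lambda>l. {\<omega> \<in> space M. localized n (?x \<omega>) (2 * real n * h) c l}"
  have B: "?B l \<in> events" for l
    using sets_grid[OF finite_upper_triangle random_variable_entry,
        where h = h and D = "{b. localized n (ungrid h b) (2 * real n * h) c l}"]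
    by simp
  have le: "(\<Sum>l\<in>?I. indicat_real (?B l) \<omega>) \<le> card ?I * indicat_real E \<omega> + 16 * real K / (c - 2) * card ?I"
    if \<omega>: "\<omega> \<in> space M" for \<omega>
  proof -
    have s: "(\<Sum>l\<in>?I. indicat_real (?B l) \<omega>) = card {l \<in> ?I. localized n (?x \<omega>) (2 * real n * h) c l}"
      unfolding indicator_def using \<omega> by (simp add: sum.If_cases Int_def)
    show ?thesis
    proof (cases "\<omega> \<in> E")
      case True
      have "card {l \<in> ?I. localized n (?x \<omega>) (2 * real n * h) c l} \<le> card ?I"
        by (rule card_mono) auto
      then show ?thesis unfolding s using True c by (simp add: add_increasing2)
    next
      case False
      have "\<not> degenerate n (2 * K) (?x \<omega>) t'"
      proof
        assume "degenerate n (2 * K) (?x \<omega>) t'"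
        then obtain e where e: "orthonormal n (2 * K) e" "\<And>j. j < 2 * K \<Longrightarrow> e j \<in> near_min n (?x \<omega>) t'"
          unfolding degenerate_def by blast
        have "e j \<in> near_min n (\<lambda>l. X l \<omega>) (t' + 2 * real n * h)" if "j < 2 * K" for j
          using ungrid_grid_close[OF h(1), of _ ?I "\<lambda>l. X l \<omega>"] h(1)
          by (intro near_min_close[OF _ _ e(2)[OF that]]) (auto simp: abs_minus_commute)
        then have "degenerate n (2 * K) (\<lambda>l. X l \<omega>) (t' + 2 * real n * h)"
          unfolding degenerate_def using e(1) by blast
        then have "degenerate n (2 * K) (\<lambda>l. X l \<omega>) (2 * t')"
          by (rule degenerate_mono) (use h in linarith)
        then show False using deg[OF \<omega>] False by blast
      qed
      \<comment> \<open>This radius turns \<open>2 / \<rho>\<close> into \<open>2 * sqrt n\<close>;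
        the smallness of \<open>h\<close> compensates for its power.\<close>
      then obtain j e where j: "j < 2 * K" "orthonormal n j e"
        "\<And>v. v \<in> near_min n (?x \<omega>) (2 * real n * h) \<Longrightarrow> ip n (resid n j e v) (resid n j e v) \<le> (1 / sqrt n)\<^sup>2"
      proof (rule near_min_cover[OF n])
        show "0 < 1 / sqrt n" "1 / sqrt n \<le> 1" "0 \<le> 2 * real n * h" using n h by auto
        show "2 * real n * h * (2 / (1 / sqrt n)) ^ (2 * (2 * K)) \<le> t'" using h(2) by simp
      qed (use that in blast)
      have "card {l \<in> ?I. localized n (?x \<omega>) (2 * real n * h) c l} \<le> 8 * real j / (c - 2) * card ?I"
        using j(3) n by (intro card_localized_le[OF n j(2) c]) (simp add: power_divide)
      also have "\<dots> \<le> 8 * real (2 * K) / (c - 2) * card ?I"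
        using j(1) c by (intro mult_right_mono divide_right_mono) auto
      finally show ?thesis unfolding s using False by simp
    qed
  qed
  have int: "integrable M (indicat_real (?B l))" for l
    using B by (intro integrable_real_indicator) (auto simp: emeasure_eq_measure)
  have intE: "integrable M (indicat_real E)"
    using E by (intro integrable_real_indicator) (auto simp: emeasure_eq_measure)
  have "(\<Sum>l\<in>?I. prob (?B l)) = expectation (\<lambda>\<omega>. \<Sum>l\<in>?I. indicat_real (?B l) \<omega>)"
    using int B by (subst Bochner_Integration.integral_sum) auto
  also have "\<dots> \<le> expectation (\<lambda>\<omega>. card ?I * indicat_real E \<omega> + 16 * real K / (c - 2) * card ?I)"
    using int intE le by (intro integral_mono Bochner_Integration.integrable_sum Bochner_Integration.integrable_add
      integrable_mult_right integrable_const) auto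
  also have "\<dots> = card ?I * prob E + 16 * real K / (c - 2) * card ?I"
    using intE E by (simp add: prob_space)
  finally show ?thesis by (simp add: algebra_simps)
qed

end


section \<open>Stability\<close>

context wigner
begin

text \<open>\<open>C1\<close> bounds the change of the entry and \<open>C2\<close> is the
  localization level: at a good block, resampling moves the energy of either minimizer by at most
  \<open>2 * C1 * C2 / n\<close>, and both together give the tolerance
  \<open>4 * C1 * C2 / n\<close>. The bound \<open>\<epsilon> \<le> 1\<close> keeps the cover radius
  \<open>\<epsilon> / 4\<close> below 1, while the packing radius stays
  \<open>\<epsilon>0\<close>.\<close>

lemma instability_prob:
  fixes Y :: "nat \<times> nat \<Rightarrow> nat \<times> nat \<Rightarrow> 'w \<Rightarrow> real" and \<epsilon> \<epsilon>0 C1 C2 h t :: real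
  assumes n: "n \<ge> 1" and \<epsilon>: "0 < \<epsilon>" "\<epsilon> \<le> 1" "\<epsilon> \<le> \<epsilon>0" and C: "0 < C1" "2 < C2"
    and t: "4 * C1 * C2 / n * (2 / (\<epsilon> / 4)) ^ (2 * (2 * K)) \<le> t"
    and h: "0 < h" "2 * real n * h * (2 * sqrt n) ^ (2 * (2 * K)) \<le> t" "2 * real n * h \<le> t"
    and E: "E \<in> events" "\<And>\<omega>. \<omega> \<in> space M \<Longrightarrow> degenerate n (2 * K) (\<lambda>l. X l \<omega>) (2 * t) \<Longrightarrow> \<omega> \<in> E"
    and copy: "\<And>l. l \<in> upper_triangle n \<Longrightarrow> independent_copy M (upper_triangle n) X (Y l)"
  shows "outer_measure_of M {\<omega> \<in> space M.
      (INF A \<in> {A. A \<subseteq> upper_triangle n \<and> real (card A) > (1 - \<epsilon>0) * real (card (upper_triangle n))}.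
        packing_number
          ((\<lambda>l. arg_min_on (quadratic_form n (perturbed_input (upper_triangle n) {l} X (Y l) \<omega>)) (half_sphere n)) ` A)
          (euclidean_distance n) \<epsilon>0) \<ge> enat (packing_bound \<epsilon>0 (2 * K) + 1)}
    \<le> ennreal (prob E + (8 * \<sigma>\<^sup>2 / C1\<^sup>2 + 2 * (prob E + 16 * real K / (C2 - 2))) / \<epsilon>)"
    (is "outer_measure_of M ?Bad \<le> _")
proof -
  let ?I = "upper_triangle n"
  let ?Z = "\<lambda>l. perturbed_input ?I {l} X (Y l)"
  define s where "s = 2 * real n * h"
  define D where "D l = {\<omega> \<in> space M. C1 < \<bar>Y l l \<omega> - X l \<omega>\<bar>}" for l
  define L1 where "L1 l = {\<omega> \<in> space M. localized n (ungrid h (grid h ?I (\<lambda>l. X l \<omega>))) s C2 l}" for l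
  define L2 where "L2 l = {\<omega> \<in> space M. localized n (ungrid h (grid h ?I (?Z l \<omega>))) s C2 l}" for l
  define B where "B l = D l \<union> (L1 l \<union> L2 l)" for l
  have X: "X l \<in> borel_measurable M" if "l \<in> ?I" for l using random_variable_entry[OF that] .
  have Y: "Y l i \<in> borel_measurable M" if "l \<in> ?I" "i \<in> ?I" for l i
    using independent_copy_measurable[OF copy[OF that(1)] that(2)] .
  have Zm: "(\<lambda>\<omega>. ?Z l \<omega> i) \<in> borel_measurable M" if "l \<in> ?I" "i \<in> ?I" for l i
    using X Y that by (auto simp: perturbed_input_def random_vector_def)
  have Dm: "D l \<in> events" if "l \<in> ?I" for l
    unfolding D_def using X[OF that] Y[OF that that] by measurable
  have L1m: "L1 l \<in> events" for l
    using sets_grid[OF finite_upper_triangle X, where h = h and D = "{b. localized n (ungrid h b) s C2 l}"]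
    by (simp add: L1_def)
  have L2m: "L2 l \<in> events" if "l \<in> ?I" for l
    using sets_grid[OF finite_upper_triangle Zm[OF that], where h = h and D = "{b. localized n (ungrid h b) s C2 l}"]
    by (simp add: L2_def)
  have Bm: "B l \<in> events" if "l \<in> ?I" for l
    using Dm[OF that] L1m L2m[OF that] by (simp add: B_def)
  have L12: "prob (L2 l) = prob (L1 l)" if "l \<in> ?I" for l
    using prob_grid_perturbed_input[OF finite_upper_triangle indep copy[OF that] that,
        where h = h and D = "{b. localized n (ungrid h b) s C2 l}"]
    by (simp add: L1_def L2_def)
  \<comment> \<open>A difference above \<open>C1\<close> forces one of the two entries to be at
    least \<open>C1 / 2\<close> in absolute value; Chebyshev for both gives the factor 8.\<close>
  have D_le: "prob (D l) \<le> 8 * \<sigma>\<^sup>2 / C1\<^sup>2" if l: "l \<in> ?I" for l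
  proof -
    let ?U = "\<lambda>V :: 'w \<Rightarrow> real. {\<omega> \<in> space M. C1 / 2 \<le> \<bar>V \<omega>\<bar>}"
    have m: "?U (Y l l) \<in> events" "?U (X l) \<in> events"
      using X[OF l] Y[OF l l] by measurable
    have "prob (D l) \<le> prob (?U (Y l l) \<union> ?U (X l))"
      by (rule finite_measure_mono) (use m in \<open>auto simp: D_def\<close>)
    also have "\<dots> \<le> prob (?U (Y l l)) + prob (?U (X l))" by (rule measure_Un_le[OF m])
    also have "\<dots> \<le> \<sigma>\<^sup>2 / (C1 / 2)\<^sup>2 + \<sigma>\<^sup>2 / (C1 / 2)\<^sup>2"
      using C X[OF l] Y[OF l l] independent_copy_marginal[OF copy[OF l] l]
      by (intro add_mono prob_large_entry[OF l]) auto
    also have "\<dots> = 8 * \<sigma>\<^sup>2 / C1\<^sup>2" by (simp add: power_divide)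
    finally show ?thesis .
  qed
  define \<theta> where "\<theta> = 8 * \<sigma>\<^sup>2 / C1\<^sup>2 + 2 * (prob E + 16 * real K / (C2 - 2))"
  have "(\<Sum>l\<in>?I. prob (B l)) \<le> (\<Sum>l\<in>?I. 8 * \<sigma>\<^sup>2 / C1\<^sup>2 + 2 * prob (L1 l))"
  proof (rule sum_mono)
    fix l assume l: "l \<in> ?I"
    have "prob (B l) \<le> prob (D l) + prob (L1 l \<union> L2 l)"
      unfolding B_def using L1m L2m[OF l] by (intro measure_Un_le Dm[OF l] sets.Un)
    also have "prob (L1 l \<union> L2 l) \<le> prob (L1 l) + prob (L2 l)" by (rule measure_Un_le[OF L1m L2m[OF l]])
    finally show "prob (B l) \<le> 8 * \<sigma>\<^sup>2 / C1\<^sup>2 + 2 * prob (L1 l)" using D_le[OF l] L12[OF l] by linarith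
  qed
  also have "\<dots> = 8 * \<sigma>\<^sup>2 / C1\<^sup>2 * card ?I + 2 * (\<Sum>l\<in>?I. prob (L1 l))"
    by (simp add: sum.distrib sum_distrib_left)
  also have "\<dots> \<le> 8 * \<sigma>\<^sup>2 / C1\<^sup>2 * card ?I + 2 * ((prob E + 16 * real K / (C2 - 2)) * card ?I)"
    using sum_prob_localized[OF n h C(2) E] by (simp add: L1_def s_def)
  also have "\<dots> = \<theta> * card ?I" by (simp add: \<theta>_def algebra_simps)
  finally have sumB: "(\<Sum>l\<in>?I. prob (B l)) \<le> \<theta> * card ?I" .
  define F where "F = {\<omega> \<in> space M. \<epsilon> * card ?I \<le> card {l \<in> ?I. \<omega> \<in> B l}}"
  have ne: "?I \<noteq> {}" using n by (auto simp: upper_triangle_def)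
  have F: "F \<in> events" "prob F \<le> \<theta> / \<epsilon>"
    unfolding F_def using prob_count_ge[OF finite_upper_triangle ne Bm sumB \<epsilon>(1)] by simp_all
  have "?Bad \<subseteq> E \<union> F"
  proof (rule subsetI, rule ccontr)
    fix \<omega> assume bad: "\<omega> \<in> ?Bad" and "\<omega> \<notin> E \<union> F"
    then have \<omega>: "\<omega> \<in> space M" and nE: "\<omega> \<notin> E" and nF: "\<omega> \<notin> F" by auto
    define A where "A = {l \<in> ?I. \<omega> \<notin> B l}"
    define x where "x = (\<lambda>l. X l \<omega>)"
    define \<tau> where "\<tau> = 4 * C1 * C2 / n"
    define u where "u l = arg_min_on (quadratic_form n (?Z l \<omega>)) (half_sphere n)" for l
    define v where "v = arg_min_on (quadratic_form n x) (half_sphere n)"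
    have u: "u l \<in> near_min n (?Z l \<omega>) 0" and v: "v \<in> near_min n x 0" for l
      unfolding u_def v_def by (rule arg_min_on_near_min[OF n])+
    have "card A + card {l \<in> ?I. \<omega> \<in> B l} = card (A \<union> {l \<in> ?I. \<omega> \<in> B l})"
      by (rule card_Un_disjoint[symmetric]) (auto simp: A_def)
    also have "A \<union> {l \<in> ?I. \<omega> \<in> B l} = ?I" by (auto simp: A_def)
    finally have "real (card A) = card ?I - real (card {l \<in> ?I. \<omega> \<in> B l})" by linarith
    moreover have "real (card {l \<in> ?I. \<omega> \<in> B l}) < \<epsilon> * card ?I" using nF \<omega> by (simp add: F_def)
    moreover have "\<epsilon> * card ?I \<le> \<epsilon>0 * card ?I" using \<epsilon> by (intro mult_right_mono) auto
    ultimately have big: "real (card A) > (1 - \<epsilon>0) * real (card ?I)" by (simp add: left_diff_distrib)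
    have near: "u l \<in> near_min n x \<tau>" if "l \<in> A" for l
    proof -
      obtain i j where l: "l = (i, j)" by (cases l)
      have lI: "l \<in> ?I" and nB: "\<omega> \<notin> B l" using that by (auto simp: A_def)
      \<comment> \<open>A minimizer for \<open>z\<close> is a near-minimizer for the rounded
        \<open>z\<close> at tolerance \<open>s\<close>, so the absence of localization, recorded for
        the rounded input, bounds its coordinates.\<close>
      have small: "\<bar>y i * y j\<bar> \<le> C2 / n" if "y \<in> near_min n z 0"
        and nl: "\<not> localized n (ungrid h (grid h ?I z)) s C2 l" for y z
      proof -
        have "y \<in> near_min n (ungrid h (grid h ?I z)) (0 + 2 * real n * h)"
          using h(1) ungrid_grid_close[OF h(1)] by (intro near_min_close[OF _ _ that(1)]) auto
        then show ?thesis using nl by (auto simp: localized_def l s_def not_less)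
      qed
      have "\<bar>v i * v j\<bar> \<le> C2 / n"
        using nB \<omega> by (intro small[OF v]) (simp add: B_def L1_def x_def)
      moreover have "\<bar>u l i * u l j\<bar> \<le> C2 / n"
        using nB \<omega> by (intro small[OF u]) (simp add: B_def L2_def)
      moreover have Zl: "?Z l \<omega> l = Y l l \<omega>"
        using lI by (simp add: perturbed_input_def random_vector_def)
      have "\<bar>x l - ?Z l \<omega> l\<bar> \<le> C1"
        unfolding Zl using nB \<omega> by (simp add: B_def D_def x_def abs_minus_commute)
      moreover have diff: "\<bar>quadratic_form n x y - quadratic_form n (?Z l \<omega>) y\<bar>
          \<le> 2 * \<bar>x l - ?Z l \<omega> l\<bar> * \<bar>y i * y j\<bar>" for y
        unfolding l using lI
        by (intro quadratic_form_single_entry) (auto simp: l perturbed_input_def random_vector_def x_def)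
      have step: "\<bar>quadratic_form n x y - quadratic_form n (?Z l \<omega>) y\<bar> \<le> \<tau> / 2"
        if "\<bar>y i * y j\<bar> \<le> C2 / n" "\<bar>x l - ?Z l \<omega> l\<bar> \<le> C1" for y
      proof -
        have "2 * \<bar>x l - ?Z l \<omega> l\<bar> * \<bar>y i * y j\<bar> \<le> 2 * C1 * (C2 / n)"
          using that C by (intro mult_mono) auto
        then show ?thesis using diff[of y] by (simp add: \<tau>_def)
      qed
      ultimately have "\<bar>quadratic_form n x v - quadratic_form n (?Z l \<omega>) v\<bar> \<le> \<tau> / 2"
        "\<bar>quadratic_form n x (u l) - quadratic_form n (?Z l \<omega>) (u l)\<bar> \<le> \<tau> / 2"
        by (auto intro: step)
      moreover have "quadratic_form n (?Z l \<omega>) (u l) \<le> quadratic_form n (?Z l \<omega>) v"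
        using u[of l] v by (simp add: near_min_def)
      \<comment> \<open>Passing to the perturbed matrix at \<open>u l\<close> and back at
        \<open>v\<close> costs \<open>\<tau> / 2\<close> each; in between, \<open>u l\<close> is
        optimal.\<close>
      ultimately have "quadratic_form n x (u l) \<le> quadratic_form n x v + \<tau>"
        unfolding abs_le_iff by linarith
      moreover have "quadratic_form n x v \<le> quadratic_form n x y" if "ip n y y = 1" for y
        using v that by (simp add: near_min_def)
      ultimately have "quadratic_form n x (u l) \<le> quadratic_form n x y + \<tau>" if "ip n y y = 1" for y
        using that by (meson add_right_mono order_trans)
      then show ?thesis using u[of l] by (simp add: near_min_def)
    qed
    have \<tau>0: "0 \<le> \<tau>" using C n by (simp add: \<tau>_def)
    have t0: "0 \<le> t" using h by (smt (verit) of_nat_0_le_iff mult_nonneg_nonneg)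
    have "\<not> degenerate n (2 * K) x t"
      using E(2)[OF \<omega>] nE degenerate_mono[of n "2 * K" x t "2 * t"] t0 by (auto simp: x_def)
    then obtain j e where j: "j < 2 * K" "orthonormal n j e"
      "\<And>y. y \<in> near_min n x \<tau> \<Longrightarrow> ip n (resid n j e y) (resid n j e y) \<le> (\<epsilon> / 4)\<^sup>2"
    proof (rule near_min_cover[OF n])
      show "0 < \<epsilon> / 4" "\<epsilon> / 4 \<le> 1" using \<epsilon> by auto
      show "\<tau> * (2 / (\<epsilon> / 4)) ^ (2 * (2 * K)) \<le> t" using t by (simp add: \<tau>_def)
    qed (use \<tau>0 that in blast)+
    have "packing_number (u ` A) (euclidean_distance n) \<epsilon>0 \<le> enat (packing_bound \<epsilon>0 (2 * K))"
    proof (rule packing_number_near_subspace[OF j(2), of "2 * K" \<epsilon>0 "\<epsilon> / 4"])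
      fix y assume "y \<in> u ` A"
      then have "y \<in> near_min n x \<tau>" using near by blast
      then show "ip n y y = 1 \<and> ip n (resid n j e y) (resid n j e y) \<le> (\<epsilon> / 4)\<^sup>2"
        using j(3) by (auto simp: near_min_def)
    qed (use j(1) \<epsilon> in auto)
    moreover have "enat (packing_bound \<epsilon>0 (2 * K) + 1) \<le> packing_number (u ` A) (euclidean_distance n) \<epsilon>0"
    proof -
      have "A \<in> {A. A \<subseteq> ?I \<and> real (card A) > (1 - \<epsilon>0) * real (card ?I)}" using big by (auto simp: A_def)
      moreover have "enat (packing_bound \<epsilon>0 (2 * K) + 1) \<le> (INF A \<in> {A. A \<subseteq> ?I \<and> real (card A) > (1 - \<epsilon>0) * real (card ?I)}.
        packing_number (u ` A) (euclidean_distance n) \<epsilon>0)"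
        using bad unfolding u_def by simp
      ultimately show ?thesis by (meson INF_lower order_trans)
    qed
    \<comment> \<open>The \<open>+ 1\<close> makes the bounds incompatible, since the bad set is
      defined by a non-strict inequality.\<close>
    ultimately have "enat (packing_bound \<epsilon>0 (2 * K) + 1) \<le> enat (packing_bound \<epsilon>0 (2 * K))"
      by (rule order_trans[rotated])
    then show False by simp
  qed
  then have "outer_measure_of M ?Bad \<le> outer_measure_of M (E \<union> F)" by (rule outer_measure_of_mono)
  also have "\<dots> = emeasure M (E \<union> F)" using E F by (intro outer_measure_of_eq) simp
  also have "\<dots> \<le> ennreal (prob E + \<theta> / \<epsilon>)"
    unfolding emeasure_eq_measure using measure_Un_le[OF E(1) F(1)] F(2) by (intro ennreal_leI) linarith
  finally show ?thesis by (simp add: \<theta>_def)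
qed

end

text \<open>A measure with a density has no atom at 0, so \<open>x\<^sup>2\<close> is positive
  almost everywhere. Positivity matters because the lower bound for the first row is proportional to
  the variance.\<close>

lemma variance_pos_of_density:
  fixes f :: "real \<Rightarrow> real"
  assumes P: "prob_space P" and f: "f \<in> borel_measurable borel" and d: "P = density lborel (\<lambda>x. ennreal (f x))"
    and int: "integrable P (\<lambda>x. x\<^sup>2)"
  shows "0 < integral\<^sup>L P (\<lambda>x. x\<^sup>2)"
proof (rule ccontr)
  assume "\<not> 0 < integral\<^sup>L P (\<lambda>x. x\<^sup>2)"
  moreover have "0 \<le> integral\<^sup>L P (\<lambda>x. x\<^sup>2)" by (rule Bochner_Integration.integral_nonneg) simp
  ultimately have "integral\<^sup>L P (\<lambda>x. x\<^sup>2) = 0" by simp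
  then have "AE x in P. x\<^sup>2 = 0"
    using integral_nonneg_eq_0_iff_AE[OF int] by simp
  moreover have "AE x in P. x \<noteq> 0"
  proof -
    have "AE x in lborel. x \<noteq> (0 :: real)" by (rule AE_lborel_singleton)
    then show ?thesis unfolding d using f by (subst AE_density) auto
  qed
  ultimately have "AE x in P. False" by eventually_elim simp
  then show False using prob_space.AE_False[OF P] by simp
qed

theorem theorem3p6p6:
  fixes M :: "nat \<Rightarrow> 'w measure"
    and X :: "nat \<Rightarrow> nat \<times> nat \<Rightarrow> 'w \<Rightarrow> real"
    and Y :: "nat \<Rightarrow> nat \<times> nat \<Rightarrow> nat \<times> nat \<Rightarrow> 'w \<Rightarrow> real"
    and P :: "real measure" and f :: "real \<Rightarrow> real" and \<sigma> \<beta> :: real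
  assumes "\<And>n. prob_space (M n)"
    and "\<And>n. prob_space.indep_vars (M n) (\<lambda>_. borel) (X n) (upper_triangle n)"
    and "\<And>n ij. ij \<in> upper_triangle n \<Longrightarrow> distr (M n) borel (X n ij) = P"
    and "prob_space P"
    and "f \<in> borel_measurable borel" and "\<And>x. f x \<ge> 0"
    and "P = density lborel (\<lambda>x. ennreal (f x))"
    and "prob_space.expectation P (\<lambda>x. x) = 0"
    and "\<sigma> \<ge> 0" and "prob_space.variance P (\<lambda>x. x) = \<sigma>\<^sup>2"
    and "\<beta> > 0"
    and "\<And>k::nat. k \<ge> 1 \<Longrightarrow> integrable P (\<lambda>x. \<bar>x\<bar> ^ k)"
    and "\<And>k::nat. k \<ge> 1 \<Longrightarrow>
           prob_space.expectation P (\<lambda>x. \<bar>x\<bar> ^ k) \<le> \<sigma> ^ k * real k powr (\<beta> * real k)"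
    and "\<And>n l. l \<in> upper_triangle n \<Longrightarrow> independent_copy (M n) (upper_triangle n) (X n) (Y n l)"
  shows "stable_under_small_perturbations M half_sphere euclidean_distance quadratic_form
           upper_triangle upper_triangle (\<lambda>n l. {l}) X Y"
proof -
  define \<mu> where "\<mu> = integral\<^sup>L P (\<lambda>x. x ^ 4)"
  have int: "integrable P (\<lambda>x. x\<^sup>2)" "integrable P (\<lambda>x. x ^ 4)"
    using assms(12)[of 2] assms(12)[of 4] by simp_all
  have var: "integral\<^sup>L P (\<lambda>x. x\<^sup>2) = \<sigma>\<^sup>2" using assms(8,10) by simp
  have \<sigma>: "0 < \<sigma>"
    using variance_pos_of_density[OF assms(4,5,7) int(1)] assms(9) var by (simp add: less_le)
  have \<mu>0: "0 \<le> \<mu>" unfolding \<mu>_def by (rule Bochner_Integration.integral_nonneg) simp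
  have wigner: "wigner (M n) (X n) n \<sigma> \<mu>" for n
  proof -
    interpret prob_space "M n" by (rule assms(1))
    have X: "X n l \<in> borel_measurable (M n)" if "l \<in> upper_triangle n" for l
      using assms(2)[of n] that by (simp add: indep_vars_def)
    have moments: "integral\<^sup>L (M n) (\<lambda>\<omega>. g (X n l \<omega>)) = integral\<^sup>L P g"
      "integrable (M n) (\<lambda>\<omega>. g (X n l \<omega>)) \<longleftrightarrow> integrable P g"
      if "l \<in> upper_triangle n" "g \<in> borel_measurable borel" for l and g :: "real \<Rightarrow> real"
      unfolding assms(3)[OF that(1), symmetric]
      using integral_distr[OF X[OF that(1)] that(2)] integrable_distr_eq[OF X[OF that(1)] that(2)] by simp_all
    show ?thesis
    proof (unfold_locales)
      show "integral\<^sup>L (M n) (X n l) = 0" if "l \<in> upper_triangle n" for l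
        using moments(1)[OF that, of "\<lambda>x. x"] assms(8) by simp
      show "integral\<^sup>L (M n) (\<lambda>\<omega>. (X n l \<omega>)\<^sup>2) = \<sigma>\<^sup>2" if "l \<in> upper_triangle n" for l
        using moments(1)[OF that, of "\<lambda>x. x\<^sup>2"] var by simp
      show "integral\<^sup>L (M n) (\<lambda>\<omega>. X n l \<omega> ^ 4) \<le> \<mu>" if "l \<in> upper_triangle n" for l
        using moments(1)[OF that, of "\<lambda>x. x ^ 4"] by (simp add: \<mu>_def)
      show "integrable (M n) (\<lambda>\<omega>. X n l \<omega> ^ 4)" if "l \<in> upper_triangle n" for l
        using moments(2)[OF that, of "\<lambda>x. x ^ 4"] int by simp
    qed (use assms(2) in auto)
  qed
  show ?thesis
    unfolding stable_under_small_perturbations_def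
  proof (intro conjI allI impI)
    fix \<epsilon>0 \<delta> :: real assume \<epsilon>0: "0 < \<epsilon>0" and \<delta>: "0 < \<delta>"
    define \<epsilon> where "\<epsilon> = min \<epsilon>0 1"
    have \<epsilon>: "0 < \<epsilon>" "\<epsilon> \<le> 1" "\<epsilon> \<le> \<epsilon>0" using \<epsilon>0 by (auto simp: \<epsilon>_def)
    \<comment> \<open>The budget: \<open>prob E \<le> \<eta>\<close> enters once directly and twice
      divided by \<open>\<epsilon>\<close>, large entries cost
      \<open>\<epsilon> * \<delta> / 8\<close> and localization twice
      \<open>\<epsilon> * \<delta> / 16\<close>, both divided by \<open>\<epsilon>\<close>; the
      total is at most \<open>5 * \<delta> / 8\<close>.\<close>
    define \<eta> where "\<eta> = \<epsilon> * \<delta> / 8"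
    have \<eta>: "0 < \<eta>" using \<epsilon> \<delta> by (simp add: \<eta>_def)
    define K where "K = nat \<lceil>16 * \<mu> / (\<eta> * \<sigma> ^ 4)\<rceil> + 1"
    have K: "0 < K" "8 * \<mu> / (K * \<sigma> ^ 4) \<le> \<eta> / 2"
    proof -
      show "0 < K" by (simp add: K_def)
      have "16 * \<mu> / (\<eta> * \<sigma> ^ 4) \<le> real K" unfolding K_def by linarith
      then show "8 * \<mu> / (K * \<sigma> ^ 4) \<le> \<eta> / 2" using \<eta> \<sigma> \<open>0 < K\<close> by (simp add: field_simps)
    qed
    define C1 where "C1 = 8 * \<sigma> / sqrt (\<epsilon> * \<delta>)"
    define C2 where "C2 = 2 + 256 * real K / (\<epsilon> * \<delta>)"
    have C1: "0 < C1" "8 * \<sigma>\<^sup>2 / C1\<^sup>2 = \<epsilon> * \<delta> / 8"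
      using \<epsilon> \<delta> \<sigma> by (auto simp: C1_def power_divide power_mult_distrib)
    have C2: "2 < C2" "16 * real K / (C2 - 2) = \<epsilon> * \<delta> / 16"
      using \<epsilon> \<delta> K by (auto simp: C2_def field_simps)
    \<comment> \<open>\<open>C / n\<close> is the tolerance \<open>4 * C1 * C2 / n\<close> after the
      Gram-Schmidt loss for radius \<open>\<epsilon> / 4\<close>.\<close>
    define C where "C = 4 * C1 * C2 * (2 / (\<epsilon> / 4)) ^ (2 * (2 * K))"
    have C: "0 < C" using C1 C2 \<epsilon> by (simp add: C_def)
    \<comment> \<open>With energies bounded by \<open>\<kappa> * n\<close> and tolerance
      \<open>2 * C / n\<close>, the powers of \<open>n\<close> cancel and
      \<open>48 * c * t \<le> \<sigma>\<^sup>2\<close> holds with equality.\<close>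
    define \<kappa> where "\<kappa> = \<sigma>\<^sup>2 / (96 * C)"
    have \<kappa>: "0 < \<kappa>" using \<sigma> C by (simp add: \<kappa>_def)
    show "\<exists>m::nat. limsup (\<lambda>n. outer_measure_of (M n) {\<omega> \<in> space (M n).
        enat m \<le> (INF A \<in> {A. A \<subseteq> upper_triangle n \<and> (1 - \<epsilon>0) * real (card (upper_triangle n)) < real (card A)}.
          packing_number
            ((\<lambda>l. arg_min_on (quadratic_form n (perturbed_input (upper_triangle n) {l} (X n) (Y n l) \<omega>)) (half_sphere n)) ` A)
            (euclidean_distance n) \<epsilon>0)}) \<le> ennreal \<delta>"
    proof (intro exI Limsup_bounded)
      \<comment> \<open>Beyond \<open>N\<close> the fourth-trace term
        \<open>3 * \<mu> / (\<kappa> ^ 4 * n)\<close> is at most \<open>\<eta> / 2\<close>.\<close>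
      define N where "N = nat \<lceil>6 * \<mu> / (\<kappa> ^ 4 * \<eta>)\<rceil> + 1"
      have "outer_measure_of (M n) {\<omega> \<in> space (M n).
        enat (packing_bound \<epsilon>0 (2 * K) + 1) \<le> (INF A \<in> {A. A \<subseteq> upper_triangle n \<and> (1 - \<epsilon>0) * real (card (upper_triangle n)) < real (card A)}.
          packing_number
            ((\<lambda>l. arg_min_on (quadratic_form n (perturbed_input (upper_triangle n) {l} (X n) (Y n l) \<omega>)) (half_sphere n)) ` A)
            (euclidean_distance n) \<epsilon>0)} \<le> ennreal \<delta>" if nN: "N \<le> n" for n
      proof -
        interpret wigner "M n" "X n" n \<sigma> \<mu> by (rule wigner)
        have n: "n \<ge> 1" using nN by (simp add: N_def)
        have "6 * \<mu> / (\<kappa> ^ 4 * \<eta>) \<le> real N" unfolding N_def by linarith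
        then have "6 * \<mu> / (\<kappa> ^ 4 * \<eta>) \<le> n" using nN by linarith
        then have tr: "3 * \<mu> * n ^ 3 / (\<kappa> * n) ^ 4 \<le> \<eta> / 2"
          using \<kappa> \<eta> n by (simp add: field_simps power3_eq_cube power4_eq_xxxx)
        define t where "t = C / n"
        have t: "0 < t" using C n by (simp add: t_def)
        define p where "p = (2 * sqrt n) ^ (2 * (2 * K))"
        have p: "1 \<le> p" unfolding p_def using n by (intro one_le_power) (smt (verit) of_nat_1 of_nat_mono real_sqrt_ge_one)
        \<comment> \<open>This mesh makes \<open>2 * n * h * p\<close> equal to \<open>t\<close>, so
          the rounding error stays within \<open>t\<close> even after the loss \<open>p\<close> of a
          cover of radius \<open>1 / sqrt n\<close>.\<close>
        define h where "h = t / (2 * real n * p)"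
        have h: "0 < h" "2 * real n * h * p \<le> t" using t p n by (auto simp: h_def)
        have "2 * real n * h * 1 \<le> 2 * real n * h * p" using h(1) p by (intro mult_left_mono) auto
        then have h2: "2 * real n * h \<le> t" using h(2) by simp
        have "48 * (\<kappa> * n) * (2 * t) \<le> \<sigma>\<^sup>2" using n C by (simp add: \<kappa>_def t_def)
        moreover have "real n * h \<le> 2 * t"
        proof -
          have "0 \<le> real n * h" using h(1) by simp
          then show ?thesis using h2 t by linarith
        qed
        ultimately obtain E where E: "E \<in> events" "prob E \<le> 8 * \<mu> / (K * \<sigma> ^ 4) + 3 * \<mu> * n ^ 3 / (\<kappa> * n) ^ 4"
          "\<And>\<omega>. \<omega> \<in> space (M n) \<Longrightarrow> degenerate n (2 * K) (\<lambda>l. X n l \<omega>) (2 * t) \<Longrightarrow> \<omega> \<in> E"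
          using degenerate_prob[OF n K(1) \<sigma> _ h(1), of "\<kappa> * n" "2 * t"] \<kappa> n by auto
        have PE: "prob E \<le> \<eta>" using E(2) K(2) tr by linarith
        have "prob E + (8 * \<sigma>\<^sup>2 / C1\<^sup>2 + 2 * (prob E + 16 * real K / (C2 - 2))) / \<epsilon>
            \<le> \<eta> + (\<epsilon> * \<delta> / 8 + 2 * (\<eta> + \<epsilon> * \<delta> / 16)) / \<epsilon>"
          unfolding C1(2) C2(2) using PE \<epsilon> by (intro add_mono divide_right_mono) auto
        also have "\<dots> = \<epsilon> * \<delta> / 8 + \<delta> / 2" using \<epsilon> by (simp add: \<eta>_def field_simps)
        also have "\<dots> \<le> 1 * \<delta> / 8 + \<delta> / 2" using \<epsilon> \<delta> by (intro add_mono divide_right_mono mult_right_mono) auto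
        also have "\<dots> \<le> \<delta>" using \<delta> by simp
        finally have total: "prob E + (8 * \<sigma>\<^sup>2 / C1\<^sup>2 + 2 * (prob E + 16 * real K / (C2 - 2))) / \<epsilon> \<le> \<delta>" .
        have "4 * C1 * C2 / n * (2 / (\<epsilon> / 4)) ^ (2 * (2 * K)) \<le> t" by (simp add: t_def C_def)
        from instability_prob[OF n \<epsilon> C1(1) C2(1) this h(1) h(2)[unfolded p_def] h2 E(1) E(3) assms(14)]
        show ?thesis by (rule order_trans) (use total in \<open>auto intro: ennreal_leI\<close>)
      qed
      then show "\<forall>\<^sub>F n in sequentially. outer_measure_of (M n) {\<omega> \<in> space (M n).
        enat (packing_bound \<epsilon>0 (2 * K) + 1) \<le> (INF A \<in> {A. A \<subseteq> upper_triangle n \<and> (1 - \<epsilon>0) * real (card (upper_triangle n)) < real (card A)}.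
          packing_number
            ((\<lambda>l. arg_min_on (quadratic_form n (perturbed_input (upper_triangle n) {l} (X n) (Y n l) \<omega>)) (half_sphere n)) ` A)
            (euclidean_distance n) \<epsilon>0)} \<le> ennreal \<delta>"
        unfolding eventually_sequentially by blast
    qed
  qed auto
qed

end
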